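(* For any $d\in\mathbb{N}$ there exists a constant $C\ge0$ such that the following holds: if $\Omega\ne\varnothing$ is an open subset of $\mathbb{R}^d$ with $\sigma_{\rm ess}(H_\Omega)=\varnothing$, then $$\|\Phi\|_1^2\le C\,\lambda_1^{-d/2}\left(\theta^{-d}\Bigl(\frac{\lambda_k}{\lambda_1}\Bigr)^d\bigl(\log N_{(1+\theta)\lambda_k}\bigr)^d\,N_{(1+\theta)\lambda_k}+\theta^{-4d}\Bigl(\frac{\lambda_k}{\lambda_1}\Bigr)^{4d-3}\right)\|\Phi\|_2^2$$ for all $0<\theta\le1$, for all $k$, and for all eigenfunctions $\Phi$ of $H_\Omega$ associated with the eigenvalue $\lambda_k$.
   Context: For an open set $\varnothing\ne\Omega\subseteq\mathbb{R}^d$, $H_\Omega$ denotes the Dirichlet Laplacian on $\Omega$, i.e. the Friedrichs extension of $-\Delta$ on $C_c^\infty(\Omega)$ in $L_2(\Omega)$ (form domain $H_0^1(\Omega)$, form $\int_\Omega\nabla u\cdot\overline{\nabla v}\,dx$). When $\sigma_{\rm ess}(H_\Omega)=\varnothing$, $\lambda_1\le\lambda_2\le\dots$ denote the eigenvalues of $H_\Omega$ in increasing order, repeated according to multiplicity. $N_t=N_t(H_\Omega)$ is the number of eigenvalues of $H_\Omega$ less than or equal to $t$, counting multiplicities. $\|\cdot\|_p$ is the norm of $L_p(\Omega)$. *)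

theory Defs
  imports "HOL-Analysis.Analysis"
begin

text \<open>
  Elements of \<open>L\<^sub>p(\<Omega>)\<close> are represented by functions on the whole space, of which only the
  restriction to \<open>\<Omega>\<close> matters, and identification is up to almost everywhere equality on \<open>\<Omega>\<close>.
  All function spaces are complex; the partial derivatives are those in the directions of the
  orthonormal basis \<open>Basis\<close>.
\<close>

definition Lp_norm :: "real \<Rightarrow> 'a::euclidean_space set \<Rightarrow> ('a \<Rightarrow> complex) \<Rightarrow> ennreal" where
  "Lp_norm p \<Omega> f =
     (let I = (\<integral>\<^sup>+x. ennreal (norm (f x) powr p) \<partial>lebesgue_on \<Omega>)
      in if I = \<infinity> then \<infinity> else ennreal (enn2real I powr (1 / p)))"

definition L2 :: "'a::euclidean_space set \<Rightarrow> ('a \<Rightarrow> complex) set" where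
  "L2 \<Omega> = {f. f \<in> borel_measurable (lebesgue_on \<Omega>) \<and> Lp_norm 2 \<Omega> f < \<infinity>}"

definition L2_inner :: "'a::euclidean_space set \<Rightarrow> ('a \<Rightarrow> complex) \<Rightarrow> ('a \<Rightarrow> complex) \<Rightarrow> complex" where
  "L2_inner \<Omega> f g = (LINT x|lebesgue_on \<Omega>. f x * cnj (g x))"

definition partial_deriv :: "'a::euclidean_space \<Rightarrow> ('a \<Rightarrow> complex) \<Rightarrow> 'a \<Rightarrow> complex" where
  "partial_deriv i f x = frechet_derivative f (at x) i"

fun C_k :: "nat \<Rightarrow> ('a::euclidean_space \<Rightarrow> complex) \<Rightarrow> bool" where
  "C_k 0 f \<longleftrightarrow> continuous_on UNIV f"
| "C_k (Suc k) f \<longleftrightarrow> (\<forall>x. f differentiable (at x)) \<and> (\<forall>i\<in>Basis. C_k k (partial_deriv i f))"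

definition test_functions :: "'a::euclidean_space set \<Rightarrow> ('a \<Rightarrow> complex) set" where
  "test_functions \<Omega> =
     {\<phi>. (\<forall>k. C_k k \<phi>) \<and> compact (closure {x. \<phi> x \<noteq> 0}) \<and> closure {x. \<phi> x \<noteq> 0} \<subseteq> \<Omega>}"

definition is_weak_deriv ::
  "'a::euclidean_space set \<Rightarrow> 'a \<Rightarrow> ('a \<Rightarrow> complex) \<Rightarrow> ('a \<Rightarrow> complex) \<Rightarrow> bool" where
  "is_weak_deriv \<Omega> i u g \<longleftrightarrow>
     (\<forall>\<phi>\<in>test_functions \<Omega>.
        (LINT x|lebesgue_on \<Omega>. u x * partial_deriv i \<phi> x) = - (LINT x|lebesgue_on \<Omega>. g x * \<phi> x))"

definition H1 :: "'a::euclidean_space set \<Rightarrow> ('a \<Rightarrow> complex) set" where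
  "H1 \<Omega> = {u \<in> L2 \<Omega>. \<forall>i\<in>Basis. \<exists>g\<in>L2 \<Omega>. is_weak_deriv \<Omega> i u g}"

text \<open>The choice below is unique up to a null set for \<open>u \<in> H1 \<Omega>\<close>.\<close>

definition weak_deriv :: "'a::euclidean_space set \<Rightarrow> 'a \<Rightarrow> ('a \<Rightarrow> complex) \<Rightarrow> 'a \<Rightarrow> complex" where
  "weak_deriv \<Omega> i u = (SOME g. g \<in> L2 \<Omega> \<and> is_weak_deriv \<Omega> i u g)"

text \<open>The closure of the test functions in the norm of \<open>H1 \<Omega>\<close>.\<close>

definition H01 :: "'a::euclidean_space set \<Rightarrow> ('a \<Rightarrow> complex) set" where
  "H01 \<Omega> =
     {u \<in> H1 \<Omega>. \<exists>\<phi>. (\<forall>n::nat. \<phi> n \<in> test_functions \<Omega>) \<and>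
        (\<lambda>n. Lp_norm 2 \<Omega> (\<lambda>x. \<phi> n x - u x)) \<longlonglongrightarrow> 0 \<and>
        (\<forall>i\<in>Basis. (\<lambda>n. Lp_norm 2 \<Omega> (\<lambda>x. partial_deriv i (\<phi> n) x - weak_deriv \<Omega> i u x)) \<longlonglongrightarrow> 0)}"

definition dirichlet_form ::
  "'a::euclidean_space set \<Rightarrow> ('a \<Rightarrow> complex) \<Rightarrow> ('a \<Rightarrow> complex) \<Rightarrow> complex" where
  "dirichlet_form \<Omega> u v = (\<Sum>i\<in>Basis. L2_inner \<Omega> (weak_deriv \<Omega> i u) (weak_deriv \<Omega> i v))"

text \<open>
  The graph of the self-adjoint operator \<open>H\<^sub>\<Omega>\<close> associated with the form above on \<open>H01 \<Omega>\<close>: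
  \<open>dirichlet_laplacian \<Omega> u f\<close> means that \<open>u\<close> is in the domain of \<open>H\<^sub>\<Omega>\<close> and \<open>H\<^sub>\<Omega> u = f\<close>.
\<close>

definition dirichlet_laplacian ::
  "'a::euclidean_space set \<Rightarrow> ('a \<Rightarrow> complex) \<Rightarrow> ('a \<Rightarrow> complex) \<Rightarrow> bool" where
  "dirichlet_laplacian \<Omega> u f \<longleftrightarrow>
     u \<in> H01 \<Omega> \<and> f \<in> L2 \<Omega> \<and> (\<forall>v\<in>H01 \<Omega>. dirichlet_form \<Omega> u v = L2_inner \<Omega> f v)"

text \<open>
  The equation \<open>(H\<^sub>\<Omega> - z) u = f\<close> is written as \<open>H\<^sub>\<Omega> u = f + z u\<close>. The norm bound says that
  the inverse of \<open>H\<^sub>\<Omega> - z\<close> is bounded; it contains the injectivity of \<open>H\<^sub>\<Omega> - z\<close>.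
\<close>

definition resolvent_set :: "'a::euclidean_space set \<Rightarrow> complex set" where
  "resolvent_set \<Omega> =
     {z. (\<forall>f\<in>L2 \<Omega>. \<exists>u. dirichlet_laplacian \<Omega> u (\<lambda>x. f x + z * u x)) \<and>
         (\<exists>M::real. \<forall>f\<in>L2 \<Omega>. \<forall>u. dirichlet_laplacian \<Omega> u (\<lambda>x. f x + z * u x) \<longrightarrow>
            Lp_norm 2 \<Omega> u \<le> ennreal M * Lp_norm 2 \<Omega> f)}"

definition spectrum :: "'a::euclidean_space set \<Rightarrow> complex set" where
  "spectrum \<Omega> = - resolvent_set \<Omega>"

definition eigenspace :: "'a::euclidean_space set \<Rightarrow> complex \<Rightarrow> ('a \<Rightarrow> complex) set" where
  "eigenspace \<Omega> z = {u. dirichlet_laplacian \<Omega> u (\<lambda>x. z * u x)}"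

definition eigenfunction :: "'a::euclidean_space set \<Rightarrow> complex \<Rightarrow> ('a \<Rightarrow> complex) \<Rightarrow> bool" where
  "eigenfunction \<Omega> z u \<longleftrightarrow> u \<in> eigenspace \<Omega> z \<and> \<not> (AE x in lebesgue_on \<Omega>. u x = 0)"

definition eigenvalue :: "'a::euclidean_space set \<Rightarrow> complex \<Rightarrow> bool" where
  "eigenvalue \<Omega> z \<longleftrightarrow> (\<exists>u. eigenfunction \<Omega> z u)"

text \<open>The complex dimension of the eigenspace, modulo almost everywhere equality, is \<open>n\<close>.\<close>

definition has_multiplicity :: "'a::euclidean_space set \<Rightarrow> complex \<Rightarrow> nat \<Rightarrow> bool" where
  "has_multiplicity \<Omega> z n \<longleftrightarrow>
     (\<exists>e. (\<forall>i<n. e i \<in> eigenspace \<Omega> z) \<and>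
          (\<forall>c::nat \<Rightarrow> complex. (AE x in lebesgue_on \<Omega>. (\<Sum>i<n. c i * e i x) = 0) \<longrightarrow> (\<forall>i<n. c i = 0)) \<and>
          (\<forall>u\<in>eigenspace \<Omega> z. \<exists>c::nat \<Rightarrow> complex. AE x in lebesgue_on \<Omega>. u x = (\<Sum>i<n. c i * e i x)))"

definition eigen_multiplicity :: "'a::euclidean_space set \<Rightarrow> complex \<Rightarrow> nat" where
  "eigen_multiplicity \<Omega> z = (THE n. has_multiplicity \<Omega> z n)"

definition discrete_spectrum :: "'a::euclidean_space set \<Rightarrow> complex set" where
  "discrete_spectrum \<Omega> =
     {z. z isolated_in spectrum \<Omega> \<and> eigenvalue \<Omega> z \<and> (\<exists>n. has_multiplicity \<Omega> z n)}"

definition essential_spectrum :: "'a::euclidean_space set \<Rightarrow> complex set" where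
  "essential_spectrum \<Omega> = spectrum \<Omega> - discrete_spectrum \<Omega>"

text \<open>
  \<open>\<lambda> 1 \<le> \<lambda> 2 \<le> \<dots>\<close> are all the eigenvalues, each repeated according to its multiplicity;
  the value \<open>\<lambda> 0\<close> is irrelevant. A number that is not an eigenvalue has multiplicity \<open>0\<close>
  and so does not occur. Eigenvalues are real because the operator is self-adjoint.
\<close>

definition eigenvalue_enumeration :: "'a::euclidean_space set \<Rightarrow> (nat \<Rightarrow> real) \<Rightarrow> bool" where
  "eigenvalue_enumeration \<Omega> lam \<longleftrightarrow>
     mono_on {1..} lam \<and>
     (\<forall>\<mu>::real. finite {k. 1 \<le> k \<and> lam k = \<mu>} \<and>
        has_multiplicity \<Omega> (complex_of_real \<mu>) (card {k. 1 \<le> k \<and> lam k = \<mu>}))"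

text \<open>
  Meaningful when there are finitely many eigenvalues up to \<open>t\<close>, all of finite multiplicity,
  in particular when the essential spectrum is empty.
\<close>

definition eigenvalue_count :: "'a::euclidean_space set \<Rightarrow> real \<Rightarrow> nat" where
  "eigenvalue_count \<Omega> t =
     (\<Sum>\<mu> | \<mu> \<le> t \<and> eigenvalue \<Omega> (complex_of_real \<mu>). eigen_multiplicity \<Omega> (complex_of_real \<mu>))"

end

(*
  The eigenfunction u of eigenvalue l is localised with smooth bumps chi_y supported in balls of
  radius 2r, r^2 ~ 1/(theta l). Since the form of chi_y u is l |chi_y u|^2 + int |grad chi_y|^2 |u|^2,
  the points y where int |grad chi_y|^2 |u|^2 < theta l int chi_y^2 |u|^2 yield, when 4r-separated,
  orthogonal trial functions of energy below (1 + theta) l; by the variational principle there are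
  at most N of them. Away from the N balls of radius 4r around these points the reverse
  inequality says that the local L2 norm of u is a small fraction of the sum of its values at
  boundedly many neighbours, so that the integral of the local L2 norms is dominated by its part
  over the N balls. Hence |u|_1^2 <= C N (theta l)^(-d/2) |u|_2^2, which is stronger than the claim.

  The variational principle is proved without the spectral theorem: if the form on the complement
  of the eigenvectors had infimum mu below the threshold, the isolated point mu of the spectrum
  would be an eigenvalue with an eigenvector in that complement.
*)

theory Submission
  imports Defs "HOL-Library.Function_Algebras"
begin

section \<open>Semi-inner products\<close>

text \<open>Elements of \<open>L2 \<Omega>\<close> are functions rather than classes, so the
  abstract part works in spaces with null vectors: operators are relations, and equality means that
  a difference is null. About the spectrum only what the definition of the resolvent set supplies is
  available, namely lower bounds for \<open>H - z\<close> at regular points. Near an isolated point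
  the functional calculus is replaced by Cauchy-Schwarz for forms such as that of
  \<open>(K - c)^2 - m\<close>, which lets a supposedly optimal bound be improved. Three obstacles
  shape the analysis. The cut-offs are not supported in \<open>\<Omega>\<close>; this is harmless
  because multiplication by them preserves \<open>H01 \<Omega>\<close>, and no regularity of the
  boundary enters. The integral of the local L2 norms over the whole space is not known to be
  finite, so the half of it produced by the neighbours cannot simply be subtracted; it is truncated
  to balls, where it grows only polynomially, and the factor 1/2 is iterated. Finally
  \<open>\<Omega>\<close> may be unbounded, so strict positivity of the first eigenvalue needs a
  weighted Poincare inequality.\<close>

lemma homogeneous_system:
  fixes A :: "'j \<Rightarrow> 'i \<Rightarrow> 'a::field"
  assumes "finite I" "finite J" "card I < card J"
  shows "\<exists>c. (\<exists>j\<in>J. c j \<noteq> 0) \<and> (\<forall>i\<in>I. (\<Sum>j\<in>J. c j * A j i) = 0)"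
  using assms
proof (induction I arbitrary: J A rule: finite_induct)
  case empty
  then have "J \<noteq> {}" by auto
  then show ?case by (intro exI[of _ "\<lambda>_. 1"]) auto
next
  case (insert i I)
  show ?case
  proof (cases "\<forall>j\<in>J. A j i = 0")
    case True
    with insert.IH[of J A] insert show ?thesis by auto
  next
    case False
    then obtain j0 where j0: "j0 \<in> J" "A j0 i \<noteq> 0" by blast
    define J' where "J' = J - {j0}"
    have J': "finite J'" "card I < card J'" using insert j0 by (auto simp: J'_def)
    \<comment> \<open>Gaussian elimination: the unknown \<open>j0\<close> is eliminated by means of
      equation \<open>i\<close>, and \<open>A'\<close> holds the coefficients of what
      remains.\<close>
    define A' where "A' j k = A j k - A j i / A j0 i * A j0 k" for j k
    obtain c where c: "\<exists>j\<in>J'. c j \<noteq> 0" "\<And>k. k \<in> I \<Longrightarrow> (\<Sum>j\<in>J'. c j * A' j k) = 0"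
      using insert.IH[OF J', of A'] by blast
    define s where "s = - (\<Sum>j\<in>J'. c j * A j i) / A j0 i"
    define c' where "c' = c(j0 := s)"
    have split: "(\<Sum>j\<in>J. c' j * A j k) = s * A j0 k + (\<Sum>j\<in>J'. c j * A j k)" for k
      unfolding J'_def using insert.prems j0 by (subst sum.remove[of _ j0]) (auto simp: c'_def intro!: sum.cong)
    have "(\<Sum>j\<in>J. c' j * A j k) = 0" if "k \<in> insert i I" for k
    proof (cases "k = i")
      case True
      then show ?thesis unfolding split using j0 by (simp add: s_def)
    next
      case False
      have "(\<Sum>j\<in>J'. c j * A' j k) = (\<Sum>j\<in>J'. c j * A j k) - (\<Sum>j\<in>J'. c j * A j i) / A j0 i * A j0 k"
        by (simp add: A'_def algebra_simps sum_subtractf sum_distrib_left sum_distrib_right sum_divide_distrib)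
      then show ?thesis unfolding split using c(2)[of k] that False by (simp add: s_def)
    qed
    moreover have "\<exists>j\<in>J. c' j \<noteq> 0" using c(1) by (auto simp: c'_def J'_def)
    ultimately show ?thesis by blast
  qed
qed

text \<open>Positivity without definiteness, because a function that vanishes almost everywhere is
  null without being zero. The form is constrained only on the carrier \<open>S\<close>, so that one
  type of functions can carry both \<open>L2 \<Omega>\<close> and, with another form,
  \<open>H01 \<Omega>\<close>.\<close>

locale semi_inner = vector_space sc for sc :: "complex \<Rightarrow> 'v::ab_group_add \<Rightarrow> 'v" +
  fixes S :: "'v set" and ip :: "'v \<Rightarrow> 'v \<Rightarrow> complex"
  assumes subspace_S: "subspace S"
    and ip_add: "\<lbrakk>x \<in> S; y \<in> S; z \<in> S\<rbrakk> \<Longrightarrow> ip (x + y) z = ip x z + ip y z"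
    and ip_scale: "\<lbrakk>x \<in> S; z \<in> S\<rbrakk> \<Longrightarrow> ip (sc c x) z = c * ip x z"
    and ip_herm: "\<lbrakk>x \<in> S; y \<in> S\<rbrakk> \<Longrightarrow> ip y x = cnj (ip x y)"
    and ip_nonneg: "x \<in> S \<Longrightarrow> 0 \<le> Re (ip x x)"
begin

lemma in_S [simp, intro]: "0 \<in> S" "\<lbrakk>x \<in> S; y \<in> S\<rbrakk> \<Longrightarrow> x + y \<in> S" "\<lbrakk>x \<in> S; y \<in> S\<rbrakk> \<Longrightarrow> x - y \<in> S"
  "x \<in> S \<Longrightarrow> sc c x \<in> S" "x \<in> S \<Longrightarrow> - x \<in> S"
  using subspace_S by (auto intro: subspace_0 subspace_add subspace_diff subspace_scale subspace_neg)

lemma in_S_sum [intro]: "(\<And>i. i \<in> I \<Longrightarrow> x i \<in> S) \<Longrightarrow> (\<Sum>i\<in>I. x i) \<in> S"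
  using subspace_S by (rule subspace_sum)

lemma ip_add_right: "\<lbrakk>x \<in> S; y \<in> S; z \<in> S\<rbrakk> \<Longrightarrow> ip z (x + y) = ip z x + ip z y"
  by (metis complex_cnj_add in_S(2) ip_add ip_herm)

lemma ip_scale_right: "\<lbrakk>x \<in> S; z \<in> S\<rbrakk> \<Longrightarrow> ip z (sc c x) = cnj c * ip z x"
  by (metis complex_cnj_mult in_S(4) ip_scale ip_herm)

lemma ip_minus: "\<lbrakk>x \<in> S; z \<in> S\<rbrakk> \<Longrightarrow> ip (- x) z = - ip x z"
  using ip_scale[of x z "-1"] by simp

lemma ip_diff: "\<lbrakk>x \<in> S; y \<in> S; z \<in> S\<rbrakk> \<Longrightarrow> ip (x - y) z = ip x z - ip y z"
  using ip_add[of x "-y" z] ip_minus[of y z] by simp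

lemma ip_diff_right: "\<lbrakk>x \<in> S; y \<in> S; z \<in> S\<rbrakk> \<Longrightarrow> ip z (x - y) = ip z x - ip z y"
  by (metis complex_cnj_diff in_S(3) ip_diff ip_herm)

lemma ip_zero: "z \<in> S \<Longrightarrow> ip 0 z = 0"
  using ip_diff[of z z z] by simp

lemma ip_zero_right: "z \<in> S \<Longrightarrow> ip z 0 = 0"
  using ip_diff_right[of z z z] by simp

lemma ip_sum: "(\<And>i. i \<in> I \<Longrightarrow> x i \<in> S) \<Longrightarrow> z \<in> S \<Longrightarrow> ip (\<Sum>i\<in>I. x i) z = (\<Sum>i\<in>I. ip (x i) z)"
proof (induction I rule: infinite_finite_induct)
  case (insert i I)
  then have "x i \<in> S" "(\<Sum>i\<in>I. x i) \<in> S" by auto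
  with insert show ?case by (simp add: ip_add)
qed (auto simp: ip_zero)

lemma ip_sum_right: "(\<And>i. i \<in> I \<Longrightarrow> x i \<in> S) \<Longrightarrow> z \<in> S \<Longrightarrow> ip z (\<Sum>i\<in>I. x i) = (\<Sum>i\<in>I. ip z (x i))"
proof (induction I rule: infinite_finite_induct)
  case (insert i I)
  then have "x i \<in> S" "(\<Sum>i\<in>I. x i) \<in> S" by auto
  with insert show ?case by (simp add: ip_add_right)
qed (auto simp: ip_zero_right)

lemmas ip_simps = ip_add ip_scale ip_add_right ip_scale_right ip_diff ip_diff_right ip_zero ip_zero_right

lemma ip_self: "x \<in> S \<Longrightarrow> ip x x = of_real (Re (ip x x))"
  using ip_herm[of x x] by (simp add: complex_eq_iff)

lemma Re_ip_comm: "\<lbrakk>x \<in> S; y \<in> S\<rbrakk> \<Longrightarrow> Re (ip y x) = Re (ip x y)"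
  by (subst ip_herm) auto

text \<open>Pythagoras with coefficients; it serves the inner product and the energy form alike,
  since the localised functions are orthogonal for both.\<close>

lemma ip_orthogonal_sum:
  assumes fin: "finite J" and f: "\<And>j. j \<in> J \<Longrightarrow> f j \<in> S"
    and orth: "\<And>j k. \<lbrakk>j \<in> J; k \<in> J; j \<noteq> k\<rbrakk> \<Longrightarrow> ip (f j) (f k) = 0"
  shows "Re (ip (\<Sum>j\<in>J. sc (c j) (f j)) (\<Sum>j\<in>J. sc (c j) (f j))) = (\<Sum>j\<in>J. (cmod (c j))\<^sup>2 * Re (ip (f j) (f j)))"
proof -
  define u where "u = (\<Sum>j\<in>J. sc (c j) (f j))"
  have u: "u \<in> S" unfolding u_def using f by auto
  have "ip (sc (c j) (f j)) u = of_real ((cmod (c j))\<^sup>2 * Re (ip (f j) (f j)))" if j: "j \<in> J" for j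
  proof -
    have "ip (f j) u = (\<Sum>k\<in>J. ip (f j) (sc (c k) (f k)))"
      unfolding u_def by (rule ip_sum_right) (use f j in auto)
    also have "\<dots> = (\<Sum>k\<in>J. if k = j then cnj (c j) * ip (f j) (f j) else 0)"
      by (rule sum.cong) (use f j orth in \<open>auto simp: ip_scale_right\<close>)
    also have "\<dots> = cnj (c j) * ip (f j) (f j)" using fin j by simp
    finally have "ip (sc (c j) (f j)) u = (c j * cnj (c j)) * ip (f j) (f j)" using f[OF j] u by (simp add: ip_scale)
    also have "\<dots> = of_real ((cmod (c j))\<^sup>2 * Re (ip (f j) (f j)))"
      using complex_norm_square[of "c j"] ip_self[OF f[OF j]] by simp
    finally show ?thesis .
  qed
  then have "(\<Sum>j\<in>J. ip (sc (c j) (f j)) u) = (\<Sum>j\<in>J. of_real ((cmod (c j))\<^sup>2 * Re (ip (f j) (f j))))"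
    by (intro sum.cong) auto
  moreover have "ip u u = (\<Sum>j\<in>J. ip (sc (c j) (f j)) u)"
    by (subst u_def) (use f u in \<open>auto intro!: ip_sum\<close>)
  ultimately show ?thesis unfolding u_def[symmetric] by (simp del: of_real_mult of_real_power)
qed

definition nm :: "'v \<Rightarrow> real" where "nm x = sqrt (Re (ip x x))"

lemma nm_nonneg [simp]: "x \<in> S \<Longrightarrow> 0 \<le> nm x"
  by (simp add: nm_def ip_nonneg)

lemma nm_sq: "x \<in> S \<Longrightarrow> (nm x)\<^sup>2 = Re (ip x x)"
  by (simp add: nm_def ip_nonneg)

text \<open>Expands the square of \<open>x - r p y\<close> with \<open>p = ip x y\<close> and real
  \<open>r\<close>. Definiteness is missing, so a null \<open>y\<close> is a case of its own: there
  the expansion is affine in \<open>r\<close>, and unless \<open>p = 0\<close> a suitable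
  \<open>r\<close> gives it the value -1.\<close>

lemma cauchy_schwarz_sq:
  assumes x: "x \<in> S" and y: "y \<in> S"
  shows "(cmod (ip x y))\<^sup>2 \<le> Re (ip x x) * Re (ip y y)"
proof -
  define A B where "A = Re (ip x x)" and "B = Re (ip y y)"
  define p where "p = ip x y"
  have yx: "ip y x = cnj p" using ip_herm[OF x y] by (simp add: p_def)
  have xx: "ip x x = of_real A" "ip y y = of_real B" using ip_self x y by (auto simp: A_def B_def)
  have pp: "p * cnj p = of_real ((cmod p)\<^sup>2)" by (rule complex_norm_square[symmetric])
  have key: "0 \<le> A - 2 * r * (cmod p)\<^sup>2 + r\<^sup>2 * (cmod p)\<^sup>2 * B" for r :: real
  proof -
    define c where "c = of_real r * p"
    have "ip (x - sc c y) (x - sc c y) = of_real A - cnj c * p - c * cnj p + c * cnj c * of_real B"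
      using x y by (simp add: ip_simps p_def[symmetric] yx xx algebra_simps)
    also have "\<dots> = of_real (A - 2 * r * (cmod p)\<^sup>2 + r\<^sup>2 * (cmod p)\<^sup>2 * B)"
    proof -
      have "cnj c * p = of_real r * (p * cnj p)" "c * cnj p = of_real r * (p * cnj p)"
        "c * cnj c = of_real (r\<^sup>2) * (p * cnj p)"
        by (auto simp: c_def power2_eq_square)
      then show ?thesis unfolding pp by (simp add: algebra_simps)
    qed
    finally show ?thesis using ip_nonneg[of "x - sc c y"] x y by auto
  qed
  have A0: "0 \<le> A" "0 \<le> B" using ip_nonneg x y by (auto simp: A_def B_def)
  show ?thesis
  proof (cases "B = 0")
    case True
    have "(cmod p)\<^sup>2 = 0"
    proof (rule ccontr)
      assume "(cmod p)\<^sup>2 \<noteq> 0"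
      then have "0 < (cmod p)\<^sup>2" by simp
      then show False using key[of "(A + 1) / (2 * (cmod p)\<^sup>2)"] True by (simp add: field_simps)
    qed
    then show ?thesis using A0 by (simp add: p_def A_def B_def)
  next
    case False
    then have B: "0 < B" using A0 by simp
    have "0 \<le> A - 2 * (1/B) * (cmod p)\<^sup>2 + (1/B)\<^sup>2 * (cmod p)\<^sup>2 * B" by (rule key)
    also have "(1/B)\<^sup>2 * (cmod p)\<^sup>2 * B = (1/B) * (cmod p)\<^sup>2"
      using B by (simp add: power2_eq_square)
    finally have "(cmod p)\<^sup>2 \<le> A * B" using B by (simp add: field_simps)
    then show ?thesis by (simp add: p_def A_def B_def)
  qed
qed

lemma cauchy_schwarz: "\<lbrakk>x \<in> S; y \<in> S\<rbrakk> \<Longrightarrow> cmod (ip x y) \<le> nm x * nm y"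
  using cauchy_schwarz_sq[of x y] nm_sq[of x] nm_sq[of y]
  by (metis mult_nonneg_nonneg nm_nonneg power2_le_imp_le power_mult_distrib)

lemma Re_cauchy_schwarz: "\<lbrakk>x \<in> S; y \<in> S\<rbrakk> \<Longrightarrow> Re (ip x y) \<le> nm x * nm y"
  using cauchy_schwarz[of x y] complex_Re_le_cmod[of "ip x y"] by linarith

lemma nm_triangle:
  assumes x: "x \<in> S" and y: "y \<in> S" shows "nm (x + y) \<le> nm x + nm y"
proof (rule power2_le_imp_le)
  have "(nm (x + y))\<^sup>2 = (nm x)\<^sup>2 + 2 * Re (ip x y) + (nm y)\<^sup>2"
    using x y by (simp add: nm_sq ip_simps Re_ip_comm[of x y])
  also have "\<dots> \<le> (nm x + nm y)\<^sup>2"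
    using Re_cauchy_schwarz[OF x y] by (simp add: power2_sum)
  finally show "(nm (x + y))\<^sup>2 \<le> (nm x + nm y)\<^sup>2" .
qed (use x y in auto)

lemma nm_scale: "x \<in> S \<Longrightarrow> nm (sc c x) = cmod c * nm x"
proof -
  assume x: "x \<in> S"
  have "ip (sc c x) (sc c x) = (c * cnj c) * ip x x" using x by (simp add: ip_simps)
  also have "\<dots> = of_real ((cmod c)\<^sup>2 * Re (ip x x))"
    using ip_self[OF x] complex_norm_square[of c] by simp
  finally show ?thesis by (simp add: nm_def real_sqrt_mult)
qed

lemma nm_minus: "x \<in> S \<Longrightarrow> nm (- x) = nm x"
  using nm_scale[of x "-1"] by simp

lemma nm_minus_commute: "\<lbrakk>x \<in> S; y \<in> S\<rbrakk> \<Longrightarrow> nm (x - y) = nm (y - x)"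
  using nm_minus[of "x - y"] by simp

lemma nm_diff_triangle:
  assumes "x \<in> S" "y \<in> S" shows "nm x \<le> nm y + nm (x - y)"
  using nm_triangle[of y "x - y"] assms by simp

lemma ip_null: "\<lbrakk>x \<in> S; y \<in> S; nm x = 0\<rbrakk> \<Longrightarrow> ip x y = 0"
  using cauchy_schwarz[of x y] by simp

lemma ip_weakly_eq_nm:
  assumes "x \<in> S" "y \<in> S" "\<And>z. z \<in> S \<Longrightarrow> ip x z = ip y z"
  shows "nm (x - y) = 0"
  using assms by (simp add: nm_def ip_diff)

lemma nm_eq: assumes "x \<in> S" "y \<in> S" "nm (x - y) = 0" shows "nm x = nm y"
  using nm_diff_triangle[of x y] nm_diff_triangle[of y x] nm_minus_commute[of x y] assms by simp

end

section \<open>Symmetric contractions with a spectral gap above 0\<close>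

text \<open>\<open>K\<close> is linear only modulo null vectors, which follows from its symmetry.\<close>

locale sym_contraction = semi_inner sc S ip for sc :: "complex \<Rightarrow> 'v::ab_group_add \<Rightarrow> 'v" and S ip +
  fixes K :: "'v \<Rightarrow> 'v"
  assumes K_in [simp, intro]: "x \<in> S \<Longrightarrow> K x \<in> S"
    and K_sym: "\<lbrakk>x \<in> S; y \<in> S\<rbrakk> \<Longrightarrow> ip (K x) y = ip x (K y)"
    and K_contr: "x \<in> S \<Longrightarrow> (nm (K x))\<^sup>2 \<le> Re (ip (K x) x)"
begin

lemma nm_K_le: assumes x: "x \<in> S" shows "nm (K x) \<le> nm x"
proof -
  have "nm (K x) * nm (K x) \<le> nm (K x) * nm x"
    using K_contr[OF x] Re_cauchy_schwarz[of "K x" x] x by (simp add: power2_eq_square)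
  then show ?thesis using nm_nonneg[of "K x"] nm_nonneg[of x] x
    by (metis K_in mult_le_cancel_left_pos order_le_less)
qed

lemma nm_K_diff: assumes x: "x \<in> S" and y: "y \<in> S" shows "nm (K x - K y) = nm (K (x - y))"
  by (rule nm_eq) (use x y in \<open>auto intro!: ip_weakly_eq_nm simp: ip_simps K_sym\<close>)

text \<open>Spectrally, a set that avoids \<open>(0, 2c)\<close> keeps distance \<open>c\<close>
  from the point \<open>c\<close>. In place of the spectral theorem, take the best constant
  \<open>m \<le> c^2\<close> in \<open>(K - c)^2 \<ge> m\<close>. If \<open>m < c^2\<close>, then
  \<open>(K - c)^2 - m\<close> is a product of two shifts of \<open>K\<close> at points of
  \<open>(0, 2c)\<close>; both are bounded below, which makes \<open>m\<close> improvable.\<close>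

lemma gap_square:
  assumes c: "0 < c" "\<And>k. \<lbrakk>0 < k; k < 2 * c\<rbrakk> \<Longrightarrow> \<exists>\<beta>>0. \<forall>x\<in>S. \<beta> * nm x \<le> nm (K x - sc (of_real k) x)"
    and x: "x \<in> S"
  shows "c\<^sup>2 * (nm x)\<^sup>2 \<le> (nm (K x - sc (of_real c) x))\<^sup>2"
proof -
  define Kc where "Kc u = K u - sc (of_real c) u" for u
  have Kc_in [simp, intro]: "u \<in> S \<Longrightarrow> Kc u \<in> S" for u by (auto simp: Kc_def)
  define M where "M = {m. 0 \<le> m \<and> m \<le> c\<^sup>2 \<and> (\<forall>u\<in>S. m * (nm u)\<^sup>2 \<le> (nm (Kc u))\<^sup>2)}"
  have M0: "0 \<in> M" and Mb: "bdd_above M" by (auto simp: M_def)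
  define m where "m = Sup M"
  have m: "0 \<le> m" unfolding m_def using M0 Mb by (rule cSup_upper)
  have mc: "m \<le> c\<^sup>2" unfolding m_def
  proof (rule cSup_least)
    show "M \<noteq> {}" using M0 by blast
  qed (simp add: M_def)
  have mM: "m * (nm u)\<^sup>2 \<le> (nm (Kc u))\<^sup>2" if u: "u \<in> S" for u
  proof (cases "nm u = 0")
    case False
    then have pos: "0 < (nm u)\<^sup>2" by simp
    have "m \<le> (nm (Kc u))\<^sup>2 / (nm u)\<^sup>2" unfolding m_def
    proof (rule cSup_least)
      show "M \<noteq> {}" using M0 by blast
    qed (use u pos in \<open>auto simp: M_def field_simps\<close>)
    then show ?thesis using pos by (simp add: field_simps)
  qed simp
  have "m = c\<^sup>2"
  proof (rule ccontr)
    assume "m \<noteq> c\<^sup>2"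
    with mc have mlt: "m < c\<^sup>2" by simp
    \<comment> \<open>The roots of \<open>(k - c)^2 = m\<close> are \<open>c - s\<close> and
      \<open>c + s\<close>; since \<open>0 \<le> s < c\<close>, a root in the open gap is hit on
      either side of \<open>c\<close>.\<close>
    define s where "s = sqrt m"
    have s: "0 \<le> s" "s\<^sup>2 = m" "s < c"
      using m mlt c by (auto simp: s_def intro: real_less_lsqrt)
    obtain b1 where b1: "b1 > 0" "\<And>u. u \<in> S \<Longrightarrow> b1 * nm u \<le> nm (K u - sc (of_real (c - s)) u)"
      using c(2)[of "c - s"] s c(1) by auto
    obtain b2 where b2: "b2 > 0" "\<And>u. u \<in> S \<Longrightarrow> b2 * nm u \<le> nm (K u - sc (of_real (c + s)) u)"
      using c(2)[of "c + s"] s c(1) by auto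
    \<comment> \<open>The nonnegative form of \<open>(K - c)^2 - m\<close>; its Cauchy-Schwarz
      inequality turns a lower bound for the operator into one for the form.\<close>
    define l where "l u v = ip (Kc u) (Kc v) - of_real m * ip u v" for u v
    interpret L: semi_inner sc S l
    proof unfold_locales
      fix u v w assume uvw: "u \<in> S" "v \<in> S" "w \<in> S"
      have 1: "ip (Kc (u + v)) (Kc w) = ip (Kc u) (Kc w) + ip (Kc v) (Kc w)"
        using uvw by (simp add: Kc_def ip_simps K_sym algebra_simps)
      show "l (u + v) w = l u w + l v w"
        using uvw by (simp add: l_def 1 ip_simps algebra_simps)
    next
      fix u w e assume uvw: "u \<in> S" "w \<in> S"
      show "l (sc e u) w = e * l u w"
        using uvw by (simp add: l_def Kc_def ip_simps K_sym algebra_simps)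
    next
      fix u v assume uv: "u \<in> S" "v \<in> S"
      have "ip (Kc v) (Kc u) = cnj (ip (Kc u) (Kc v))" "ip v u = cnj (ip u v)"
        using uv by (auto intro: ip_herm)
      then show "l v u = cnj (l u v)" by (simp add: l_def)
    next
      fix u assume u: "u \<in> S"
      show "0 \<le> Re (l u u)"
        using mM[OF u] u by (simp add: l_def nm_sq)
    qed (fact subspace_S)
    have nmKc: "nm (Kc u) \<le> (1 + c) * nm u" if u: "u \<in> S" for u
    proof -
      have "nm (Kc u) \<le> nm (K u) + nm (sc (of_real c) u)"
        unfolding Kc_def using nm_triangle[of "K u" "- sc (of_real c) u"] u nm_minus[of "sc (of_real c) u"] by simp
      also have "\<dots> \<le> nm u + c * nm u"
        using nm_K_le[OF u] u c by (simp add: nm_scale)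
      finally show ?thesis by (simp add: algebra_simps)
    qed
    have l_le: "Re (l w w) \<le> ((1 + c) * nm w)\<^sup>2" if w: "w \<in> S" for w
    proof -
      have "Re (l w w) \<le> (nm (Kc w))\<^sup>2" using w m by (simp add: l_def nm_sq ip_nonneg)
      also have "\<dots> \<le> ((1 + c) * nm w)\<^sup>2" using nmKc[OF w] w by (intro power_mono) auto
      finally show ?thesis .
    qed
    \<comment> \<open>\<open>b1 * b2\<close> bounds the product of the two shifts from below, and
      \<open>1 + c\<close> bounds \<open>K - c\<close> from above.\<close>
    define \<beta> where "\<beta> = (b1 * b2 / (1 + c))\<^sup>2"
    have \<beta>: "0 < \<beta>" using b1 b2 c by (simp add: \<beta>_def)
    have low: "\<beta> * (nm u)\<^sup>2 \<le> Re (l u u)" if u: "u \<in> S" for u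
    proof -
      define v where "v = K u - sc (of_real (c - s)) u"
      define w where "w = K v - sc (of_real (c + s)) v"
      have v: "v \<in> S" using u by (auto simp: v_def)
      have w: "w \<in> S" using v by (auto simp: w_def)
      \<comment> \<open>\<open>w\<close> is the product of the two shifts applied to
        \<open>u\<close>, so it represents the functional \<open>l u\<close>.\<close>
      have eq: "ip w z = l u z" if z: "z \<in> S" for z
      proof -
        have "ip w z = ip (K u) (K z) - of_real (c - s) * ip u (K z)
            - of_real (c + s) * (ip (K u) z - of_real (c - s) * ip u z)"
          using u v z unfolding w_def by (simp add: ip_simps K_sym[of v z]) (simp add: v_def ip_simps)
        also have "\<dots> = l u z"
          unfolding l_def Kc_def s(2)[symmetric] using u z
          by (simp add: ip_simps K_sym[of u z] algebra_simps power2_eq_square)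
        finally show ?thesis .
      qed
      have "(nm w)\<^sup>2 = Re (l u w)" using eq[OF w] w by (simp add: nm_sq)
      also have "\<dots> \<le> L.nm u * L.nm w" using u w by (rule L.Re_cauchy_schwarz)
      also have "\<dots> \<le> L.nm u * ((1 + c) * nm w)"
      proof (rule mult_left_mono)
        show "L.nm w \<le> (1 + c) * nm w"
          by (rule power2_le_imp_le) (use l_le[OF w] w c in \<open>auto simp: L.nm_sq\<close>)
      qed (use u in auto)
      finally have "nm w * nm w \<le> (L.nm u * (1 + c)) * nm w" by (simp add: power2_eq_square mult_ac)
      then have le1: "nm w \<le> L.nm u * (1 + c)"
        using nm_nonneg[OF w] L.nm_nonneg[OF u] c
        by (cases "nm w = 0") auto
      have "b1 * b2 * nm u \<le> b2 * nm v"
        using b1(2)[OF u] b2(1) by (simp add: v_def mult_ac)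
      also have "\<dots> \<le> nm w" using b2(2)[OF v] by (simp add: w_def)
      also note le1
      finally have "b1 * b2 / (1 + c) * nm u \<le> L.nm u" using c by (simp add: field_simps)
      then have "(b1 * b2 / (1 + c) * nm u)\<^sup>2 \<le> (L.nm u)\<^sup>2"
        using b1 b2 c u by (intro power_mono) auto
      then show ?thesis using u by (simp add: \<beta>_def power_mult_distrib L.nm_sq power_divide)
    qed
    \<comment> \<open>The minimum with \<open>c^2\<close> keeps the improved constant inside
      \<open>M\<close>.\<close>
    define m' where "m' = min (m + \<beta>) (c\<^sup>2)"
    have "m' \<in> M"
    proof -
      have "m' * (nm u)\<^sup>2 \<le> (nm (Kc u))\<^sup>2" if u: "u \<in> S" for u
      proof -
        have "m' * (nm u)\<^sup>2 \<le> (m + \<beta>) * (nm u)\<^sup>2" by (intro mult_right_mono) (auto simp: m'_def)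
        also have "\<dots> \<le> (nm (Kc u))\<^sup>2" using low[OF u] u by (simp add: l_def nm_sq algebra_simps)
        finally show ?thesis .
      qed
      then show ?thesis using m \<beta> by (auto simp: M_def m'_def)
    qed
    then have "m' \<le> m" unfolding m_def using Mb by (rule cSup_upper)
    then show False using mlt \<beta> by (simp add: m'_def)
  qed
  then show ?thesis using mM[OF x] by (simp add: Kc_def)
qed

text \<open>The gap makes the iterates \<open>(1 - K)\<^sup>n x\<close> a geometric Cauchy sequence; the limit lies in
  the kernel of \<open>K\<close>, hence is null.\<close>

lemma bounded_below:
  assumes \<kappa>: "0 < \<kappa>" "\<kappa> < 1"
    and gap: "\<And>k. \<lbrakk>0 < k; k < \<kappa>\<rbrakk> \<Longrightarrow> \<exists>\<beta>>0. \<forall>x\<in>S. \<beta> * nm x \<le> nm (K x - sc (of_real k) x)"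
    and ker: "\<And>x. \<lbrakk>x \<in> S; nm (K x) = 0\<rbrakk> \<Longrightarrow> nm x = 0"
    and complete: "\<And>(x::nat \<Rightarrow> 'v) C q. \<lbrakk>\<And>n. x n \<in> S; \<And>n. nm (x (Suc n) - x n) \<le> C * q ^ n; 0 \<le> q; q < 1\<rbrakk>
        \<Longrightarrow> \<exists>p\<in>S. (\<lambda>n. nm (x n - p)) \<longlonglongrightarrow> 0"
  shows "\<exists>\<beta>>0. \<forall>x\<in>S. \<beta> * nm x \<le> nm (K x)"
proof -
  \<comment> \<open>The square of \<open>K - \<kappa>/2\<close> is at least
    \<open>(\<kappa>/2)^2\<close>, which rearranges to \<open>\<kappa> K \<le> K^2\<close> in the
    sense of forms.\<close>
  have g1: "\<kappa> * Re (ip (K x) x) \<le> (nm (K x))\<^sup>2" if x: "x \<in> S" for x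
  proof -
    have "(\<kappa>/2)\<^sup>2 * (nm x)\<^sup>2 \<le> (nm (K x - sc (of_real (\<kappa>/2)) x))\<^sup>2"
      by (rule gap_square[OF _ _ x]) (use \<kappa> gap in auto)
    also have "\<dots> = (nm (K x))\<^sup>2 - \<kappa> * Re (ip (K x) x) + (\<kappa>/2)\<^sup>2 * (nm x)\<^sup>2"
    proof -
      have "ip (K x - sc (of_real (\<kappa>/2)) x) (K x - sc (of_real (\<kappa>/2)) x) =
          ip (K x) (K x) - of_real (\<kappa>/2) * (ip (K x) x + ip x (K x)) + of_real ((\<kappa>/2)\<^sup>2) * ip x x"
        using x by (simp add: ip_simps algebra_simps power2_eq_square)
      then have "Re (ip (K x - sc (of_real (\<kappa>/2)) x) (K x - sc (of_real (\<kappa>/2)) x)) =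
          Re (ip (K x) (K x)) - (\<kappa>/2) * (2 * Re (ip (K x) x)) + (\<kappa>/2)\<^sup>2 * Re (ip x x)"
        using x Re_ip_comm[of "K x" x] by (simp del: of_real_divide of_real_power)
      then show ?thesis using x by (simp add: nm_sq)
    qed
    finally show ?thesis by simp
  qed
  \<comment> \<open>\<open>K \<ge> \<kappa>\<close> on the range of \<open>K\<close>: Cauchy-Schwarz
    for the form \<open>ip (K u) v\<close> at the vectors \<open>x\<close> and \<open>K x\<close>,
    with \<open>ip (K x) x\<close> estimated by \<open>g1\<close>.\<close>
  have g2: "\<kappa> * (nm (K x))\<^sup>2 \<le> Re (ip (K (K x)) (K x))" if x: "x \<in> S" for x
  proof -
    define f where "f u v = ip (K u) v" for u v
    interpret F: semi_inner sc S f
    proof unfold_locales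
      fix u v w assume "u \<in> S" "v \<in> S" "w \<in> S"
      then show "f (u + v) w = f u w + f v w" by (simp add: f_def K_sym ip_simps)
    next
      fix u w c assume "u \<in> S" "w \<in> S"
      then show "f (sc c u) w = c * f u w" by (simp add: f_def K_sym ip_simps)
    next
      fix u v assume "u \<in> S" "v \<in> S"
      then show "f v u = cnj (f u v)" using ip_herm[of u "K v"] by (simp add: f_def K_sym)
    next
      fix u assume "u \<in> S"
      then show "0 \<le> Re (f u u)" using K_contr[of u] by (simp add: f_def) (smt (verit) zero_le_power2)
    qed (fact subspace_S)
    have Kx: "K x \<in> S" using x by auto
    have "(nm (K x))\<^sup>2 = Re (f x (K x))" using Kx by (simp add: f_def nm_sq)
    also have "\<dots> \<le> F.nm x * F.nm (K x)" using x Kx by (rule F.Re_cauchy_schwarz)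
    finally have "((nm (K x))\<^sup>2)\<^sup>2 \<le> (F.nm x * F.nm (K x))\<^sup>2" by (intro power_mono) auto
    also have "\<dots> = Re (f x x) * Re (f (K x) (K x))" using x Kx by (simp add: power_mult_distrib F.nm_sq)
    finally have 1: "((nm (K x))\<^sup>2)\<^sup>2 \<le> Re (f x x) * Re (f (K x) (K x))" .
    have 2: "\<kappa> * Re (f x x) \<le> (nm (K x))\<^sup>2" using g1[OF x] by (simp add: f_def)
    define N where "N = (nm (K x))\<^sup>2"
    have "\<kappa> * N\<^sup>2 \<le> \<kappa> * (Re (f x x) * Re (f (K x) (K x)))" using 1 \<kappa> by (simp add: N_def)
    also have "\<dots> \<le> N * Re (f (K x) (K x))"
      using mult_right_mono[OF 2 F.ip_nonneg[OF Kx]] by (simp add: N_def mult_ac)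
    finally have "N * (\<kappa> * N) \<le> N * Re (f (K x) (K x))" by (simp add: power2_eq_square mult_ac)
    moreover have "0 \<le> N" by (simp add: N_def)
    ultimately have "\<kappa> * N \<le> Re (f (K x) (K x))"
      using F.ip_nonneg[OF Kx] by (cases "N = 0") auto
    then show ?thesis by (simp add: N_def f_def)
  qed
  define q where "q = sqrt (1 - \<kappa>)"
  have q: "0 \<le> q" "q < 1" "q\<^sup>2 = 1 - \<kappa>" using \<kappa> by (auto simp: q_def)
  \<comment> \<open>For \<open>y\<close> in the range of \<open>K\<close>, the contraction property
    bounds \<open>(nm (y - K y))^2\<close> by \<open>(nm y)^2 - Re (ip (K y) y)\<close>, and
    \<open>g2\<close> makes this at most \<open>(1 - \<kappa>) * (nm y)^2\<close>.\<close>
  have contr: "nm (K x - K (K x)) \<le> q * nm (K x)" if x: "x \<in> S" for x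
  proof (rule power2_le_imp_le)
    define y where "y = K x"
    have y: "y \<in> S" using x by (auto simp: y_def)
    have "(nm (y - K y))\<^sup>2 = (nm y)\<^sup>2 - 2 * Re (ip (K y) y) + (nm (K y))\<^sup>2"
      using y Re_ip_comm[of "K y" y] by (simp add: nm_sq ip_simps)
    also have "\<dots> \<le> (nm y)\<^sup>2 - \<kappa> * (nm y)\<^sup>2"
      using K_contr[OF y] g2[OF x] by (simp add: y_def)
    also have "\<dots> = (q * nm y)\<^sup>2" by (simp add: power_mult_distrib q algebra_simps)
    finally show "(nm (K x - K (K x)))\<^sup>2 \<le> (q * nm (K x))\<^sup>2" by (simp add: y_def)
  qed (use q x in auto)
  have "(1 - q) * nm u \<le> nm (K u)" if u: "u \<in> S" for u
  proof -
    define x where "x n = ((\<lambda>y. y - K y) ^^ n) u" for n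
    have x0: "x 0 = u" and xS: "x (Suc n) = x n - K (x n)" for n by (auto simp: x_def)
    have xin [simp, intro]: "x n \<in> S" for n by (induction n) (auto simp: x0 xS u)
    have step: "nm (K (x n)) \<le> nm (K u) * q ^ n" for n
    proof (induction n)
      case (Suc n)
      have "nm (K (x (Suc n))) = nm (K (x n) - K (K (x n)))"
        unfolding xS by (rule nm_K_diff[symmetric]) auto
      also have "\<dots> \<le> q * nm (K (x n))" by (rule contr) auto
      also have "\<dots> \<le> q * (nm (K u) * q ^ n)" using Suc q by (intro mult_left_mono) auto
      finally show ?case by (simp add: mult_ac)
    qed (simp add: x0)
    have "nm (x (Suc n) - x n) \<le> nm (K u) * q ^ n" for n
      using step[of n] nm_minus[of "K (x n)"] by (simp add: xS)
    from complete[OF xin this q(1,2)] obtain p where p: "p \<in> S" "(\<lambda>n. nm (x n - p)) \<longlonglongrightarrow> 0" by blast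
    have qn: "(\<lambda>n. q ^ n) \<longlonglongrightarrow> 0" using q by (intro LIMSEQ_realpow_zero) auto
    have "nm (K p) \<le> 0"
    proof (rule LIMSEQ_le_const)
      show "(\<lambda>n. nm (K u) * q ^ n + nm (x n - p)) \<longlonglongrightarrow> 0"
        using tendsto_add[OF tendsto_mult_right_zero[OF qn] p(2)] by simp
      have "nm (K p) \<le> nm (K u) * q ^ n + nm (x n - p)" for n
      proof -
        have "nm (K p) \<le> nm (K (x n)) + nm (K p - K (x n))" by (rule nm_diff_triangle) (use p in auto)
        also have "nm (K p - K (x n)) = nm (K (p - x n))" by (rule nm_K_diff) (use p in auto)
        also have "\<dots> \<le> nm (p - x n)" by (rule nm_K_le) (use p in auto)
        also have "\<dots> = nm (x n - p)" by (rule nm_minus_commute) (use p in auto)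
        finally show ?thesis using step[of n] by simp
      qed
      then show "\<exists>N. \<forall>n\<ge>N. nm (K p) \<le> nm (K u) * q ^ n + nm (x n - p)" by blast
    qed
    moreover have "0 \<le> nm (K p)" using p by (intro nm_nonneg K_in)
    ultimately have p0: "nm p = 0" using ker[OF p(1)] by linarith
    \<comment> \<open>\<open>u - x n\<close> telescopes into the sum of \<open>K (x j)\<close> over
      \<open>j < n\<close>, whose norms are dominated by a geometric series with ratio
      \<open>q\<close>.\<close>
    have part: "(1 - q) * nm (u - x n) \<le> nm (K u)" for n
    proof -
      have "(1 - q) * nm (u - x n) \<le> nm (K u) * (1 - q ^ n)"
      proof (induction n)
        case 0 then show ?case using ip_zero[of 0] by (simp add: x0 nm_def)
      next
        case (Suc n)
        have "nm (u - x (Suc n)) \<le> nm (u - x n) + nm (K (x n))"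
          using nm_triangle[of "u - x n" "K (x n)"] u by (simp add: xS algebra_simps)
        then have "(1 - q) * nm (u - x (Suc n)) \<le> (1 - q) * (nm (u - x n) + nm (K u) * q ^ n)"
          using step[of n] q by (intro mult_left_mono) auto
        also have "\<dots> \<le> nm (K u) * (1 - q ^ n) + (1 - q) * (nm (K u) * q ^ n)"
          using Suc by (simp add: algebra_simps)
        finally show ?case by (simp add: algebra_simps)
      qed
      also have "\<dots> \<le> nm (K u)" using q u by (intro mult_left_le) (auto intro: power_le_one)
      finally show ?thesis .
    qed
    show ?thesis
    proof (rule LIMSEQ_le_const)
      show "(\<lambda>n. nm (K u) + (1 - q) * nm (x n - p)) \<longlonglongrightarrow> nm (K u)"
        using tendsto_add[OF tendsto_const tendsto_mult_right_zero[OF p(2)]] by simp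
      have "(1 - q) * nm u \<le> nm (K u) + (1 - q) * nm (x n - p)" for n
      proof -
        have "nm u \<le> nm (x n) + nm (u - x n)" by (rule nm_diff_triangle) (use u in auto)
        moreover have "nm (x n) \<le> nm p + nm (x n - p)" by (rule nm_diff_triangle) (use p in auto)
        ultimately have "(1 - q) * nm u \<le> (1 - q) * (nm (u - x n) + nm (x n - p))"
          using q p0 by (intro mult_left_mono) auto
        also have "\<dots> \<le> nm (K u) + (1 - q) * nm (x n - p)" using part[of n] by (simp add: algebra_simps)
        finally show ?thesis .
      qed
      then show "\<exists>N. \<forall>n\<ge>N. (1 - q) * nm u \<le> nm (K u) + (1 - q) * nm (x n - p)" by blast
    qed
  qed
  then show ?thesis using q by (intro exI[of _ "1 - q"]) auto
qed

end

section \<open>Operators of nonnegative forms: Rayleigh quotients and trial vectors\<close>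

locale form_space = semi_inner sc V ip + A: semi_inner sc D a
  for sc :: "complex \<Rightarrow> 'v::ab_group_add \<Rightarrow> 'v" and V ip and D a +
  assumes D_sub: "D \<subseteq> V"
    and complete: "\<And>(x::nat \<Rightarrow> 'v) C q. \<lbrakk>\<And>n. x n \<in> V; \<And>n. nm (x (Suc n) - x n) \<le> C * q ^ n; 0 \<le> q; q < 1\<rbrakk>
        \<Longrightarrow> \<exists>p\<in>V. (\<lambda>n. nm (x n - p)) \<longlonglongrightarrow> 0"
begin

text \<open>\<open>H u = f\<close> for the operator \<open>H\<close> of the form \<open>a\<close>.
  It is a relation because \<open>f\<close> enters only through its inner products with
  \<open>D\<close>.\<close>

definition op_graph :: "'v \<Rightarrow> 'v \<Rightarrow> bool" where
  "op_graph u f \<longleftrightarrow> u \<in> D \<and> f \<in> V \<and> (\<forall>v\<in>D. a u v = ip f v)"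

text \<open>A lower bound for \<open>H - z\<close>. Surjectivity is kept apart: it enters at the
  single point \<open>z = -1\<close>, as the assumption that provides the resolvent
  \<open>R\<close>.\<close>

definition inv_bounded :: "real \<Rightarrow> bool" where
  "inv_bounded z \<longleftrightarrow> (\<exists>M. \<forall>f\<in>V. \<forall>u. op_graph u (f + sc (of_real z) u) \<longrightarrow> nm u \<le> M * nm f)"

lemma D_V [intro, simp]: "x \<in> D \<Longrightarrow> x \<in> V" using D_sub by blast

text \<open>With the resolvent \<open>R = (H + 1)\<^sup>-\<^sup>1\<close>, the gap lemma is applied to \<open>K = (H - \<mu>) R = 1 - (\<mu> + 1) R\<close>
  on the orthogonal complement of the \<open>e i\<close>; \<open>K - k\<close> corresponds to the spectral parameter
  \<open>(\<mu> + k) / (1 - k)\<close> of \<open>H\<close>.\<close>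

lemma rayleigh_improve:
  fixes e :: "'i \<Rightarrow> 'v" and l :: "'i \<Rightarrow> real"
  assumes surj: "\<And>f. f \<in> V \<Longrightarrow> \<exists>u. op_graph u (f - u)"
    and spec: "inv_bounded \<mu> \<or> (\<exists>\<epsilon>>0. \<forall>z. 0 < \<bar>z - \<mu>\<bar> \<and> \<bar>z - \<mu>\<bar> < \<epsilon> \<longrightarrow> inv_bounded z)"
    and I: "finite I" "\<And>i. i \<in> I \<Longrightarrow> op_graph (e i) (sc (of_real (l i)) (e i))" "\<And>i. i \<in> I \<Longrightarrow> 0 \<le> l i"
    and span: "\<And>u. op_graph u (sc (of_real \<mu>) u) \<Longrightarrow> \<exists>c. nm (u - (\<Sum>i\<in>I. sc (c i) (e i))) = 0"
    and \<mu>: "0 \<le> \<mu>" "\<And>u. \<lbrakk>u \<in> D; \<And>i. i \<in> I \<Longrightarrow> ip u (e i) = 0\<rbrakk> \<Longrightarrow> \<mu> * (nm u)\<^sup>2 \<le> Re (a u u)"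
  shows "\<exists>\<delta>>0. \<forall>u\<in>D. (\<forall>i\<in>I. ip u (e i) = 0) \<longrightarrow> (\<mu> + \<delta>) * (nm u)\<^sup>2 \<le> Re (a u u)"
proof -
  have eD: "e i \<in> D" "e i \<in> V" if "i \<in> I" for i using I(2)[OF that] by (auto simp: op_graph_def)
  define W where "W = {f \<in> V. \<forall>i\<in>I. ip f (e i) = 0}"
  have WV: "f \<in> W \<Longrightarrow> f \<in> V" for f by (simp add: W_def)
  have Wz: "f \<in> W \<Longrightarrow> i \<in> I \<Longrightarrow> ip f (e i) = 0" for f i by (simp add: W_def)
  have WI: "f \<in> V \<Longrightarrow> (\<And>i. i \<in> I \<Longrightarrow> ip f (e i) = 0) \<Longrightarrow> f \<in> W" for f by (simp add: W_def)
  have subW: "subspace W" unfolding subspace_def W_def using eD by (auto simp: ip_simps)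
  note WV [simp, intro]
  have "\<exists>R. \<forall>f\<in>V. op_graph (R f) (f - R f)" using surj by metis
  then obtain R where R: "\<And>f. f \<in> V \<Longrightarrow> op_graph (R f) (f - R f)" by blast
  have RD [simp, intro]: "R f \<in> D" if "f \<in> V" for f using R[OF that] by (simp add: op_graph_def)
  have RV [simp, intro]: "R f \<in> V" if "f \<in> V" for f using RD[OF that] by simp
  have Ra: "a (R f) v = ip f v - ip (R f) v" if "f \<in> V" "v \<in> D" for f v
    using R[OF that(1)] that by (simp add: op_graph_def ip_simps)
  have Ra': "a v (R f) = ip v f - ip v (R f)" if f: "f \<in> V" and v: "v \<in> D" for f v
    using arg_cong[OF Ra[OF f v], of cnj] f v A.ip_herm[of "R f" v] ip_herm[of "R f" v] ip_herm[of f v] by simp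
  \<comment> \<open>The eigenvectors reduce the resolvent: evaluating \<open>a (e i) (R f)\<close>
    once through the eigenvalue equation and once through \<open>Ra'\<close> gives
    \<open>(l i + 1) * ip (e i) (R f) = 0\<close>, where \<open>l i + 1 > 0\<close>.\<close>
  have RW [intro]: "R f \<in> W" if f: "f \<in> W" for f
  proof -
    have "ip (R f) (e i) = 0" if i: "i \<in> I" for i
    proof -
      have "a (e i) (R f) = of_real (l i) * ip (e i) (R f)"
        using I(2)[OF i] f eD[OF i] by (simp add: op_graph_def ip_simps)
      moreover have "ip (e i) f = 0" using ip_herm[of f "e i"] f eD[OF i] Wz[OF f i] by simp
      ultimately have "(of_real (l i) + 1) * ip (e i) (R f) = 0"
        using Ra'[OF WV[OF f] eD(1)[OF i]] by algebra
      moreover have "complex_of_real (l i) + 1 \<noteq> 0"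
        using I(3)[OF i] by (metis add.commute add_nonneg_eq_0_iff of_real_1 of_real_add of_real_eq_0_iff zero_le_one zero_neq_one)
      ultimately have "ip (e i) (R f) = 0" by simp
      then show ?thesis using ip_herm[of "e i" "R f"] f eD[OF i] by simp
    qed
    then show ?thesis using f by (intro WI) auto
  qed
  define K where "K f = f - sc (of_real (\<mu> + 1)) (R f)" for f
  \<comment> \<open>The form of \<open>H - \<mu>\<close>, nonnegative on the complement
    \<open>W\<close> by the assumption on \<open>\<mu>\<close>. It is linked to \<open>K\<close> by
    \<open>b (R f) v = ip (K f) v\<close>.\<close>
  define b where "b u v = a u v - of_real \<mu> * ip u v" for u v
  have b_nonneg: "0 \<le> Re (b u u)" if "u \<in> D" "u \<in> W" for u
    using \<mu>(2)[OF that(1) Wz[OF that(2)]] that by (simp add: b_def nm_sq)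
  interpret B: semi_inner sc "D \<inter> W" b
  proof unfold_locales
    show "subspace (D \<inter> W)" using A.subspace_S subW by (rule subspace_inter)
  next
    fix u v assume "u \<in> D \<inter> W" "v \<in> D \<inter> W"
    then show "b v u = cnj (b u v)" using A.ip_herm[of u v] ip_herm[of u v] by (auto simp: b_def)
  next
    show "0 \<le> Re (b u u)" if "u \<in> D \<inter> W" for u using b_nonneg that by blast
  qed (auto simp: b_def A.ip_simps ip_simps algebra_simps)
  have KV [simp, intro]: "f \<in> V \<Longrightarrow> K f \<in> V" for f by (auto simp: K_def)
  have bR: "b (R f) v = ip (K f) v" if "f \<in> V" "v \<in> D" for f v
    using that by (simp add: b_def K_def Ra ip_simps algebra_simps)
  interpret W: semi_inner sc W ip
    by unfold_locales (use subW in \<open>auto simp: ip_simps ip_nonneg intro: ip_herm\<close>)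
  interpret Kop: sym_contraction sc W ip K
  proof unfold_locales
    show "K x \<in> W" if "x \<in> W" for x unfolding K_def using that by blast
  next
    fix f g assume fg: "f \<in> W" "g \<in> W"
    have "ip (R f) g = a (R f) (R g) + ip (R f) (R g)" using Ra'[of g "R f"] fg by simp
    also have "\<dots> = ip f (R g)" using Ra[of f "R g"] fg by simp
    finally show "ip (K f) g = ip f (K g)" using fg by (simp add: K_def ip_simps)
  next
    fix f assume f: "f \<in> W"
    have fV: "f \<in> V" using f by simp
    have "0 \<le> Re (b (R f) (R f))" using b_nonneg RW[OF f] RD[OF fV] by blast
    then have 1: "0 \<le> Re (ip (K f) (R f))" using bR[OF fV RD[OF fV]] by simp
    \<comment> \<open>This splitting gives \<open>ip (K f) f\<close> as the square of
      \<open>nm (K f)\<close> plus \<open>\<mu> + 1\<close> times \<open>b (R f) (R f)\<close>, and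
      the latter is nonnegative.\<close>
    have "f = K f + sc (of_real (\<mu> + 1)) (R f)" by (simp add: K_def)
    then have "ip (K f) f = ip (K f) (K f + sc (of_real (\<mu> + 1)) (R f))" by simp
    also have "\<dots> = ip (K f) (K f) + of_real (\<mu> + 1) * ip (K f) (R f)" using fV by (simp add: ip_simps)
    finally have "Re (ip (K f) f) = (nm (K f))\<^sup>2 + (\<mu> + 1) * Re (ip (K f) (R f))"
      using fV by (simp add: nm_sq del: of_real_add)
    then show "(nm (K f))\<^sup>2 \<le> Re (ip (K f) f)" using 1 \<mu> by simp
  qed
  \<comment> \<open>With \<open>z = (\<mu> + k) / (1 - k)\<close> one has
    \<open>K - k = (1 - k) * (1 - (z + 1) R)\<close>, and \<open>h\<close> below is
    \<open>(H - z) (R f)\<close>. The bound at \<open>z\<close> controls \<open>R f\<close> by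
    \<open>h\<close>, and therefore also \<open>f = h + (z + 1) R f\<close>.\<close>
  have K_shift: "\<exists>\<beta>>0. \<forall>f\<in>W. \<beta> * nm f \<le> nm (K f - sc (of_real k) f)"
    if k: "0 \<le> k" "k < 1" and inv: "inv_bounded ((\<mu> + k) / (1 - k))" for k
  proof -
    define z where "z = (\<mu> + k) / (1 - k)"
    have z1: "z + 1 = (\<mu> + 1) / (1 - k)" "0 \<le> z" using k \<mu> by (auto simp: z_def field_simps)
    obtain M0 where M0: "\<And>f u. \<lbrakk>f \<in> V; op_graph u (f + sc (of_real z) u)\<rbrakk> \<Longrightarrow> nm u \<le> M0 * nm f"
      using inv unfolding inv_bounded_def z_def by blast
    define M where "M = max M0 0"
    have M: "nm u \<le> M * nm f" if "f \<in> V" "op_graph u (f + sc (of_real z) u)" for f u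
      using M0[OF that] mult_right_mono[of M0 M "nm f"] that(1) by (force simp: M_def)
    have M_ge: "0 \<le> M" by (simp add: M_def)
    define \<beta> where "\<beta> = (1 - k) / (1 + (z + 1) * M)"
    have den: "0 < 1 + (z + 1) * M" using z1(2) M_ge by (simp add: add_pos_nonneg)
    have "\<beta> * nm f \<le> nm (K f - sc (of_real k) f)" if f: "f \<in> W" for f
    proof -
      define g where "g = K f - sc (of_real k) f"
      define h where "h = sc (of_real (1 / (1 - k))) g"
      have fV: "f \<in> V" and gV: "g \<in> V" using f by (auto simp: g_def)
      have hV: "h \<in> V" using gV by (auto simp: h_def)
      have nh: "nm h = nm g / (1 - k)" using gV k by (simp add: h_def nm_scale norm_divide flip: of_real_diff)
      have g_eq: "g = sc (of_real (1 - k)) f - sc (of_real (\<mu> + 1)) (R f)"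
        by (simp add: g_def K_def algebra_simps)
      have h_eq: "h = f - sc (of_real (z + 1)) (R f)"
      proof -
        have "h = sc (of_real (1 / (1 - k) * (1 - k))) f - sc (of_real (1 / (1 - k) * (\<mu> + 1))) (R f)"
          unfolding h_def g_eq scale_right_diff_distrib scale_scale of_real_mult ..
        moreover have "1 / (1 - k) * (1 - k) = 1" "1 / (1 - k) * (\<mu> + 1) = z + 1" using k z1 by auto
        ultimately show ?thesis by (metis of_real_1 scale_one)
      qed
      have "h + sc (of_real z) (R f) = f - R f" by (simp add: h_eq algebra_simps)
      then have le: "nm (R f) \<le> M * nm h" using M[OF hV, of "R f"] R[OF fV] by simp
      have "nm f \<le> nm h + nm (sc (of_real (z + 1)) (R f))"
        using nm_triangle[of h "sc (of_real (z + 1)) (R f)"] hV fV by (simp add: h_eq)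
      also have "\<dots> = nm h + (z + 1) * nm (R f)"
        using fV z1(2) by (simp add: nm_scale del: of_real_add)
      also have "\<dots> \<le> nm h + (z + 1) * (M * nm h)" using le z1 by (intro add_left_mono mult_left_mono) auto
      also have "\<dots> = (1 + (z + 1) * M) * nm g / (1 - k)" by (simp add: nh algebra_simps add_divide_distrib)
      finally have "nm f \<le> (1 + (z + 1) * M) * nm g / (1 - k)" .
      then show ?thesis using den k unfolding \<beta>_def g_def[symmetric] by (simp add: field_simps)
    qed
    moreover have "0 < \<beta>" using den k by (simp add: \<beta>_def)
    ultimately show ?thesis by blast
  qed
  have "\<exists>\<beta>>0. \<forall>f\<in>W. \<beta> * nm f \<le> nm (K f)"
  proof (cases "inv_bounded \<mu>")
    case True
    then show ?thesis using K_shift[of 0] by simp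
  next
    case False
    then obtain \<epsilon> where \<epsilon>: "\<epsilon> > 0" "\<And>z. \<lbrakk>0 < \<bar>z - \<mu>\<bar>; \<bar>z - \<mu>\<bar> < \<epsilon>\<rbrakk> \<Longrightarrow> inv_bounded z" using spec by blast
    \<comment> \<open>For \<open>k < 1/2\<close> the spectral parameter differs from
      \<open>\<mu>\<close> by \<open>k * (1 + \<mu>) / (1 - k) < 2 * k * (1 + \<mu>)\<close>, and
      the second bound makes this smaller than \<open>\<epsilon>\<close>.\<close>
    define \<kappa> where "\<kappa> = min (1/2) (\<epsilon> / (2 * (1 + \<mu>)))"
    show ?thesis
    proof (rule Kop.bounded_below[where \<kappa> = \<kappa>])
      show "0 < \<kappa>" "\<kappa> < 1" using \<epsilon> \<mu> by (auto simp: \<kappa>_def)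
    next
      fix k assume k: "0 < k" "k < \<kappa>"
      then have k2: "k < 1/2" and k3: "k * (2 * (1 + \<mu>)) < \<epsilon>" using \<mu> by (auto simp: \<kappa>_def field_simps)
      have eq: "(\<mu> + k) / (1 - k) - \<mu> = k * (1 + \<mu>) / (1 - k)" using k2 by (simp add: field_simps)
      have pos: "0 < k * (1 + \<mu>) / (1 - k)" using k k2 \<mu> by simp
      have "k * (1 + \<mu>) / (1 - k) \<le> k * (1 + \<mu>) / (1/2)" using k k2 \<mu> by (intro divide_left_mono) auto
      also have "\<dots> = k * (2 * (1 + \<mu>))" by simp
      also note k3
      finally have "k * (1 + \<mu>) / (1 - k) < \<epsilon>" .
      then have "inv_bounded ((\<mu> + k) / (1 - k))" using \<epsilon>(2)[of "(\<mu> + k) / (1 - k)"] pos unfolding eq by (simp only: abs_of_pos)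
      then show "\<exists>\<beta>>0. \<forall>f\<in>W. \<beta> * nm f \<le> nm (K f - sc (of_real k) f)" using K_shift[of k] k k2 by auto
    next
      fix p assume p: "p \<in> W" and n0: "nm (K p) = 0"
      have pV: "p \<in> V" using p by simp
      \<comment> \<open>\<open>p\<close> itself need not lie in \<open>D\<close>, but
        \<open>p'\<close> does, and it differs from \<open>p\<close> by a null vector. It satisfies
        the eigenvalue equation at \<open>\<mu>\<close>, so \<open>span\<close> writes it through
        the \<open>e i\<close>, to all of which it is orthogonal; hence it is null.\<close>
      define p' where "p' = sc (of_real (\<mu> + 1)) (R p)"
      have p'D: "p' \<in> D" and p'V: "p' \<in> V" and p'W: "p' \<in> W" using p by (auto simp: p'_def)
      have same: "ip p v = ip p' v" if "v \<in> V" for v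
      proof -
        have Kp: "K p = p - p'" by (simp add: K_def p'_def)
        show ?thesis using ip_null[OF KV[OF pV] that n0] pV p'V that unfolding Kp by (simp add: ip_diff)
      qed
      have "a p' v = of_real \<mu> * ip p' v" if v: "v \<in> D" for v
      proof -
        have vV: "v \<in> V" using v by simp
        have 1: "ip p' v = of_real (\<mu> + 1) * ip (R p) v" using pV vV by (simp add: p'_def ip_simps)
        have "a p' v = of_real (\<mu> + 1) * (ip p v - ip (R p) v)" using pV v by (simp add: p'_def A.ip_simps Ra)
        also have "\<dots> = of_real (\<mu> + 1) * ip p' v - ip p' v"
          using same[OF vV] 1 by (simp add: right_diff_distrib)
        finally show ?thesis by (simp add: algebra_simps)
      qed
      then have "op_graph p' (sc (of_real \<mu>) p')" using p'D by (simp add: op_graph_def ip_simps)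
      from span[OF this] obtain c where c: "nm (p' - (\<Sum>i\<in>I. sc (c i) (e i))) = 0" by blast
      define s where "s = (\<Sum>i\<in>I. sc (c i) (e i))"
      have sV: "s \<in> V" unfolding s_def using eD by auto
      have "ip s p' = (\<Sum>i\<in>I. ip (sc (c i) (e i)) p')"
        unfolding s_def using eD p'V by (intro ip_sum) auto
      also have "\<dots> = 0"
      proof (rule sum.neutral, rule ballI)
        fix i assume i: "i \<in> I"
        have "ip p' (e i) = 0" using p'W i by (rule Wz)
        then have "ip (e i) p' = 0" using ip_herm[of p' "e i"] eD[OF i] p'V by simp
        then show "ip (sc (c i) (e i)) p' = 0" using eD[OF i] p'V by (simp add: ip_simps)
      qed
      finally have "ip s p' = 0" .
      moreover have "ip (p' - s) p' = 0" using c sV p'V by (intro ip_null) (auto simp: s_def)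
      ultimately have "ip p' p' = 0" using sV p'V by (simp add: ip_simps)
      then have "nm p' = 0" by (simp add: nm_def)
      moreover have "nm p = nm p'" using n0 pV p'V by (intro nm_eq) (auto simp: K_def p'_def)
      ultimately show "nm p = 0" by simp
    next
      fix x :: "nat \<Rightarrow> 'v" and C q :: real
      assume x: "\<And>n. x n \<in> W" "\<And>n. nm (x (Suc n) - x n) \<le> C * q ^ n" "0 \<le> q" "q < 1"
      then obtain p where p: "p \<in> V" "(\<lambda>n. nm (x n - p)) \<longlonglongrightarrow> 0" using complete[of x C q] by blast
      have "ip p (e i) = 0" if i: "i \<in> I" for i
      proof -
        have "cmod (ip p (e i)) \<le> 0"
        proof (rule LIMSEQ_le_const)
          show "(\<lambda>n. nm (x n - p) * nm (e i)) \<longlonglongrightarrow> 0" by (rule tendsto_mult_left_zero[OF p(2)])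
          have "cmod (ip p (e i)) \<le> nm (x n - p) * nm (e i)" for n
          proof -
            have "ip (x n) (e i) = 0" using x(1)[of n] i by (rule Wz)
            then have "ip (x n - p) (e i) = - ip p (e i)" using x(1)[of n] p(1) eD[OF i] by (simp add: ip_simps)
            then show ?thesis using cauchy_schwarz[of "x n - p" "e i"] x(1)[of n] p(1) eD[OF i] by simp
          qed
          then show "\<exists>N. \<forall>n\<ge>N. cmod (ip p (e i)) \<le> nm (x n - p) * nm (e i)" by blast
        qed
        then show ?thesis by simp
      qed
      then show "\<exists>p\<in>W. (\<lambda>n. nm (x n - p)) \<longlonglongrightarrow> 0" using p WI by blast
    qed
  qed
  then obtain \<beta> where \<beta>: "\<beta> > 0" "\<And>f. f \<in> W \<Longrightarrow> \<beta> * nm f \<le> nm (K f)" by blast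
  \<comment> \<open>Back from \<open>K\<close> to the form: \<open>\<beta>^2 * (nm u)^2\<close> is
    at most \<open>b (R u) u\<close>, and Cauchy-Schwarz for \<open>b\<close> together with
    \<open>b (R u) (R u) \<le> (nm u)^2\<close> leaves \<open>\<beta>^2 * nm u \<le> B.nm u\<close>.
    Squaring produces the gain \<open>\<beta>^4\<close>.\<close>
  have "(\<mu> + \<beta>^4) * (nm u)\<^sup>2 \<le> Re (a u u)" if u: "u \<in> D" "u \<in> W" for u
  proof -
    have uV: "u \<in> V" using u by simp
    have DW: "u \<in> D \<inter> W" "R u \<in> D \<inter> W" using u RW by auto
    have Rle: "B.nm (R u) ^ 2 \<le> (nm u)\<^sup>2"
    proof -
      have 1: "B.nm (R u) ^ 2 = Re (ip (K u) (R u))" using DW uV by (simp add: B.nm_sq bR)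
      have 2: "Re (ip (K u) (R u)) \<le> nm (K u) * nm (R u)" using uV by (intro Re_cauchy_schwarz) auto
      have 3: "nm (K u) \<le> nm u" using u by (intro Kop.nm_K_le)
      have "Re (ip u (R u)) = Re (a (R u) (R u)) + (nm (R u))\<^sup>2"
        using Ra'[OF uV, of "R u"] Ra[OF uV, of "R u"] uV Re_ip_comm[of u "R u"] by (simp add: nm_sq)
      then have "nm (R u) * nm (R u) \<le> Re (ip u (R u))" using A.ip_nonneg[of "R u"] uV by (simp add: power2_eq_square)
      also have "\<dots> \<le> nm u * nm (R u)" using uV by (intro Re_cauchy_schwarz) auto
      finally have "nm (R u) \<le> nm u" using uV nm_nonneg[OF uV] nm_nonneg[OF RV[OF uV]]
        by (cases "nm (R u) = 0") (auto simp: mult_le_cancel_right)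
      then have "nm (K u) * nm (R u) \<le> nm u * nm u" using 3 uV by (intro mult_mono) auto
      then show ?thesis using 1 2 by (simp add: power2_eq_square)
    qed
    have "(\<beta> * nm u)\<^sup>2 \<le> (nm (K u))\<^sup>2" using \<beta> u uV by (intro power_mono) auto
    also have "\<dots> \<le> Re (ip (K u) u)" using u by (intro Kop.K_contr)
    also have "\<dots> = Re (b (R u) u)" using bR[OF uV u(1)] by simp
    also have "\<dots> \<le> B.nm (R u) * B.nm u" using DW by (intro B.Re_cauchy_schwarz)
    also have "\<dots> \<le> nm u * B.nm u"
      by (intro mult_right_mono power2_le_imp_le[OF Rle]) (use DW uV in auto)
    finally have "nm u * (\<beta>\<^sup>2 * nm u) \<le> nm u * B.nm u" by (simp add: power_mult_distrib power2_eq_square mult_ac)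
    then have "\<beta>\<^sup>2 * nm u \<le> B.nm u \<or> nm u = 0" using nm_nonneg[OF uV] by (auto simp: mult_le_cancel_left)
    then have "(\<beta>\<^sup>2 * nm u)\<^sup>2 \<le> (B.nm u)\<^sup>2"
    proof
      assume "\<beta>\<^sup>2 * nm u \<le> B.nm u" then show ?thesis using \<beta> uV by (intro power_mono) auto
    qed simp
    then show ?thesis using DW uV by (simp add: B.nm_sq b_def nm_sq power_mult_distrib algebra_simps)
  qed
  then have "\<forall>u\<in>D. (\<forall>i\<in>I. ip u (e i) = 0) \<longrightarrow> (\<mu> + \<beta>^4) * (nm u)\<^sup>2 \<le> Re (a u u)" using WI D_V by blast
  then show ?thesis using \<beta>(1) zero_less_power by blast
qed

text \<open>The best constant \<open>m \<le> t\<close> on the complement is itself admissible, and a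
  value below \<open>t\<close> could be raised by \<open>rayleigh_improve\<close>, since
  \<open>span\<close> covers all points up to \<open>t\<close>. For negative \<open>t\<close>
  nonnegativity of the form is enough.\<close>

theorem rayleigh_bound:
  fixes e :: "'i \<Rightarrow> 'v" and l :: "'i \<Rightarrow> real"
  assumes surj: "\<And>f. f \<in> V \<Longrightarrow> \<exists>u. op_graph u (f - u)"
    and spec: "\<And>\<mu>. inv_bounded \<mu> \<or> (\<exists>\<epsilon>>0. \<forall>z. 0 < \<bar>z - \<mu>\<bar> \<and> \<bar>z - \<mu>\<bar> < \<epsilon> \<longrightarrow> inv_bounded z)"
    and I: "finite I" "\<And>i. i \<in> I \<Longrightarrow> op_graph (e i) (sc (of_real (l i)) (e i))" "\<And>i. i \<in> I \<Longrightarrow> 0 \<le> l i"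
    and span: "\<And>u \<mu>. \<lbrakk>\<mu> \<le> t; op_graph u (sc (of_real \<mu>) u)\<rbrakk> \<Longrightarrow> \<exists>c. nm (u - (\<Sum>i\<in>I. sc (c i) (e i))) = 0"
    and u: "u \<in> D" "\<And>i. i \<in> I \<Longrightarrow> ip u (e i) = 0"
  shows "t * (nm u)\<^sup>2 \<le> Re (a u u)"
proof (cases "0 \<le> t")
  case False
  then have "t * (nm u)\<^sup>2 \<le> 0" by (simp add: mult_nonpos_nonneg)
  then show ?thesis using A.ip_nonneg[OF u(1)] by linarith
next
  case t: True
  define P where "P v \<longleftrightarrow> v \<in> D \<and> (\<forall>i\<in>I. ip v (e i) = 0)" for v
  define M where "M = {m. 0 \<le> m \<and> m \<le> t \<and> (\<forall>v. P v \<longrightarrow> m * (nm v)\<^sup>2 \<le> Re (a v v))}"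
  have M0: "0 \<in> M" using t A.ip_nonneg by (auto simp: M_def P_def)
  have Mb: "bdd_above M" by (auto simp: M_def)
  define m where "m = Sup M"
  have m: "0 \<le> m" unfolding m_def using M0 Mb by (rule cSup_upper)
  have mt: "m \<le> t" unfolding m_def
  proof (rule cSup_least)
    show "M \<noteq> {}" using M0 by blast
  qed (simp add: M_def)
  have mM: "m * (nm v)\<^sup>2 \<le> Re (a v v)" if v: "P v" for v
  proof (cases "nm v = 0")
    case True
    then show ?thesis using A.ip_nonneg v by (auto simp: P_def)
  next
    case False
    then have pos: "0 < (nm v)\<^sup>2" by simp
    have "m \<le> Re (a v v) / (nm v)\<^sup>2" unfolding m_def
    proof (rule cSup_least)
      show "M \<noteq> {}" using M0 by blast
    qed (use v pos in \<open>auto simp: M_def field_simps\<close>)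
    then show ?thesis using pos by (simp add: field_simps)
  qed
  have "m = t"
  proof (rule ccontr)
    assume "m \<noteq> t"
    have "\<exists>\<delta>>0. \<forall>u\<in>D. (\<forall>i\<in>I. ip u (e i) = 0) \<longrightarrow> (m + \<delta>) * (nm u)\<^sup>2 \<le> Re (a u u)"
      by (rule rayleigh_improve[OF surj spec I]) (use span m mt mM in \<open>auto simp: P_def\<close>)
    then obtain \<delta> where \<delta>: "\<delta> > 0" "\<And>v. P v \<Longrightarrow> (m + \<delta>) * (nm v)\<^sup>2 \<le> Re (a v v)" by (auto simp: P_def)
    have "min (m + \<delta>) t \<in> M"
    proof -
      have "min (m + \<delta>) t * (nm v)\<^sup>2 \<le> Re (a v v)" if "P v" for v
      proof -
        have "min (m + \<delta>) t * (nm v)\<^sup>2 \<le> (m + \<delta>) * (nm v)\<^sup>2" by (intro mult_right_mono) auto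
        then show ?thesis using \<delta>(2)[OF that] by linarith
      qed
      then show ?thesis using m t \<delta>(1) by (auto simp: M_def)
    qed
    then have "min (m + \<delta>) t \<le> m" unfolding m_def using Mb by (rule cSup_upper)
    then show False using \<delta>(1) mt \<open>m \<noteq> t\<close> by simp
  qed
  then show ?thesis using mM[of u] u by (simp add: P_def)
qed

text \<open>One half of the min-max principle. More trial vectors than \<open>e i\<close> leave a
  nonzero combination orthogonal to every \<open>e i\<close>. Orthogonality for both forms makes its
  norm and its energy weighted sums of the individual ones, so its energy contradicts
  \<open>bound\<close>.\<close>

theorem trial_count:
  fixes e :: "'i \<Rightarrow> 'v" and f :: "'j \<Rightarrow> 'v"
  assumes fin: "finite I" "finite J" and e: "\<And>i. i \<in> I \<Longrightarrow> e i \<in> V"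
    and bound: "\<And>u. \<lbrakk>u \<in> D; \<And>i. i \<in> I \<Longrightarrow> ip u (e i) = 0\<rbrakk> \<Longrightarrow> t * (nm u)\<^sup>2 \<le> Re (a u u)"
    and f: "\<And>j. j \<in> J \<Longrightarrow> f j \<in> D" "\<And>j. j \<in> J \<Longrightarrow> Re (a (f j) (f j)) < t * (nm (f j))\<^sup>2"
    and orth: "\<And>j k. \<lbrakk>j \<in> J; k \<in> J; j \<noteq> k\<rbrakk> \<Longrightarrow> ip (f j) (f k) = 0"
      "\<And>j k. \<lbrakk>j \<in> J; k \<in> J; j \<noteq> k\<rbrakk> \<Longrightarrow> a (f j) (f k) = 0"
  shows "card J \<le> card I"
proof (rule ccontr)
  assume "\<not> card J \<le> card I"
  then have "card I < card J" by simp
  from homogeneous_system[OF fin this, of "\<lambda>j i. ip (f j) (e i)"]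
  obtain c j0 where c: "j0 \<in> J" "c j0 \<noteq> 0" "\<And>i. i \<in> I \<Longrightarrow> (\<Sum>j\<in>J. c j * ip (f j) (e i)) = 0" by blast
  define u where "u = (\<Sum>j\<in>J. sc (c j) (f j))"
  have fV: "f j \<in> V" if "j \<in> J" for j using f(1)[OF that] by simp
  have uD: "u \<in> D" unfolding u_def using f(1) by auto
  have "ip u (e i) = 0" if i: "i \<in> I" for i
  proof -
    have "ip u (e i) = (\<Sum>j\<in>J. ip (sc (c j) (f j)) (e i))"
      unfolding u_def by (rule ip_sum) (use fV e[OF i] in auto)
    also have "\<dots> = (\<Sum>j\<in>J. c j * ip (f j) (e i))"
      by (rule sum.cong) (use fV e[OF i] in \<open>auto simp: ip_simps\<close>)
    finally show ?thesis using c(3)[OF i] by simp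
  qed
  then have "t * (nm u)\<^sup>2 \<le> Re (a u u)" using uD by (intro bound)
  moreover have "(nm u)\<^sup>2 = (\<Sum>j\<in>J. (cmod (c j))\<^sup>2 * Re (ip (f j) (f j)))"
    using ip_orthogonal_sum[OF fin(2) fV orth(1), where c = c] uD by (simp add: nm_sq u_def)
  moreover have "Re (a u u) = (\<Sum>j\<in>J. (cmod (c j))\<^sup>2 * Re (a (f j) (f j)))"
    using A.ip_orthogonal_sum[OF fin(2) f(1) orth(2), where c = c] by (simp add: u_def)
  \<comment> \<open>Strict inequality comes from the index \<open>j0\<close>, whose coefficient is
    nonzero.\<close>
  moreover have "(\<Sum>j\<in>J. (cmod (c j))\<^sup>2 * Re (a (f j) (f j))) < (\<Sum>j\<in>J. (cmod (c j))\<^sup>2 * (t * Re (ip (f j) (f j))))"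
  proof (rule sum_strict_mono_ex1)
    show "\<forall>j\<in>J. (cmod (c j))\<^sup>2 * Re (a (f j) (f j)) \<le> (cmod (c j))\<^sup>2 * (t * Re (ip (f j) (f j)))"
      using f(2) fV by (intro ballI mult_left_mono) (auto simp: nm_sq intro: less_imp_le)
    show "\<exists>j\<in>J. (cmod (c j))\<^sup>2 * Re (a (f j) (f j)) < (cmod (c j))\<^sup>2 * (t * Re (ip (f j) (f j)))"
      using c(1,2) f(2)[OF c(1)] fV[OF c(1)] by (intro bexI[of _ j0]) (auto simp: nm_sq)
  qed (fact fin(2))
  ultimately show False by (simp add: sum_distrib_left mult_ac)
qed

end

section \<open>Smooth functions and bumps\<close>

definition smooth :: "('a::euclidean_space \<Rightarrow> complex) \<Rightarrow> bool" where
  "smooth f \<longleftrightarrow> (\<forall>k. C_k k f)"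

lemma C_k_SucD: "C_k (Suc k) f \<Longrightarrow> C_k k f"
proof (induction k arbitrary: f)
  case 0
  then show ?case by (auto intro!: continuous_at_imp_continuous_on differentiable_imp_continuous_within)
next
  case (Suc k)
  then show ?case by (metis C_k.simps(2))
qed

lemma partial_derivI: "(f has_derivative f') (at x) \<Longrightarrow> partial_deriv i f x = f' i"
  unfolding partial_deriv_def using frechet_derivative_at by metis

lemma partial_deriv_has_derivative:
  "f differentiable (at x) \<Longrightarrow> (f has_derivative frechet_derivative f (at x)) (at x)"
  by (simp add: frechet_derivative_works)

lemma partial_deriv_add:
  "\<lbrakk>f differentiable (at x); g differentiable (at x)\<rbrakk>
    \<Longrightarrow> partial_deriv i (\<lambda>x. f x + g x) x = partial_deriv i f x + partial_deriv i g x"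
  by (rule partial_derivI[OF has_derivative_add[OF partial_deriv_has_derivative partial_deriv_has_derivative],
        folded partial_deriv_def])

lemma partial_deriv_mult:
  "\<lbrakk>f differentiable (at x); g differentiable (at x)\<rbrakk>
    \<Longrightarrow> partial_deriv i (\<lambda>x. f x * g x) x = f x * partial_deriv i g x + partial_deriv i f x * g x"
  by (rule partial_derivI[OF has_derivative_mult[OF partial_deriv_has_derivative partial_deriv_has_derivative],
        folded partial_deriv_def])

lemma partial_deriv_const: "partial_deriv i (\<lambda>x. c) = (\<lambda>x. 0)"
  by (rule ext, rule partial_derivI) simp

lemma C_k_const: "C_k k (\<lambda>x. c)"
  by (induction k arbitrary: c) (auto simp: partial_deriv_const)

lemma C_k_add: "C_k k f \<Longrightarrow> C_k k g \<Longrightarrow> C_k k (\<lambda>x. f x + g x)"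
proof (induction k arbitrary: f g)
  case (Suc k)
  then have "partial_deriv i (\<lambda>x. f x + g x) = (\<lambda>x. partial_deriv i f x + partial_deriv i g x)" for i
    by (intro ext partial_deriv_add) auto
  with Suc show ?case by auto
qed (auto intro: continuous_intros)

lemma C_k_mult: "C_k k f \<Longrightarrow> C_k k g \<Longrightarrow> C_k k (\<lambda>x. f x * g x)"
proof (induction k arbitrary: f g)
  case (Suc k)
  then have "partial_deriv i (\<lambda>x. f x * g x) = (\<lambda>x. f x * partial_deriv i g x + partial_deriv i f x * g x)" for i
    by (intro ext partial_deriv_mult) auto
  moreover have "C_k k f" "C_k k g" using Suc.prems C_k_SucD by blast+
  ultimately show ?case using Suc by (auto intro!: C_k_add)
qed (auto intro: continuous_intros)

lemma smooth_const [intro]: "smooth (\<lambda>x. c)"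
  by (simp add: smooth_def C_k_const)

lemma smooth_add [intro]: "smooth f \<Longrightarrow> smooth g \<Longrightarrow> smooth (\<lambda>x. f x + g x)"
  by (simp add: smooth_def C_k_add)

lemma smooth_mult [intro]: "smooth f \<Longrightarrow> smooth g \<Longrightarrow> smooth (\<lambda>x. f x * g x)"
  by (simp add: smooth_def C_k_mult)

lemma smooth_diff [intro]: "smooth f \<Longrightarrow> smooth g \<Longrightarrow> smooth (\<lambda>x. f x - g x)"
  using smooth_add[OF _ smooth_mult[OF smooth_const[of "-1"]], of f g] by simp

lemma smooth_prod: "(\<And>i. i \<in> I \<Longrightarrow> smooth (f i)) \<Longrightarrow> smooth (\<lambda>x. \<Prod>i\<in>I. f i x)"
  by (induction I rule: infinite_finite_induct) auto

lemma smooth_power: "smooth f \<Longrightarrow> smooth (\<lambda>x. f x ^ n)"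
  by (induction n) auto

lemma smooth_differentiable: "smooth f \<Longrightarrow> f differentiable (at x)"
  unfolding smooth_def by (metis C_k.simps(2))

lemma smooth_partial_deriv: "smooth f \<Longrightarrow> i \<in> Basis \<Longrightarrow> smooth (partial_deriv i f)"
  unfolding smooth_def by (metis C_k.simps(2))

lemma smooth_continuous: "smooth f \<Longrightarrow> continuous_on S f"
  unfolding smooth_def by (metis C_k.simps(1) continuous_on_subset subset_UNIV)

lemma smooth_affine: "smooth (\<lambda>x. complex_of_real (c * ((x - y) \<bullet> v)))"
proof -
  have der: "((\<lambda>x. complex_of_real (c * ((x - y) \<bullet> v))) has_derivative (\<lambda>w. complex_of_real (c * (w \<bullet> v)))) (at x)" for x
    by (auto intro!: derivative_eq_intros)
  have eq: "partial_deriv i (\<lambda>x. complex_of_real (c * ((x - y) \<bullet> v))) = (\<lambda>x. complex_of_real (c * (i \<bullet> v)))" for i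
    by (rule ext, rule partial_derivI[OF der])
  have "C_k k (\<lambda>x. complex_of_real (c * ((x - y) \<bullet> v)))" for k
  proof (cases k)
    case 0 then show ?thesis by (auto intro!: continuous_intros)
  next
    case (Suc n) then show ?thesis using der by (auto simp: eq C_k_const differentiable_def simp del: of_real_mult)
  qed
  then show ?thesis by (simp add: smooth_def)
qed

section \<open>Bump functions with explicit bounds\<close>

definition flat :: "nat \<Rightarrow> real \<Rightarrow> real" where
  "flat j t = (if t > 0 then exp (- 1 / t) / t ^ j else 0)"

lemma flat_nonneg: "0 \<le> flat j t"
  by (simp add: flat_def)

text \<open>From \<open>(1 + x / n)^n \<le> exp x\<close> at \<open>x = 1 / t\<close> with
  \<open>n = j + 2\<close>, two powers more than the division by \<open>t^j\<close> costs. Quadratic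
  decay at 0 makes the difference quotient there vanish in the limit.\<close>

lemma flat_le: "\<bar>flat j t\<bar> \<le> real (j + 2) ^ (j + 2) * t\<^sup>2"
proof (cases "t > 0")
  case True
  define n where "n = j + 2"
  have n: "0 < real n" by (simp add: n_def)
  have "(1 / (real n * t)) ^ n \<le> (1 + (1 / t) / real n) ^ n"
    using True n by (intro power_mono) (auto simp: field_simps)
  also have "\<dots> \<le> exp (1 / t)" using True n by (intro exp_ge_one_plus_x_over_n_power_n) (auto simp: n_def field_simps intro: order_trans[of _ 0])
  finally have "1 \<le> exp (1 / t) * (real n * t) ^ n" using True n by (simp add: power_divide field_simps)
  then have "exp (- 1 / t) \<le> real n ^ n * t ^ n"
    using True by (simp add: exp_minus field_simps power_mult_distrib)
  then have "exp (- 1 / t) / t ^ j \<le> real n ^ n * t ^ n / t ^ j" using True by (intro divide_right_mono) auto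
  also have "\<dots> = real n ^ n * t\<^sup>2" using True by (simp add: n_def power_add power2_eq_square)
  finally show ?thesis using True by (simp add: flat_def n_def)
qed (simp add: flat_def)

text \<open>The family is closed under differentiation up to linear combinations, so smoothness of
  all members follows by one induction on the order. Only \<open>t = 0\<close> is delicate, and
  there \<open>flat_le\<close> gives derivative 0.\<close>

lemma flat_has_derivative:
  "(flat j has_real_derivative (flat (j + 2) t - real j * flat (j + 1) t)) (at t)"
proof -
  consider "t > 0" | "t < 0" | "t = 0" by linarith
  then show ?thesis
  proof cases
    case 1
    have "((\<lambda>t. exp (- 1 / t) / t ^ j) has_real_derivative (flat (j + 2) t - real j * flat (j + 1) t)) (at t)"
    proof (cases j)
      case 0
      then show ?thesis using 1 by (auto intro!: derivative_eq_intros simp: flat_def power2_eq_square)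
    next
      case (Suc m)
      then show ?thesis using 1
        by (auto intro!: derivative_eq_intros simp: flat_def power2_eq_square field_simps) (cases m; simp)
    qed
    then show ?thesis
      by (rule DERIV_cong_ev[THEN iffD1, rotated 3])
        (use 1 in \<open>auto simp: flat_def eventually_nhds intro!: exI[of _ "{0<..}"]\<close>)
  next
    case 2
    have "((\<lambda>t. 0) has_real_derivative (flat (j + 2) t - real j * flat (j + 1) t)) (at t)"
      using 2 by (simp add: flat_def)
    then show ?thesis
      by (rule DERIV_cong_ev[THEN iffD1, rotated 3])
        (use 2 in \<open>auto simp: flat_def eventually_nhds intro!: exI[of _ "{..<0}"]\<close>)
  next
    case 3
    define C where "C = real (j + 2) ^ (j + 2)"
    have "((\<lambda>h. flat j h / h) \<longlongrightarrow> 0) (at 0)"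
    proof (rule Lim_null_comparison)
      show "\<forall>\<^sub>F h in at 0. norm (flat j h / h) \<le> C * \<bar>h\<bar>"
      proof (intro eventually_at_filter[THEN iffD2] always_eventually allI impI)
        fix h :: real assume "h \<noteq> 0"
        have "norm (flat j h / h) = \<bar>flat j h\<bar> / \<bar>h\<bar>" by simp
        also have "\<dots> \<le> C * h\<^sup>2 / \<bar>h\<bar>" using flat_le[of j h] unfolding C_def by (intro divide_right_mono) auto
        also have "\<dots> = C * \<bar>h\<bar>" using \<open>h \<noteq> 0\<close> by (simp add: field_simps power2_eq_square)
        finally show "norm (flat j h / h) \<le> C * \<bar>h\<bar>" .
      qed
      show "((\<lambda>h. C * \<bar>h\<bar>) \<longlongrightarrow> 0) (at 0)" by (auto intro!: tendsto_eq_intros)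
    qed
    then show ?thesis using 3 by (simp add: DERIV_def flat_def)
  qed
qed

text \<open>The 4 makes the function vanish outside the ball of radius \<open>2 * r\<close>, while
  on the ball of radius \<open>r\<close> the argument of \<open>flat\<close> exceeds 3 and the bump
  stays away from 0. The index \<open>j\<close> keeps derivatives within the family.\<close>

definition bump_gen :: "nat \<Rightarrow> real \<Rightarrow> 'a::euclidean_space \<Rightarrow> 'a \<Rightarrow> real" where
  "bump_gen j r y x = flat j (4 - (norm (x - y))\<^sup>2 / r\<^sup>2)"

abbreviation bump :: "real \<Rightarrow> 'a::euclidean_space \<Rightarrow> 'a \<Rightarrow> real" where
  "bump \<equiv> bump_gen 0"

lemma bump_gen_has_derivative:
  "((\<lambda>x. complex_of_real (bump_gen j r y x)) has_derivative
     (\<lambda>v. complex_of_real ((bump_gen (j+2) r y x - real j * bump_gen (j+1) r y x) * (- 2 / r\<^sup>2 * ((x - y) \<bullet> v))))) (at x)"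
proof -
  have 1: "((\<lambda>x. 4 - (norm (x - y))\<^sup>2 / r\<^sup>2) has_derivative (\<lambda>v. - 2 / r\<^sup>2 * ((x - y) \<bullet> v))) (at x)"
  proof -
    have "((\<lambda>x. (x - y) \<bullet> (x - y)) has_derivative (\<lambda>v. 2 * ((x - y) \<bullet> v))) (at x)"
      by (auto intro!: derivative_eq_intros simp: inner_commute)
    from has_derivative_diff[OF has_derivative_const bounded_linear.has_derivative[OF bounded_linear_divide this], of 4 "r\<^sup>2"]
    show ?thesis unfolding power2_norm_eq_inner by simp
  qed
  have "((\<lambda>x. flat j (4 - (norm (x - y))\<^sup>2 / r\<^sup>2)) has_derivative
     (\<lambda>v. (bump_gen (j+2) r y x - real j * bump_gen (j+1) r y x) * (- 2 / r\<^sup>2 * ((x - y) \<bullet> v)))) (at x)"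
    using has_derivative_compose[OF 1 flat_has_derivative[THEN has_field_derivative_imp_has_derivative]]
    by (simp add: bump_gen_def)
  from has_derivative_of_real[OF this, where 'a = complex] show ?thesis by (simp add: bump_gen_def)
qed

lemma bump_gen_partial_deriv:
  "partial_deriv i (\<lambda>x. complex_of_real (bump_gen j r y x)) =
     (\<lambda>x. (complex_of_real (bump_gen (j+2) r y x) + of_real (- real j) * of_real (bump_gen (j+1) r y x))
        * complex_of_real (- 2 / r\<^sup>2 * ((x - y) \<bullet> i)))"
  by (rule ext, subst partial_derivI[OF bump_gen_has_derivative]) (simp add: algebra_simps)

lemma smooth_bump_gen: "smooth (\<lambda>x. complex_of_real (bump_gen j r y x))"
proof -
  have "C_k k (\<lambda>x. complex_of_real (bump_gen j r y x))" for k
  proof (induction k arbitrary: j)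
    case 0
    have "isCont (\<lambda>x. complex_of_real (bump_gen j r y x)) x" for x
      by (rule has_derivative_continuous[OF bump_gen_has_derivative])
    then show ?case unfolding C_k.simps by (intro continuous_at_imp_continuous_on ballI)
  next
    case (Suc k)
    have "C_k k (\<lambda>x. complex_of_real (- 2 / r\<^sup>2 * ((x - y) \<bullet> i)))" for i
      using smooth_affine unfolding smooth_def by blast
    then have "C_k k (partial_deriv i (\<lambda>x. complex_of_real (bump_gen j r y x)))" for i
      unfolding bump_gen_partial_deriv by (intro C_k_mult C_k_add C_k_const Suc)
    then show ?case using bump_gen_has_derivative[of j r y] by (auto simp: differentiable_def)
  qed
  then show ?thesis by (simp add: smooth_def)
qed

lemma bump_nonneg: "0 \<le> bump r y x"
  by (simp add: bump_gen_def flat_nonneg)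

lemma bump_le_1: "bump r y x \<le> 1"
  by (simp add: bump_gen_def flat_def)

lemma bump_pos_iff: "0 < r \<Longrightarrow> 0 < bump r y x \<longleftrightarrow> x \<in> ball y (2 * r)"
proof -
  assume r: "0 < r"
  have "0 < 4 - (norm (x - y))\<^sup>2 / r\<^sup>2 \<longleftrightarrow> (norm (x - y))\<^sup>2 < (2 * r)\<^sup>2"
    using r by (simp add: field_simps)
  also have "\<dots> \<longleftrightarrow> norm (x - y) < 2 * r"     by (subst (1 2) not_le[symmetric], subst power_mono_iff) (use r in auto)
  finally show ?thesis by (auto simp: bump_gen_def flat_def dist_norm norm_minus_commute)
qed

lemma bump_gen_zero: "0 < r \<Longrightarrow> x \<notin> ball y (2 * r) \<Longrightarrow> bump_gen j r y x = 0"
proof -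
  assume r: "0 < r" "x \<notin> ball y (2 * r)"
  then have "(2 * r)\<^sup>2 \<le> (norm (x - y))\<^sup>2" by (intro power_mono) (auto simp: dist_norm norm_minus_commute)
  then show ?thesis using r by (simp add: bump_gen_def flat_def field_simps)
qed

text \<open>The argument of \<open>flat\<close> exceeds 3 on this ball, and
  \<open>exp (-2/3) \<ge> 1 - 2/3\<close>.\<close>

lemma bump_sq_ge: assumes r: "0 < r" and x: "x \<in> ball y r" shows "1 / 3 \<le> (bump r y x)\<^sup>2"
proof -
  define t where "t = 4 - (norm (x - y))\<^sup>2 / r\<^sup>2"
  have "(norm (x - y))\<^sup>2 < r\<^sup>2"
    using x by (intro power_strict_mono) (auto simp: dist_norm norm_minus_commute)
  then have t: "3 < t" using r by (simp add: t_def field_simps)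
  have "(bump r y x)\<^sup>2 = exp (- (2 / t))" using t by (simp add: bump_gen_def flat_def t_def[symmetric] flip: exp_double)
  moreover have "1 + - (2 / t) \<le> exp (- (2 / t))" by (rule exp_ge_add_one_self)
  moreover have "2 / t \<le> 2 / 3" using t by (intro divide_left_mono) auto
  ultimately show ?thesis by linarith
qed

text \<open>In terms of \<open>s = 1 / t\<close> this is \<open>s^2 \<le> exp s\<close>, the square
  of \<open>s \<le> exp (s / 2)\<close>, which the quadratic Taylor polynomial already
  yields.\<close>

lemma bump_gen_2_le: "bump_gen 2 r y x \<le> 1"
proof -
  have "flat 2 t \<le> 1" for t
  proof (cases "t > 0")
    case True
    define s where "s = 1 / t"
    have s: "0 < s" using True by (simp add: s_def)
    have "0 \<le> (s - 2)\<^sup>2" by simp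
    then have "s \<le> 1 + s / 2 + (s / 2)\<^sup>2 / 2" using s by (simp add: power2_eq_square algebra_simps)
    also have "\<dots> \<le> exp (s / 2)" using s by (intro exp_lower_Taylor_quadratic) auto
    finally have "s\<^sup>2 \<le> (exp (s / 2))\<^sup>2" using s by (intro power_mono) auto
    also have "\<dots> = exp s" by (simp flip: exp_double)
    finally have "exp (- s) * s\<^sup>2 \<le> 1" by (simp add: exp_minus field_simps)
    then show ?thesis using True by (simp add: flat_def s_def power_one_over field_simps)
  qed (simp add: flat_def)
  then show ?thesis by (simp add: bump_gen_def)
qed

text \<open>The gradient is \<open>bump_gen 2\<close> times \<open>-2 * (x - y) / r^2\<close>. Since
  that factor is at most 1 and \<open>norm (x - y) < 2 * r\<close> on the ball, the squared length
  is at most \<open>(2 / r^2)^2 * (2 * r)^2\<close>.\<close>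

lemma bump_gradient:
  assumes r: "0 < r"
  shows "(\<Sum>i\<in>Basis. (cmod (partial_deriv i (\<lambda>x. complex_of_real (bump r y x)) x))\<^sup>2)
    \<le> 16 / r\<^sup>2 * indicator (ball y (2 * r)) x"
proof (cases "x \<in> ball y (2 * r)")
  case False
  then show ?thesis using r by (simp add: bump_gen_partial_deriv bump_gen_zero)
next
  case True
  have "(\<Sum>i\<in>Basis. (cmod (partial_deriv i (\<lambda>x. complex_of_real (bump r y x)) x))\<^sup>2)
      = (\<Sum>i\<in>Basis. (bump_gen 2 r y x * 2 / r\<^sup>2)\<^sup>2 * ((x - y) \<bullet> i)\<^sup>2)"
    by (simp add: bump_gen_partial_deriv norm_mult norm_divide power_mult_distrib power_divide numeral_2_eq_2[symmetric] norm_power mult_ac)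
  also have "\<dots> = (bump_gen 2 r y x * 2 / r\<^sup>2)\<^sup>2 * (norm (x - y))\<^sup>2"
    by (simp add: sum_distrib_left[symmetric] euclidean_inner[of "x - y" "x - y"] power2_norm_eq_inner flip: power2_eq_square)
  also have "\<dots> \<le> (1 * 2 / r\<^sup>2)\<^sup>2 * (2 * r)\<^sup>2"
    using True r bump_gen_2_le[of r y x]
    by (intro mult_mono power_mono divide_right_mono mult_right_mono)
       (auto simp: dist_norm norm_minus_commute bump_gen_def flat_nonneg)
  also have "\<dots> = 16 / r\<^sup>2" using r by (simp add: power2_eq_square field_simps)
  finally show ?thesis using True by simp
qed

section \<open>The space of square integrable functions\<close>

text \<open>The squared L2 norm as an extended real, free of the root and the case distinction in
  \<open>Lp_norm\<close>.\<close>

definition sq_int :: "'a::euclidean_space set \<Rightarrow> ('a \<Rightarrow> complex) \<Rightarrow> ennreal" where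
  "sq_int \<Omega> f = (\<integral>\<^sup>+x. ennreal ((cmod (f x))\<^sup>2) \<partial>lebesgue_on \<Omega>)"

lemma Lp_norm_2: "Lp_norm 2 \<Omega> f = (if sq_int \<Omega> f = \<infinity> then \<infinity> else ennreal (sqrt (enn2real (sq_int \<Omega> f))))"
  by (simp add: Lp_norm_def sq_int_def Let_def powr_half_sqrt)

lemma Lp_norm_2_sq: "(Lp_norm 2 \<Omega> f)\<^sup>2 = sq_int \<Omega> f"
  by (auto simp: Lp_norm_2 ennreal_power ennreal_enn2real_if)

lemma Lp_norm_1: "Lp_norm 1 \<Omega> f = (\<integral>\<^sup>+x. ennreal (cmod (f x)) \<partial>lebesgue_on \<Omega>)"
  by (auto simp: Lp_norm_def Let_def ennreal_enn2real_if)

lemma Lp_norm_2_tendsto_0: "(\<lambda>n. Lp_norm 2 \<Omega> (f n)) \<longlonglongrightarrow> 0 \<longleftrightarrow> (\<lambda>n. sq_int \<Omega> (f n)) \<longlonglongrightarrow> 0"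
proof
  assume lim: "(\<lambda>n. Lp_norm 2 \<Omega> (f n)) \<longlonglongrightarrow> 0"
  have "(\<lambda>n. Lp_norm 2 \<Omega> (f n) * Lp_norm 2 \<Omega> (f n)) \<longlonglongrightarrow> 0 * 0"
    by (rule tendsto_mult_ennreal[OF lim lim]) auto
  moreover have "Lp_norm 2 \<Omega> (f n) * Lp_norm 2 \<Omega> (f n) = sq_int \<Omega> (f n)" for n
    by (metis Lp_norm_2_sq power2_eq_square)
  ultimately show "(\<lambda>n. sq_int \<Omega> (f n)) \<longlonglongrightarrow> 0" by (metis (no_types, lifting) ext mult_zero_left)
next
  assume lim: "(\<lambda>n. sq_int \<Omega> (f n)) \<longlonglongrightarrow> 0"
  have "(\<lambda>n. enn2real (sq_int \<Omega> (f n))) \<longlonglongrightarrow> 0" by (rule tendsto_enn2real) (use lim in auto)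
  then have "(\<lambda>n. ennreal (sqrt (enn2real (sq_int \<Omega> (f n))))) \<longlonglongrightarrow> ennreal (sqrt 0)"
    by (intro tendsto_ennrealI tendsto_real_sqrt)
  moreover have "\<forall>\<^sub>F n in sequentially. sq_int \<Omega> (f n) < \<infinity>"
    using order_tendstoD(2)[OF lim, of \<infinity>] by simp
  then have "\<forall>\<^sub>F n in sequentially. ennreal (sqrt (enn2real (sq_int \<Omega> (f n)))) = Lp_norm 2 \<Omega> (f n)"
    by eventually_elim (simp add: Lp_norm_2)
  ultimately show "(\<lambda>n. Lp_norm 2 \<Omega> (f n)) \<longlonglongrightarrow> 0"
    using Lim_transform_eventually by force
qed

lemma L2_iff_sq_int: "f \<in> L2 \<Omega> \<longleftrightarrow> f \<in> borel_measurable (lebesgue_on \<Omega>) \<and> sq_int \<Omega> f < \<infinity>"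
  by (auto simp: L2_def Lp_norm_2 less_top)

lemma L2_iff: "f \<in> L2 \<Omega> \<longleftrightarrow> f \<in> borel_measurable (lebesgue_on \<Omega>) \<and> integrable (lebesgue_on \<Omega>) (\<lambda>x. (cmod (f x))\<^sup>2)"
  unfolding L2_iff_sq_int sq_int_def by (auto simp: integrable_iff_bounded)

lemma L2_measurable [measurable_dest]: "f \<in> L2 \<Omega> \<Longrightarrow> f \<in> borel_measurable (lebesgue_on \<Omega>)"
  by (simp add: L2_iff)

lemma L2_sq_int: "f \<in> L2 \<Omega> \<Longrightarrow> sq_int \<Omega> f = ennreal (\<integral>x. (cmod (f x))\<^sup>2 \<partial>lebesgue_on \<Omega>)"
  unfolding L2_iff sq_int_def by (intro nn_integral_eq_integral) auto

lemma sq_int_add: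
  assumes [measurable]: "f \<in> borel_measurable (lebesgue_on \<Omega>)" "g \<in> borel_measurable (lebesgue_on \<Omega>)"
  shows "sq_int \<Omega> (\<lambda>x. f x + g x) \<le> 2 * sq_int \<Omega> f + 2 * sq_int \<Omega> g"
proof -
  have pt: "(cmod (f x + g x))\<^sup>2 \<le> 2 * (cmod (f x))\<^sup>2 + 2 * (cmod (g x))\<^sup>2" for x
  proof -
    have "(cmod (f x + g x))\<^sup>2 \<le> (cmod (f x) + cmod (g x))\<^sup>2" by (intro power_mono norm_triangle_ineq) auto
    moreover have "0 \<le> (cmod (f x) - cmod (g x))\<^sup>2" by simp
    ultimately show ?thesis by (simp add: power2_eq_square algebra_simps)
  qed
  have "sq_int \<Omega> (\<lambda>x. f x + g x) \<le> (\<integral>\<^sup>+x. 2 * ennreal ((cmod (f x))\<^sup>2) + 2 * ennreal ((cmod (g x))\<^sup>2) \<partial>lebesgue_on \<Omega>)"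
    unfolding sq_int_def
  proof (intro nn_integral_mono)
    fix x
    have "2 * ennreal ((cmod (f x))\<^sup>2) + 2 * ennreal ((cmod (g x))\<^sup>2) = ennreal (2 * (cmod (f x))\<^sup>2 + 2 * (cmod (g x))\<^sup>2)"
      by (simp add: ennreal_plus ennreal_mult)
    then show "ennreal ((cmod (f x + g x))\<^sup>2) \<le> 2 * ennreal ((cmod (f x))\<^sup>2) + 2 * ennreal ((cmod (g x))\<^sup>2)"
      using ennreal_leI[OF pt[of x]] by metis
  qed
  also have "\<dots> = 2 * sq_int \<Omega> f + 2 * sq_int \<Omega> g"
    unfolding sq_int_def by (subst nn_integral_add) (auto simp: nn_integral_cmult)
  finally show ?thesis .
qed

lemma sq_int_le:
  assumes [measurable]: "f \<in> borel_measurable (lebesgue_on \<Omega>)"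
    and le: "AE x in lebesgue_on \<Omega>. cmod (g x) \<le> B * cmod (f x)" and B: "0 \<le> B"
  shows "sq_int \<Omega> g \<le> ennreal (B\<^sup>2) * sq_int \<Omega> f"
proof -
  have "sq_int \<Omega> g \<le> (\<integral>\<^sup>+x. ennreal (B\<^sup>2) * ennreal ((cmod (f x))\<^sup>2) \<partial>lebesgue_on \<Omega>)"
    unfolding sq_int_def
  proof (intro nn_integral_mono_AE, use le in eventually_elim)
    fix x assume "cmod (g x) \<le> B * cmod (f x)"
    then have "(cmod (g x))\<^sup>2 \<le> (B * cmod (f x))\<^sup>2" by (intro power_mono) auto
    then show "ennreal ((cmod (g x))\<^sup>2) \<le> ennreal (B\<^sup>2) * ennreal ((cmod (f x))\<^sup>2)"
      by (simp add: power_mult_distrib flip: ennreal_mult)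
  qed
  also have "\<dots> = ennreal (B\<^sup>2) * sq_int \<Omega> f" unfolding sq_int_def by (simp add: nn_integral_cmult)
  finally show ?thesis .
qed

lemma sq_int_cong_AE: "AE x in lebesgue_on \<Omega>. f x = g x \<Longrightarrow> sq_int \<Omega> f = sq_int \<Omega> g"
  unfolding sq_int_def by (intro nn_integral_cong_AE) auto

lemma L2_add: assumes "f \<in> L2 \<Omega>" "g \<in> L2 \<Omega>" shows "(\<lambda>x. f x + g x) \<in> L2 \<Omega>"
proof -
  have m: "f \<in> borel_measurable (lebesgue_on \<Omega>)" "g \<in> borel_measurable (lebesgue_on \<Omega>)"
    using assms by (auto simp: L2_iff)
  have "sq_int \<Omega> (\<lambda>x. f x + g x) \<le> 2 * sq_int \<Omega> f + 2 * sq_int \<Omega> g" by (rule sq_int_add[OF m])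
  also have "\<dots> < \<infinity>" using assms by (auto simp: L2_iff_sq_int ennreal_mult_less_top)
  finally show ?thesis using m by (auto simp: L2_iff_sq_int)
qed

lemma L2_bounded_mult:
  assumes f: "f \<in> L2 \<Omega>" and m [measurable]: "c \<in> borel_measurable (lebesgue_on \<Omega>)" and c: "\<And>x. cmod (c x) \<le> B"
  shows "(\<lambda>x. c x * f x) \<in> L2 \<Omega>"
proof -
  have [measurable]: "f \<in> borel_measurable (lebesgue_on \<Omega>)" using f by (rule L2_measurable)
  have B: "0 \<le> B" using c[of undefined] norm_ge_zero order_trans by blast
  have "sq_int \<Omega> (\<lambda>x. c x * f x) \<le> ennreal (B\<^sup>2) * sq_int \<Omega> f"
    by (rule sq_int_le) (use c B in \<open>auto simp: norm_mult mult_right_mono\<close>)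
  also have "\<dots> < \<infinity>" using f by (auto simp: L2_iff_sq_int ennreal_mult_less_top)
  finally show ?thesis by (simp add: L2_iff_sq_int)
qed

lemma L2_cmult: "f \<in> L2 \<Omega> \<Longrightarrow> (\<lambda>x. c * f x) \<in> L2 \<Omega>"
  by (rule L2_bounded_mult[of _ _ "\<lambda>_. c"]) auto

lemma L2_zero: "(\<lambda>x. 0) \<in> L2 \<Omega>"
  by (simp add: L2_iff)

lemma L2_integrable_mult:
  assumes f: "f \<in> L2 \<Omega>" and g: "g \<in> L2 \<Omega>" shows "integrable (lebesgue_on \<Omega>) (\<lambda>x. f x * g x)"
proof (rule Bochner_Integration.integrable_bound)
  show "integrable (lebesgue_on \<Omega>) (\<lambda>x. (cmod (f x))\<^sup>2 + (cmod (g x))\<^sup>2)"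
    using f g by (auto simp: L2_iff)
  show "(\<lambda>x. f x * g x) \<in> borel_measurable (lebesgue_on \<Omega>)"
    using f g by (auto simp: L2_iff)
  have "norm (f x * g x) \<le> norm ((cmod (f x))\<^sup>2 + (cmod (g x))\<^sup>2)" for x
  proof -
    have "0 \<le> (cmod (f x) - cmod (g x))\<^sup>2" by simp
    moreover have "0 \<le> cmod (f x) * cmod (g x)" by simp
    ultimately have "cmod (f x) * cmod (g x) \<le> (cmod (f x))\<^sup>2 + (cmod (g x))\<^sup>2"
      by (simp only: power2_diff)
    then show ?thesis by (simp add: norm_mult)
  qed
  then show "AE x in lebesgue_on \<Omega>. norm (f x * g x) \<le> norm ((cmod (f x))\<^sup>2 + (cmod (g x))\<^sup>2)" by simp
qed

lemma L2_cnj: "f \<in> L2 \<Omega> \<Longrightarrow> (\<lambda>x. cnj (f x)) \<in> L2 \<Omega>"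
  by (auto simp: L2_iff intro: borel_measurable_continuous_on[of cnj] continuous_intros)

definition cscale :: "complex \<Rightarrow> ('a \<Rightarrow> complex) \<Rightarrow> 'a \<Rightarrow> complex" where
  "cscale c f = (\<lambda>x. c * f x)"

lemma vector_space_cscale: "vector_space cscale"
  by unfold_locales (auto simp: cscale_def fun_eq_iff algebra_simps)

lemma L2_semi_inner: "semi_inner cscale (L2 \<Omega>) (L2_inner \<Omega>)"
proof -
  interpret vector_space cscale by (rule vector_space_cscale)
  note int = L2_integrable_mult[OF _ L2_cnj]
  show ?thesis
  proof
    show "subspace (L2 \<Omega>)"
      by (auto simp: subspace_def plus_fun_def cscale_def zero_fun_def L2_zero intro: L2_add L2_cmult)
  next
    fix f g h assume "f \<in> L2 \<Omega>" "g \<in> L2 \<Omega>" "h \<in> L2 \<Omega>"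
    then show "L2_inner \<Omega> (f + g) h = L2_inner \<Omega> f h + L2_inner \<Omega> g h"
      by (simp add: L2_inner_def distrib_right Bochner_Integration.integral_add int)
  next
    fix f g c assume "f \<in> L2 \<Omega>" "g \<in> L2 \<Omega>"
    then show "L2_inner \<Omega> (cscale c f) g = c * L2_inner \<Omega> f g"
      by (simp add: L2_inner_def cscale_def mult.assoc)
  next
    fix f g show "L2_inner \<Omega> g f = cnj (L2_inner \<Omega> f g)"
    proof -
      have "L2_inner \<Omega> g f = (\<integral>x. cnj (f x * cnj (g x)) \<partial>lebesgue_on \<Omega>)"
        by (simp add: L2_inner_def mult.commute del: Bochner_Integration.integral_cnj)
      also have "\<dots> = cnj (L2_inner \<Omega> f g)" unfolding L2_inner_def by (rule Bochner_Integration.integral_cnj)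
      finally show ?thesis .
    qed
  next
    fix f have "L2_inner \<Omega> f f = of_real (\<integral>x. (cmod (f x))\<^sup>2 \<partial>lebesgue_on \<Omega>)"
      unfolding L2_inner_def by (subst integral_complex_of_real[symmetric]) (simp only: complex_norm_square)
    then show "0 \<le> Re (L2_inner \<Omega> f f)" by simp
  qed
qed

lemma L2_inner_self: "L2_inner \<Omega> f f = of_real (\<integral>x. (cmod (f x))\<^sup>2 \<partial>lebesgue_on \<Omega>)"
  unfolding L2_inner_def by (subst integral_complex_of_real[symmetric]) (simp only: complex_norm_square)

abbreviation L2_nm :: "'a::euclidean_space set \<Rightarrow> ('a \<Rightarrow> complex) \<Rightarrow> real" where
  "L2_nm \<Omega> \<equiv> semi_inner.nm (L2_inner \<Omega>)"

lemma L2_nm_sq: "(L2_nm \<Omega> f)\<^sup>2 = (\<integral>x. (cmod (f x))\<^sup>2 \<partial>lebesgue_on \<Omega>)"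
  unfolding semi_inner.nm_def[OF L2_semi_inner] L2_inner_self by (simp add: Bochner_Integration.integral_nonneg)

lemma L2_nm_nonneg: "0 \<le> L2_nm \<Omega> f"
  unfolding semi_inner.nm_def[OF L2_semi_inner] L2_inner_self by (simp add: Bochner_Integration.integral_nonneg)

lemma sq_int_L2_nm: "f \<in> L2 \<Omega> \<Longrightarrow> sq_int \<Omega> f = ennreal ((L2_nm \<Omega> f)\<^sup>2)"
  by (simp add: L2_nm_sq L2_sq_int)

lemma L2_nm_eq_0_iff:
  assumes "f \<in> L2 \<Omega>" shows "L2_nm \<Omega> f = 0 \<longleftrightarrow> (AE x in lebesgue_on \<Omega>. f x = 0)"
proof -
  have "L2_nm \<Omega> f = 0 \<longleftrightarrow> (\<integral>x. (cmod (f x))\<^sup>2 \<partial>lebesgue_on \<Omega>) = 0"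
    using L2_nm_sq[of \<Omega> f] by (metis zero_eq_power2)
  also have "\<dots> \<longleftrightarrow> (AE x in lebesgue_on \<Omega>. f x = 0)"
    using assms by (subst integral_nonneg_eq_0_iff_AE) (auto simp: L2_iff)
  finally show ?thesis .
qed

text \<open>Riesz-Fischer for geometrically convergent sequences. The function \<open>H\<close> sums
  the squared increments with weights \<open>\<rho>^(-n)\<close>. Its integral is finite because
  their integrals decay like \<open>\<rho>^(2 n)\<close>, and wherever \<open>H\<close> is finite
  the increments are at most \<open>sqrt H * s^n\<close>. So one integrable function yields both the
  pointwise limit and the rate in L2.\<close>

lemma L2_complete:
  fixes x :: "nat \<Rightarrow> 'a::euclidean_space \<Rightarrow> complex"
  assumes x: "\<And>n. x n \<in> L2 \<Omega>" and le: "\<And>n. L2_nm \<Omega> (x (Suc n) - x n) \<le> C * q ^ n" and q: "0 \<le> q" "q < 1"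
  shows "\<exists>p\<in>L2 \<Omega>. (\<lambda>n. L2_nm \<Omega> (x n - p)) \<longlonglongrightarrow> 0"
proof -
  interpret semi_inner cscale "L2 \<Omega>" "L2_inner \<Omega>" by (rule L2_semi_inner)
  have [measurable]: "x n \<in> borel_measurable (lebesgue_on \<Omega>)" for n using x[of n] by (simp add: L2_iff)
  \<comment> \<open>At least 1/2, so that dividing by powers of \<open>\<rho>\<close> is possible
    even for \<open>q = 0\<close>.\<close>
  define \<rho> where "\<rho> = max q (1/2)"
  define s where "s = sqrt \<rho>"
  have \<rho>: "0 < \<rho>" "\<rho> < 1" "q \<le> \<rho>" using q by (auto simp: \<rho>_def)
  have s: "0 < s" "s < 1" "s\<^sup>2 = \<rho>" using \<rho> by (auto simp: s_def)
  have sn: "(s ^ n)\<^sup>2 = \<rho> ^ n" for n by (metis power_mult mult.commute s(3))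
  have C: "0 \<le> C" using le[of 0] L2_nm_nonneg[of \<Omega> "x (Suc 0) - x 0"] by simp
  define d where "d n y = cmod (x (Suc n) y - x n y)" for n y
  have [measurable]: "d n \<in> borel_measurable (lebesgue_on \<Omega>)" for n unfolding d_def by measurable
  define H where "H y = (\<Sum>n. ennreal ((d n y)\<^sup>2 / \<rho> ^ n))" for y
  have [measurable]: "H \<in> borel_measurable (lebesgue_on \<Omega>)" unfolding H_def by measurable
  have dint: "(\<integral>\<^sup>+y. ennreal ((d n y)\<^sup>2) \<partial>lebesgue_on \<Omega>) \<le> ennreal (C\<^sup>2 * \<rho> ^ (2 * n))" for n
  proof -
    have "(\<integral>\<^sup>+y. ennreal ((d n y)\<^sup>2) \<partial>lebesgue_on \<Omega>) = sq_int \<Omega> (x (Suc n) - x n)" by (simp add: sq_int_def d_def)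
    also have "\<dots> = ennreal ((L2_nm \<Omega> (x (Suc n) - x n))\<^sup>2)" using x by (intro sq_int_L2_nm) auto
    also have "\<dots> \<le> ennreal ((C * \<rho> ^ n)\<^sup>2)"
    proof (intro ennreal_leI power_mono)
      have "C * q ^ n \<le> C * \<rho> ^ n" using C q \<rho> by (intro mult_left_mono power_mono) auto
      then show "L2_nm \<Omega> (x (Suc n) - x n) \<le> C * \<rho> ^ n" using le[of n] by simp
    qed (simp add: L2_nm_nonneg)
    finally show ?thesis by (simp add: power_mult_distrib power_mult power2_eq_square mult_ac flip: power_add)
  qed
  have Hint: "(\<integral>\<^sup>+y. H y \<partial>lebesgue_on \<Omega>) \<le> ennreal (C\<^sup>2 / (1 - \<rho>))"
  proof -
    have "(\<integral>\<^sup>+y. H y \<partial>lebesgue_on \<Omega>) = (\<Sum>n. \<integral>\<^sup>+y. ennreal ((d n y)\<^sup>2 / \<rho> ^ n) \<partial>lebesgue_on \<Omega>)"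
      unfolding H_def by (rule nn_integral_suminf) measurable
    also have "\<dots> \<le> (\<Sum>n. ennreal (C\<^sup>2 * \<rho> ^ n))"
    proof (intro suminf_le)
      fix n
      have "(\<integral>\<^sup>+y. ennreal ((d n y)\<^sup>2 / \<rho> ^ n) \<partial>lebesgue_on \<Omega>) = ennreal (1 / \<rho> ^ n) * (\<integral>\<^sup>+y. ennreal ((d n y)\<^sup>2) \<partial>lebesgue_on \<Omega>)"
        using \<rho> by (subst nn_integral_cmult[symmetric]) (auto simp flip: ennreal_mult)
      also have "\<dots> \<le> ennreal (1 / \<rho> ^ n) * ennreal (C\<^sup>2 * \<rho> ^ (2 * n))" by (intro mult_left_mono dint) auto
      also have "\<dots> = ennreal (C\<^sup>2 * \<rho> ^ n)"
        using \<rho> by (subst ennreal_mult[symmetric]) (auto simp: field_simps mult_2_right power_add)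
      finally show "(\<integral>\<^sup>+y. ennreal ((d n y)\<^sup>2 / \<rho> ^ n) \<partial>lebesgue_on \<Omega>) \<le> ennreal (C\<^sup>2 * \<rho> ^ n)" .
    qed auto
    also have "\<dots> = ennreal (\<Sum>n. C\<^sup>2 * \<rho> ^ n)"
      using \<rho> by (intro suminf_ennreal2 summable_mult summable_geometric) auto
    also have "(\<Sum>n. C\<^sup>2 * \<rho> ^ n) = C\<^sup>2 / (1 - \<rho>)"
      using \<rho> by (subst suminf_mult) (auto simp: suminf_geometric summable_geometric)
    finally show ?thesis .
  qed
  then have "AE y in lebesgue_on \<Omega>. H y \<noteq> \<infinity>"
    by (intro nn_integral_PInf_AE) (auto simp: top_unique)
  define p where "p y = lim (\<lambda>n. x n y)" for y
  have [measurable]: "p \<in> borel_measurable (lebesgue_on \<Omega>)" unfolding p_def by measurable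
  have pt: "cmod (x n y - p y) \<le> sqrt (enn2real (H y)) * (s ^ n / (1 - s))" if Hy: "H y \<noteq> \<infinity>" for y n
  proof -
    define S where "S = sqrt (enn2real (H y))"
    have dS: "d n y \<le> S * s ^ n" for n
    proof -
      have "ennreal ((d n y)\<^sup>2 / \<rho> ^ n) \<le> H y"
        unfolding H_def using sum_le_suminf[of "\<lambda>n. ennreal ((d n y)\<^sup>2 / \<rho> ^ n)" "{n}"] by simp
      also have "H y = ennreal (enn2real (H y))" using Hy by (simp add: ennreal_enn2real_if)
      finally have "(d n y)\<^sup>2 / \<rho> ^ n \<le> enn2real (H y)" by (simp add: ennreal_le_iff)
      then have "(d n y)\<^sup>2 \<le> enn2real (H y) * (s ^ n)\<^sup>2"
        using \<rho> sn[of n] by (simp add: field_simps)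
      also have "\<dots> = (S * s ^ n)\<^sup>2" by (simp add: S_def power_mult_distrib)
      finally show ?thesis using s by (intro power2_le_imp_le[of "d n y"]) (auto simp: S_def)
    qed
    have "summable (\<lambda>n. S * s ^ n)" using s by (intro summable_mult summable_geometric) auto
    then have sm: "summable (\<lambda>n. x (Suc n) y - x n y)"
      by (rule summable_comparison_test[rotated]) (use dS in \<open>auto simp: d_def\<close>)
    have tele: "(\<Sum>k<m. x (Suc k) y - x k y) = x m y - x 0 y" for m by (induction m) auto
    have "(\<lambda>m. x m y - x 0 y) \<longlonglongrightarrow> suminf (\<lambda>n. x (Suc n) y - x n y)"
      using summable_LIMSEQ[OF sm] unfolding tele .
    then have "(\<lambda>m. x m y - x 0 y + x 0 y) \<longlonglongrightarrow> suminf (\<lambda>n. x (Suc n) y - x n y) + x 0 y" by (intro tendsto_intros)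
    then have lim: "(\<lambda>m. x m y) \<longlonglongrightarrow> p y" unfolding p_def by (simp add: limI)
    have part: "cmod (x n y - x (n + m) y) \<le> S * (s ^ n / (1 - s))" for m
    proof -
      have "cmod (x n y - x (n + m) y) \<le> S * s ^ n * (1 - s ^ m) / (1 - s)"
      proof (induction m)
        case (Suc m)
        have "cmod (x n y - x (n + Suc m) y) \<le> cmod (x n y - x (n + m) y) + d (n + m) y"
          using norm_triangle_ineq[of "x n y - x (n + m) y" "x (n + m) y - x (Suc (n + m)) y"]
          by (simp add: d_def norm_minus_commute)
        also have "\<dots> \<le> S * s ^ n * (1 - s ^ m) / (1 - s) + S * s ^ (n + m)" using Suc dS by (intro add_mono) auto
        also have "\<dots> = S * s ^ n * (1 - s ^ Suc m) / (1 - s)" using s by (simp add: field_simps power_add)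
        finally show ?case .
      qed simp
      also have "\<dots> \<le> S * s ^ n * 1 / (1 - s)"
        using s by (intro divide_right_mono mult_left_mono) (auto simp: S_def)
      finally show ?thesis by simp
    qed
    have "(\<lambda>m. cmod (x n y - x (n + m) y)) \<longlonglongrightarrow> cmod (x n y - p y)"
      using LIMSEQ_ignore_initial_segment[OF lim, of n] by (intro tendsto_intros) (simp add: add.commute)
    then show ?thesis using part LIMSEQ_le_const2 unfolding S_def by blast
  qed
  have bound: "sq_int \<Omega> (x n - p) \<le> ennreal (\<rho> ^ n / (1 - s)\<^sup>2 * (C\<^sup>2 / (1 - \<rho>)))" for n
  proof -
    have "sq_int \<Omega> (x n - p) \<le> (\<integral>\<^sup>+y. ennreal (\<rho> ^ n / (1 - s)\<^sup>2) * H y \<partial>lebesgue_on \<Omega>)"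
      unfolding sq_int_def
    proof (intro nn_integral_mono_AE, use \<open>AE y in lebesgue_on \<Omega>. H y \<noteq> \<infinity>\<close> in eventually_elim)
      fix y assume Hy: "H y \<noteq> \<infinity>"
      have "(cmod (x n y - p y))\<^sup>2 \<le> (sqrt (enn2real (H y)) * (s ^ n / (1 - s)))\<^sup>2"
        using pt[OF Hy, of n] by (intro power_mono) auto
      also have "\<dots> = \<rho> ^ n / (1 - s)\<^sup>2 * enn2real (H y)"
        by (simp add: power_mult_distrib power_divide s(3)[symmetric] power_mult[symmetric] mult.commute)
      finally have "ennreal ((cmod (x n y - p y))\<^sup>2) \<le> ennreal (\<rho> ^ n / (1 - s)\<^sup>2 * enn2real (H y))" by (rule ennreal_leI)
      also have "\<dots> = ennreal (\<rho> ^ n / (1 - s)\<^sup>2) * H y"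
        using Hy \<rho> by (subst ennreal_mult) (auto simp: ennreal_enn2real_if)
      finally show "ennreal ((cmod ((x n - p) y))\<^sup>2) \<le> ennreal (\<rho> ^ n / (1 - s)\<^sup>2) * H y" by simp
    qed
    also have "\<dots> = ennreal (\<rho> ^ n / (1 - s)\<^sup>2) * (\<integral>\<^sup>+y. H y \<partial>lebesgue_on \<Omega>)" by (rule nn_integral_cmult) measurable
    also have "\<dots> \<le> ennreal (\<rho> ^ n / (1 - s)\<^sup>2) * ennreal (C\<^sup>2 / (1 - \<rho>))" by (intro mult_left_mono Hint) auto
    also have "\<dots> = ennreal (\<rho> ^ n / (1 - s)\<^sup>2 * (C\<^sup>2 / (1 - \<rho>)))"
      using \<rho> by (intro ennreal_mult[symmetric]) auto
    finally show ?thesis .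
  qed
  have diff: "x n - p \<in> L2 \<Omega>" for n
    using bound[of n] by (auto simp: L2_iff_sq_int fun_diff_def intro: le_less_trans)
  have "x 0 - (x 0 - p) \<in> L2 \<Omega>" using x diff by (rule in_S(3))
  moreover have "x 0 - (x 0 - p) = p" by simp
  ultimately have pL: "p \<in> L2 \<Omega>" by metis
  have "(\<lambda>n. (L2_nm \<Omega> (x n - p))\<^sup>2) \<longlonglongrightarrow> 0"
  proof (rule tendsto_sandwich[where f = "\<lambda>_. 0"])
    show "\<forall>\<^sub>F n in sequentially. (L2_nm \<Omega> (x n - p))\<^sup>2 \<le> \<rho> ^ n / (1 - s)\<^sup>2 * (C\<^sup>2 / (1 - \<rho>))"
      using bound \<rho> by (auto simp: sq_int_L2_nm[OF diff] ennreal_le_iff)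
    have "(\<lambda>n. \<rho> ^ n) \<longlonglongrightarrow> 0" using \<rho> by (intro LIMSEQ_realpow_zero) auto
    from tendsto_mult_left_zero[OF this, of "1 / (1 - s)\<^sup>2 * (C\<^sup>2 / (1 - \<rho>))"]
    show "(\<lambda>n. \<rho> ^ n / (1 - s)\<^sup>2 * (C\<^sup>2 / (1 - \<rho>))) \<longlonglongrightarrow> 0" by simp
  qed auto
  then have "(\<lambda>n. sqrt ((L2_nm \<Omega> (x n - p))\<^sup>2)) \<longlonglongrightarrow> sqrt 0" by (rule tendsto_real_sqrt)
  then have "(\<lambda>n. L2_nm \<Omega> (x n - p)) \<longlonglongrightarrow> 0" by (simp add: L2_nm_nonneg)
  then show ?thesis using pL by blast
qed

section \<open>Test functions and weak derivatives\<close>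

lemma test_functions_iff:
  "\<phi> \<in> test_functions \<Omega> \<longleftrightarrow> smooth \<phi> \<and> compact (closure {x. \<phi> x \<noteq> 0}) \<and> closure {x. \<phi> x \<noteq> 0} \<subseteq> \<Omega>"
  by (auto simp: test_functions_def smooth_def)

lemma test_functionsI:
  assumes "smooth \<phi>" "compact K" "K \<subseteq> \<Omega>" "\<And>x. x \<notin> K \<Longrightarrow> \<phi> x = 0"
  shows "\<phi> \<in> test_functions \<Omega>"
proof -
  have "closure {x. \<phi> x \<noteq> 0} \<subseteq> K"
    by (rule closure_minimal) (use assms compact_imp_closed in auto)
  then show ?thesis
    using assms by (auto simp: test_functions_iff compact_eq_bounded_closed intro: bounded_subset)
qed

lemma test_smooth: "\<phi> \<in> test_functions \<Omega> \<Longrightarrow> smooth \<phi>"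
  by (simp add: test_functions_iff)

lemma test_support:
  assumes "\<phi> \<in> test_functions \<Omega>"
  shows "\<exists>K. compact K \<and> K \<subseteq> \<Omega> \<and> (\<forall>x. x \<notin> K \<longrightarrow> \<phi> x = 0) \<and> (\<forall>x i. x \<notin> K \<longrightarrow> partial_deriv i \<phi> x = 0)"
proof -
  define K where "K = closure {x. \<phi> x \<noteq> 0}"
  have K: "compact K" "K \<subseteq> \<Omega>" using assms by (auto simp: test_functions_iff K_def)
  have z: "\<phi> x = 0" if "x \<notin> K" for x using that closure_subset[of "{x. \<phi> x \<noteq> 0}"] unfolding K_def by blast
  have "partial_deriv i \<phi> x = 0" if x: "x \<notin> K" for i x
  proof -
    have "(\<phi> has_derivative (\<lambda>_. 0)) (at x)"
    proof (rule has_derivative_transform_within_open)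
      show "((\<lambda>_. 0) has_derivative (\<lambda>_. 0)) (at x)" by simp
      show "open (- K)" using K(1) by (intro open_Compl compact_imp_closed)
      show "x \<in> - K" using x by simp
      show "0 = \<phi> y" if "y \<in> - K" for y using z[of y] that by simp
    qed
    then show ?thesis by (rule partial_derivI)
  qed
  then show ?thesis using K z by blast
qed

lemma test_partial_deriv:
  assumes "\<phi> \<in> test_functions \<Omega>" "i \<in> Basis" shows "partial_deriv i \<phi> \<in> test_functions \<Omega>"
proof -
  obtain K where K: "compact K" "K \<subseteq> \<Omega>" "\<And>x. x \<notin> K \<Longrightarrow> \<phi> x = 0"
      "\<And>i x. x \<notin> K \<Longrightarrow> partial_deriv i \<phi> x = 0" using test_support[OF assms(1)] by blast
  show ?thesis
    by (rule test_functionsI[OF smooth_partial_deriv[OF test_smooth[OF assms(1)] assms(2)] K(1,2,4)])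
qed

lemma test_mult:
  assumes "\<phi> \<in> test_functions \<Omega>" "smooth \<eta>" shows "(\<lambda>x. \<eta> x * \<phi> x) \<in> test_functions \<Omega>"
proof -
  obtain K where K: "compact K" "K \<subseteq> \<Omega>" "\<And>x. x \<notin> K \<Longrightarrow> \<phi> x = 0"
      "\<And>i x. x \<notin> K \<Longrightarrow> partial_deriv i \<phi> x = 0" using test_support[OF assms(1)] by blast
  have "smooth \<phi>" using assms by (simp add: test_smooth)
  then show ?thesis using K assms by (intro test_functionsI[of _ K]) auto
qed

lemma test_add:
  assumes "\<phi> \<in> test_functions \<Omega>" "\<psi> \<in> test_functions \<Omega>" shows "(\<lambda>x. \<phi> x + \<psi> x) \<in> test_functions \<Omega>"
proof -
  obtain K where K: "compact K" "K \<subseteq> \<Omega>" "\<And>x. x \<notin> K \<Longrightarrow> \<phi> x = 0"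
      "\<And>i x. x \<notin> K \<Longrightarrow> partial_deriv i \<phi> x = 0" using test_support[OF assms(1)] by blast
  obtain L where L: "compact L" "L \<subseteq> \<Omega>" "\<And>x. x \<notin> L \<Longrightarrow> \<psi> x = 0"
      "\<And>i x. x \<notin> L \<Longrightarrow> partial_deriv i \<psi> x = 0" using test_support[OF assms(2)] by blast
  show ?thesis
    by (rule test_functionsI[of _ "K \<union> L"]) (use K L assms in \<open>auto intro: test_smooth\<close>)
qed

lemma smooth_measurable: "smooth \<phi> \<Longrightarrow> \<phi> \<in> borel_measurable (lebesgue_on S)"
  using borel_measurable_continuous_onI[OF smooth_continuous[of \<phi> UNIV]]
  by (simp add: measurable_completion measurable_restrict_space1)

lemma test_bounded:
  assumes "\<phi> \<in> test_functions \<Omega>" shows "\<exists>B. \<forall>x. cmod (\<phi> x) \<le> B"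
proof -
  obtain K where K: "compact K" "K \<subseteq> \<Omega>" "\<And>x. x \<notin> K \<Longrightarrow> \<phi> x = 0"
      "\<And>i x. x \<notin> K \<Longrightarrow> partial_deriv i \<phi> x = 0" using test_support[OF assms] by blast
  have "bounded (\<phi> ` K)"
    using K(1) smooth_continuous[OF test_smooth[OF assms]] by (intro compact_imp_bounded compact_continuous_image)
  then obtain B where "B > 0" "\<And>x. x \<in> K \<Longrightarrow> cmod (\<phi> x) \<le> B" by (auto simp: bounded_pos)
  with K(3) have "cmod (\<phi> x) \<le> B" for x by (cases "x \<in> K") auto
  then show ?thesis by blast
qed

lemma test_L2:
  assumes \<Omega>: "\<Omega> \<in> sets lebesgue" and \<phi>: "\<phi> \<in> test_functions \<Omega>" shows "\<phi> \<in> L2 \<Omega>"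
proof -
  obtain K where K: "compact K" "K \<subseteq> \<Omega>" "\<And>x. x \<notin> K \<Longrightarrow> \<phi> x = 0" using test_support[OF \<phi>] by blast
  obtain B where B: "\<And>x. cmod (\<phi> x) \<le> B" using test_bounded[OF \<phi>] by blast
  have Km: "K \<in> sets (lebesgue_on \<Omega>)" "emeasure (lebesgue_on \<Omega>) K < \<infinity>"
    using K \<Omega> lmeasurable_compact[OF K(1)]
    by (auto simp: sets_restrict_space_iff emeasure_restrict_space fmeasurable_def)
  have "integrable (lebesgue_on \<Omega>) (\<lambda>x. B\<^sup>2 * indicator K x)" using Km by simp
  then have "integrable (lebesgue_on \<Omega>) (\<lambda>x. (cmod (\<phi> x))\<^sup>2)"
  proof (rule Bochner_Integration.integrable_bound)
    show "(\<lambda>x. (cmod (\<phi> x))\<^sup>2) \<in> borel_measurable (lebesgue_on \<Omega>)"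
      using smooth_measurable[OF test_smooth[OF \<phi>]] by measurable
    have "norm ((cmod (\<phi> x))\<^sup>2) \<le> norm (B\<^sup>2 * indicator K x)" for x
      using B[of x] K(3)[of x] by (cases "x \<in> K") (auto intro: power_mono)
    then show "AE x in lebesgue_on \<Omega>. norm ((cmod (\<phi> x))\<^sup>2) \<le> norm (B\<^sup>2 * indicator K x)" by simp
  qed
  then show ?thesis using smooth_measurable[OF test_smooth[OF \<phi>]] by (simp add: L2_iff)
qed

section \<open>The fundamental lemma of the calculus of variations\<close>

text \<open>The indicator of \<open>G\<close> is the pointwise limit of \<open>1 - \<Prod>\<^sub>j\<^sub>\<le>\<^sub>n (1 - b\<^sub>j)\<^sup>n\<close>, where the sets
  \<open>b\<^sub>j > 0\<close> are countably many balls with union \<open>G\<close>.\<close>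

lemma open_indicator_test_limit:
  fixes G :: "'a::euclidean_space set"
  assumes G: "open G"
  obtains \<psi> :: "nat \<Rightarrow> 'a \<Rightarrow> real" where "\<And>n. (\<lambda>x. complex_of_real (\<psi> n x)) \<in> test_functions G"
    "\<And>n x. 0 \<le> \<psi> n x \<and> \<psi> n x \<le> 1" "\<And>x. (\<lambda>n. \<psi> n x) \<longlonglongrightarrow> indicator G x"
proof (cases "G = {}")
  case True
  show ?thesis
    by (rule that[of "\<lambda>_ _. 0"]) (use True in \<open>auto intro!: test_functionsI[of _ "{}"] smooth_const\<close>)
next
  case False
  \<comment> \<open>Closed balls inside \<open>G\<close>: a finite union of them is a compact subset
    of \<open>G\<close> outside which the corresponding bumps vanish.\<close>
  define P where "P = {(x, r). 0 < r \<and> cball x (2 * r) \<subseteq> G}"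
  define b where "b p = ball (fst p) (2 * snd p)" for p :: "'a \<times> real"
  have UG: "\<Union>(b ` P) = G"
  proof
    show "\<Union>(b ` P) \<subseteq> G" by (auto simp: b_def P_def)
    show "G \<subseteq> \<Union>(b ` P)"
    proof
      fix x assume "x \<in> G"
      then obtain e where "e > 0" "cball x e \<subseteq> G" using G open_contains_cball by blast
      then show "x \<in> \<Union>(b ` P)" by (intro UN_I[of "(x, e/2)"]) (auto simp: P_def b_def)
    qed
  qed
  obtain F where F: "F \<subseteq> b ` P" "countable F" "\<Union>F = \<Union>(b ` P)"
    using Lindelof[of "b ` P"] by (auto simp: b_def)
  then obtain Q where Q: "Q \<subseteq> P" "countable Q" "F = b ` Q" by (meson countable_subset_image)
  have Qne: "Q \<noteq> {}" using F Q UG False by auto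
  define p where "p = from_nat_into Q"
  have p: "range p = Q" using Q Qne by (simp add: p_def range_from_nat_into)
  define c where "c j x = bump (snd (p j)) (fst (p j)) x" for j x
  have pP: "0 < snd (p j)" "cball (fst (p j)) (2 * snd (p j)) \<subseteq> G" for j
  proof -
    have "p j \<in> P" using p Q(1) by blast
    then show "0 < snd (p j)" "cball (fst (p j)) (2 * snd (p j)) \<subseteq> G" by (auto simp: P_def case_prod_beta)
  qed
  have c01: "0 \<le> 1 - c j x" "1 - c j x \<le> 1" for j x
    using bump_nonneg bump_le_1 by (auto simp: c_def)
  have cpos: "0 < c j x \<longleftrightarrow> x \<in> b (p j)" for j x
    unfolding c_def b_def by (rule bump_pos_iff[OF pP(1)])
  define \<psi> where "\<psi> n x = 1 - (\<Prod>j\<le>n. (1 - c j x) ^ n)" for n x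
  show ?thesis
  proof (rule that[of \<psi>])
    fix n
    show "(\<lambda>x. complex_of_real (\<psi> n x)) \<in> test_functions G"
    proof (rule test_functionsI)
      show "smooth (\<lambda>x. complex_of_real (\<psi> n x))"
        unfolding \<psi>_def c_def of_real_diff of_real_prod of_real_power of_real_1
        by (intro smooth_diff smooth_const smooth_prod smooth_power smooth_bump_gen)
      show "compact (\<Union>j\<le>n. cball (fst (p j)) (2 * snd (p j)))" by (intro compact_UN) auto
      show "(\<Union>j\<le>n. cball (fst (p j)) (2 * snd (p j))) \<subseteq> G" using pP by blast
      fix x assume "x \<notin> (\<Union>j\<le>n. cball (fst (p j)) (2 * snd (p j)))"
      then have "c j x = 0" if "j \<le> n" for j
        unfolding c_def by (intro bump_gen_zero[OF pP(1)]) (use that in force)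
      then show "complex_of_real (\<psi> n x) = 0" by (simp add: \<psi>_def)
    qed
  next
    fix n x
    show "0 \<le> \<psi> n x \<and> \<psi> n x \<le> 1"
      unfolding \<psi>_def using c01 by (auto intro!: prod_le_1 prod_nonneg power_le_one)
  next
    fix x
    show "(\<lambda>n. \<psi> n x) \<longlonglongrightarrow> indicator G x"
    proof (cases "x \<in> G")
      case False
      then have "c j x = 0" for j
          unfolding c_def using pP(2)[of j] False by (intro bump_gen_zero[OF pP(1)]) (meson ball_subset_cball subsetD)
      then show ?thesis using False by (simp add: \<psi>_def)
    next
      case True
      then have "x \<in> \<Union>(b ` Q)" using UG F(3) Q(3) by simp
      then obtain j where j: "x \<in> b (p j)" using p by blast
      then have cj: "0 < c j x" by (simp add: cpos)
      \<comment> \<open>The factor of the one index \<open>j\<close> with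
        \<open>x \<in> b (p j)\<close> already tends to 0, and all others are at most 1.\<close>
      have "(\<lambda>n. \<Prod>j\<le>n. (1 - c j x) ^ n) \<longlonglongrightarrow> 0"
      proof (rule tendsto_sandwich[where f = "\<lambda>_. 0"])
        show "\<forall>\<^sub>F n in sequentially. 0 \<le> (\<Prod>j\<le>n. (1 - c j x) ^ n)"
          using c01 by (auto intro!: prod_nonneg always_eventually)
        show "\<forall>\<^sub>F n in sequentially. (\<Prod>j\<le>n. (1 - c j x) ^ n) \<le> (1 - c j x) ^ n"
        proof (rule eventually_sequentiallyI[of j])
          fix n assume n: "j \<le> n"
          have "(\<Prod>j\<le>n. (1 - c j x) ^ n) = (1 - c j x) ^ n * (\<Prod>k\<in>{..n} - {j}. (1 - c k x) ^ n)"
            using n by (intro prod.remove) auto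
          also have "\<dots> \<le> (1 - c j x) ^ n * 1"
            using c01 by (intro mult_left_mono prod_le_1) (auto intro!: power_le_one)
          finally show "(\<Prod>j\<le>n. (1 - c j x) ^ n) \<le> (1 - c j x) ^ n" by simp
        qed
        show "(\<lambda>n. (1 - c j x) ^ n) \<longlonglongrightarrow> 0" using c01[of j x] cj by (intro LIMSEQ_realpow_zero) auto
      qed auto
      from tendsto_diff[OF tendsto_const[of 1] this] show ?thesis using True by (simp add: \<psi>_def)
    qed
  qed
qed

text \<open>Dominated convergence along test functions approximating the indicator of
  \<open>G\<close>. The majorant is \<open>h\<close> cut off to \<open>G\<close>, integrable because
  a bounded \<open>G\<close> has finite measure and \<open>h\<close> is square integrable.\<close>

lemma integral_test_zero_open:
  fixes \<Omega> :: "'a::euclidean_space set"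
  assumes \<Omega>: "open \<Omega>" and h: "h \<in> L2 \<Omega>"
    and z: "\<And>\<phi>. \<phi> \<in> test_functions \<Omega> \<Longrightarrow> (LINT x|lebesgue_on \<Omega>. h x * \<phi> x) = 0"
    and G: "open G" "bounded G" "G \<subseteq> \<Omega>"
  shows "integrable (lebesgue_on \<Omega>) (\<lambda>x. h x * indicator G x)" "(LINT x|lebesgue_on \<Omega>. h x * indicator G x) = 0"
proof -
  have \<Omega>s: "\<Omega> \<in> sets lebesgue" using \<Omega> by auto
  have Gm: "G \<in> sets (lebesgue_on \<Omega>)" "emeasure (lebesgue_on \<Omega>) G < \<infinity>"
    using G \<Omega>s lmeasurable_open[OF G(2,1)]
    by (auto simp: sets_restrict_space_iff emeasure_restrict_space fmeasurable_def)
  have "(cmod (indicator G x))\<^sup>2 = indicator G x" for x by (simp add: indicator_def)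
  then have "(\<lambda>x. indicator G x) \<in> L2 \<Omega>" using Gm by (simp add: L2_iff)
  then show int: "integrable (lebesgue_on \<Omega>) (\<lambda>x. h x * indicator G x)" using h by (rule L2_integrable_mult[rotated])
  obtain \<psi> :: "nat \<Rightarrow> 'a \<Rightarrow> real" where \<psi>: "\<And>n. (\<lambda>x. complex_of_real (\<psi> n x)) \<in> test_functions G"
    "\<And>n x. 0 \<le> \<psi> n x \<and> \<psi> n x \<le> 1" "\<And>x. (\<lambda>n. \<psi> n x) \<longlonglongrightarrow> indicator G x"
    using open_indicator_test_limit[OF G(1)] by blast
  have \<psi>\<Omega>: "(\<lambda>x. complex_of_real (\<psi> n x)) \<in> test_functions \<Omega>" for n
    using \<psi>(1)[of n] G(3) by (auto simp: test_functions_iff)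
  have \<psi>0: "\<psi> n x = 0" if "x \<notin> G" for n x
    using \<psi>(1)[of n] that closure_subset[of "{x. complex_of_real (\<psi> n x) \<noteq> 0}"] by (auto simp: test_functions_iff)
  have "(\<lambda>n. LINT x|lebesgue_on \<Omega>. h x * complex_of_real (\<psi> n x)) \<longlonglongrightarrow> (LINT x|lebesgue_on \<Omega>. h x * indicator G x)"
  proof (rule integral_dominated_convergence)
    show "integrable (lebesgue_on \<Omega>) (\<lambda>x. norm (h x * indicator G x))" using int by simp
    show "(\<lambda>x. h x * indicator G x) \<in> borel_measurable (lebesgue_on \<Omega>)" using int by auto
    show "(\<lambda>x. h x * complex_of_real (\<psi> n x)) \<in> borel_measurable (lebesgue_on \<Omega>)" for n
      using smooth_measurable[OF test_smooth[OF \<psi>\<Omega>[of n]]] L2_measurable[OF h] by measurable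
    have "(\<lambda>n. h x * complex_of_real (\<psi> n x)) \<longlonglongrightarrow> h x * of_real (indicator G x)" for x
      by (intro tendsto_intros \<psi>(3))
    moreover have "complex_of_real (indicator G x) = indicator G x" for x by (simp add: indicator_def)
    ultimately show "AE x in lebesgue_on \<Omega>. (\<lambda>n. h x * complex_of_real (\<psi> n x)) \<longlonglongrightarrow> h x * indicator G x"
      by simp
    show "AE x in lebesgue_on \<Omega>. norm (h x * complex_of_real (\<psi> n x)) \<le> norm (h x * indicator G x)" for n
      using \<psi>(2) \<psi>0 by (intro always_eventually allI) (auto simp: norm_mult indicator_def intro!: mult_left_le)
  qed
  then have "(\<lambda>n. 0) \<longlonglongrightarrow> (LINT x|lebesgue_on \<Omega>. h x * indicator G x)" using z[OF \<psi>\<Omega>] by simp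
  then show "(LINT x|lebesgue_on \<Omega>. h x * indicator G x) = 0" using LIMSEQ_unique tendsto_const by blast
qed

text \<open>By inner regularity, if \<open>Re h > 0\<close> held on a set of positive measure, it
  would hold on a compact \<open>T\<close> of positive measure. The indicator of \<open>T\<close> is
  a difference of indicators of two bounded open sets, so \<open>h\<close> integrates to 0 over
  \<open>T\<close>, where its real part is positive.\<close>

lemma integral_test_zero_Re_le:
  fixes \<Omega> :: "'a::euclidean_space set"
  assumes \<Omega>: "open \<Omega>" and h: "h \<in> L2 \<Omega>"
    and z: "\<And>\<phi>. \<phi> \<in> test_functions \<Omega> \<Longrightarrow> (LINT x|lebesgue_on \<Omega>. h x * \<phi> x) = 0"
  shows "AE x in lebesgue_on \<Omega>. Re (h x) \<le> 0"
proof (rule ccontr)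
  assume nae: "\<not> (AE x in lebesgue_on \<Omega>. Re (h x) \<le> 0)"
  have \<Omega>s: "\<Omega> \<in> sets lebesgue" using \<Omega> by auto
  have hm [measurable]: "h \<in> borel_measurable (lebesgue_on \<Omega>)" using h by (rule L2_measurable)
  define A where "A = {x \<in> \<Omega>. 0 < Re (h x)}"
  have "{x \<in> space (lebesgue_on \<Omega>). 0 < Re (h x)} \<in> sets (lebesgue_on \<Omega>)" by measurable
  then have "A \<in> sets (lebesgue_on \<Omega>)" by (simp add: A_def)
  then have As: "A \<in> sets lebesgue" using \<Omega>s by (auto simp: sets_restrict_space_iff)
  have "A \<notin> null_sets lebesgue"
  proof
    assume "A \<in> null_sets lebesgue"
    then have "AE x in lebesgue. x \<notin> A" by (rule AE_not_in)
    then have "AE x in lebesgue_on \<Omega>. Re (h x) \<le> 0"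
      using \<Omega>s by (subst AE_restrict_space_iff) (auto simp: A_def not_less elim!: eventually_mono)
    then show False using nae by simp
  qed
  then have "\<not> (\<forall>n::nat. A \<inter> cball 0 (real n) \<in> null_sets lebesgue)"
  proof (rule contrapos_nn)
    assume "\<forall>n::nat. A \<inter> cball 0 (real n) \<in> null_sets lebesgue"
    then have "(\<Union>n. A \<inter> cball 0 (real n)) \<in> null_sets lebesgue" by (intro null_sets_UN) auto
    moreover have "(\<Union>n. A \<inter> cball 0 (real n)) = A" using real_arch_simple by (fastforce simp: dist_norm)
    ultimately show "A \<in> null_sets lebesgue" by simp
  qed
  then obtain n :: nat where n: "A \<inter> cball 0 (real n) \<notin> null_sets lebesgue" by blast
  define A' where "A' = A \<inter> cball 0 (real n)"
  have A's: "A' \<in> sets lebesgue" using As by (auto simp: A'_def)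
  have A'fin: "A' \<in> lmeasurable" using A's by (intro bounded_set_imp_lmeasurable) (auto simp: A'_def)
  have pos: "0 < emeasure lebesgue A'" using n A's by (auto simp: A'_def null_sets_def zero_less_iff_neq_zero)
  have pos': "0 < measure lebesgue A'" using pos A'fin by (simp add: emeasure_eq_measure2)
  obtain T where T: "closed T" "T \<subseteq> A'" "A' - T \<in> lmeasurable" "emeasure lebesgue (A' - T) < ennreal (measure lebesgue A')"
    using sets_lebesgue_inner_closed[OF A's pos'] by blast
  have Tc: "compact T" using T(1,2) by (auto simp: A'_def compact_eq_bounded_closed intro: bounded_subset[of "cball 0 (real n)"])
  have T\<Omega>: "T \<subseteq> \<Omega>" using T(2) by (auto simp: A'_def A_def)
  have Tn: "T \<notin> null_sets lebesgue"
  proof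
    assume T0: "T \<in> null_sets lebesgue"
    have "emeasure lebesgue A' = emeasure lebesgue (A' - T)"
      using T0 A's by (simp add: emeasure_Diff_null_set)
    then show False using T(4) A'fin by (simp add: emeasure_eq_measure2)
  qed
  obtain R where R: "R > 0" "T \<subseteq> ball 0 R"
    using bounded_subset_ballD[OF compact_imp_bounded[OF Tc]] by blast
  define G where "G = \<Omega> \<inter> ball 0 R"
  have G: "open G" "bounded G" "G \<subseteq> \<Omega>" "open (G - T)" "bounded (G - T)" "G - T \<subseteq> \<Omega>" "T \<subseteq> G"
    using \<Omega> T(1) R T\<Omega> by (auto simp: G_def intro: bounded_subset[of "ball 0 R"])
  note i1 = integral_test_zero_open[OF \<Omega> h z G(1-3)] and i2 = integral_test_zero_open[OF \<Omega> h z G(4-6)]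
  have eq: "h x * indicator T x = h x * indicator G x - h x * indicator (G - T) x" for x
    using G(7) by (auto simp: indicator_def)
  have iT: "integrable (lebesgue_on \<Omega>) (\<lambda>x. h x * indicator T x)" "(LINT x|lebesgue_on \<Omega>. h x * indicator T x) = 0"
    unfolding eq using i1 i2 by auto
  have ReT: "Re (h x * indicator T x) = Re (h x) * indicator T x" for x by (simp add: indicator_def)
  have "(LINT x|lebesgue_on \<Omega>. Re (h x) * indicator T x) = 0"
    using integral_Re[OF iT(1)] iT(2) unfolding ReT by simp
  moreover have "integrable (lebesgue_on \<Omega>) (\<lambda>x. Re (h x) * indicator T x)"
    using integrable_Re[OF iT(1)] unfolding ReT .
  moreover have "AE x in lebesgue_on \<Omega>. 0 \<le> Re (h x) * indicator T x"
    using T(2) by (auto simp: A'_def A_def indicator_def intro!: always_eventually)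
  ultimately have "AE x in lebesgue_on \<Omega>. Re (h x) * indicator T x = 0"
    by (simp add: integral_nonneg_eq_0_iff_AE)
  then have "AE x in lebesgue_on \<Omega>. x \<notin> T"
    by eventually_elim (use T(2) in \<open>auto simp: A'_def A_def indicator_def split: if_splits\<close>)
  then have "AE x in lebesgue. x \<notin> T"
    using \<Omega>s T\<Omega> by (subst (asm) AE_restrict_space_iff) (auto elim!: eventually_mono)
  then have "T \<in> null_sets lebesgue"
    using T(1) by (subst (asm) AE_iff_null_sets[symmetric]) auto
  then show False using Tn by simp
qed

text \<open>The one-sided bound on the real part, applied to \<open>h\<close> multiplied by 1, -1,
  \<open>\<i>\<close> and \<open>-\<i>\<close>, leaves only \<open>h = 0\<close>.\<close>

lemma du_Bois_Reymond:
  fixes \<Omega> :: "'a::euclidean_space set"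
  assumes \<Omega>: "open \<Omega>" and h: "h \<in> L2 \<Omega>"
    and z: "\<And>\<phi>. \<phi> \<in> test_functions \<Omega> \<Longrightarrow> (LINT x|lebesgue_on \<Omega>. h x * \<phi> x) = 0"
  shows "AE x in lebesgue_on \<Omega>. h x = 0"
proof -
  have "AE x in lebesgue_on \<Omega>. Re (c * h x) \<le> 0" for c
    by (rule integral_test_zero_Re_le[OF \<Omega> L2_cmult[OF h]]) (use z in \<open>simp add: mult.assoc\<close>)
  from this[of 1] this[of "-1"] this[of "\<i>"] this[of "-\<i>"]
  show ?thesis by eventually_elim (simp add: complex_eq_iff)
qed

lemma weak_deriv_unique:
  assumes \<Omega>: "open \<Omega>" and "g \<in> L2 \<Omega>" "g' \<in> L2 \<Omega>" "is_weak_deriv \<Omega> i u g" "is_weak_deriv \<Omega> i u g'"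
  shows "AE x in lebesgue_on \<Omega>. g x = g' x"
proof -
  have \<Omega>s: "\<Omega> \<in> sets lebesgue" using \<Omega> by auto
  have "AE x in lebesgue_on \<Omega>. g x + - 1 * g' x = 0"
  proof (rule du_Bois_Reymond[OF \<Omega>])
    show "(\<lambda>x. g x + - 1 * g' x) \<in> L2 \<Omega>" using assms by (intro L2_add L2_cmult)
    fix \<phi> assume \<phi>: "\<phi> \<in> test_functions \<Omega>"
    have "integrable (lebesgue_on \<Omega>) (\<lambda>x. g x * \<phi> x)" "integrable (lebesgue_on \<Omega>) (\<lambda>x. g' x * \<phi> x)"
      using L2_integrable_mult test_L2[OF \<Omega>s \<phi>] assms by blast+
    moreover have "(LINT x|lebesgue_on \<Omega>. g x * \<phi> x) = (LINT x|lebesgue_on \<Omega>. g' x * \<phi> x)"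
      using assms(4,5) \<phi> by (simp add: is_weak_deriv_def)
    ultimately show "(LINT x|lebesgue_on \<Omega>. (g x + - 1 * g' x) * \<phi> x) = 0" by (simp add: algebra_simps)
  qed
  then show ?thesis by eventually_elim simp
qed

lemma weak_derivI:
  assumes "open \<Omega>" "g \<in> L2 \<Omega>" "is_weak_deriv \<Omega> i u g"
  shows "weak_deriv \<Omega> i u \<in> L2 \<Omega>" "is_weak_deriv \<Omega> i u (weak_deriv \<Omega> i u)"
    "AE x in lebesgue_on \<Omega>. weak_deriv \<Omega> i u x = g x"
proof -
  have *: "weak_deriv \<Omega> i u \<in> L2 \<Omega> \<and> is_weak_deriv \<Omega> i u (weak_deriv \<Omega> i u)"
    unfolding weak_deriv_def by (rule someI[of _ g]) (use assms in simp)
  then show "weak_deriv \<Omega> i u \<in> L2 \<Omega>" "is_weak_deriv \<Omega> i u (weak_deriv \<Omega> i u)" by auto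
  show "AE x in lebesgue_on \<Omega>. weak_deriv \<Omega> i u x = g x"
    using * assms by (intro weak_deriv_unique) auto
qed

section \<open>The form domain\<close>

text \<open>The comparison behind the closure properties of \<open>H01 \<Omega>\<close>: it
  transfers L2 convergence through pointwise bounds, with no need for membership in
  \<open>L2 \<Omega>\<close>.\<close>

lemma sq_int_tendsto_0:
  assumes f: "\<And>n. f n \<in> borel_measurable (lebesgue_on \<Omega>)" "(\<lambda>n. sq_int \<Omega> (f n)) \<longlonglongrightarrow> 0"
    and g: "\<And>n. g n \<in> borel_measurable (lebesgue_on \<Omega>)" "(\<lambda>n. sq_int \<Omega> (g n)) \<longlonglongrightarrow> 0"
    and h: "\<And>n. AE x in lebesgue_on \<Omega>. cmod (h n x) \<le> B * (cmod (f n x) + cmod (g n x))" and B: "0 \<le> B"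
  shows "(\<lambda>n. sq_int \<Omega> (h n)) \<longlonglongrightarrow> 0"
proof (rule tendsto_sandwich[where f = "\<lambda>_. 0"])
  note [measurable] = f(1) g(1)
  have "sq_int \<Omega> (h n) \<le> ennreal (B\<^sup>2) * (2 * sq_int \<Omega> (f n) + 2 * sq_int \<Omega> (g n))" for n
  proof -
    define F where "F x = complex_of_real (cmod (f n x)) + complex_of_real (cmod (g n x))" for x
    have [measurable]: "F \<in> borel_measurable (lebesgue_on \<Omega>)" unfolding F_def by measurable
    have "cmod (F x) = cmod (f n x) + cmod (g n x)" for x unfolding F_def
      by (metis abs_of_nonneg add_nonneg_nonneg norm_ge_zero norm_of_real of_real_add)
    then have "sq_int \<Omega> (h n) \<le> ennreal (B\<^sup>2) * sq_int \<Omega> F"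
      using h[of n] B by (intro sq_int_le) auto
    also have "sq_int \<Omega> F \<le> 2 * sq_int \<Omega> (\<lambda>x. complex_of_real (cmod (f n x))) + 2 * sq_int \<Omega> (\<lambda>x. complex_of_real (cmod (g n x)))"
      unfolding F_def by (intro sq_int_add) measurable
    also have "\<dots> = 2 * sq_int \<Omega> (f n) + 2 * sq_int \<Omega> (g n)" by (simp add: sq_int_def)
    finally show ?thesis by (simp add: mult_left_mono)
  qed
  then show "\<forall>\<^sub>F n in sequentially. sq_int \<Omega> (h n) \<le> ennreal (B\<^sup>2) * (2 * sq_int \<Omega> (f n) + 2 * sq_int \<Omega> (g n))" by simp
  have "(\<lambda>n. ennreal (B\<^sup>2) * (2 * sq_int \<Omega> (f n) + 2 * sq_int \<Omega> (g n))) \<longlonglongrightarrow> ennreal (B\<^sup>2) * (2 * 0 + 2 * 0)"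
    using f(2) g(2) by (intro tendsto_mult_ennreal tendsto_add tendsto_const) auto
  then show "(\<lambda>n. ennreal (B\<^sup>2) * (2 * sq_int \<Omega> (f n) + 2 * sq_int \<Omega> (g n))) \<longlonglongrightarrow> 0" by simp
qed auto

context
  fixes \<Omega> :: "'a::euclidean_space set"
  assumes \<Omega>: "open \<Omega>"
begin

lemma sets_Omega: "\<Omega> \<in> sets lebesgue" using \<Omega> by auto

lemma H01_L2: "u \<in> H01 \<Omega> \<Longrightarrow> u \<in> L2 \<Omega>"
  by (simp add: H01_def H1_def)

lemma H01_weak_deriv:
  assumes "u \<in> H01 \<Omega>" "i \<in> Basis"
  shows "weak_deriv \<Omega> i u \<in> L2 \<Omega>" "is_weak_deriv \<Omega> i u (weak_deriv \<Omega> i u)"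
  using weak_derivI[OF \<Omega>] assms by (auto simp: H01_def H1_def)

lemma H01_approx:
  assumes "u \<in> H01 \<Omega>"
  shows "\<exists>\<phi>. (\<forall>n::nat. \<phi> n \<in> test_functions \<Omega>) \<and> (\<lambda>n. sq_int \<Omega> (\<lambda>x. \<phi> n x - u x)) \<longlonglongrightarrow> 0 \<and>
        (\<forall>i\<in>Basis. (\<lambda>n. sq_int \<Omega> (\<lambda>x. partial_deriv i (\<phi> n) x - weak_deriv \<Omega> i u x)) \<longlonglongrightarrow> 0)"
  using assms unfolding H01_def Lp_norm_2_tendsto_0 by blast

text \<open>Membership may be certified with explicit candidates \<open>g\<close>: uniqueness of
  weak derivatives identifies them almost everywhere with the functions chosen by
  \<open>weak_deriv\<close>.\<close>

lemma H01I:
  assumes u: "u \<in> L2 \<Omega>" and g: "\<And>i. i \<in> Basis \<Longrightarrow> g i \<in> L2 \<Omega> \<and> is_weak_deriv \<Omega> i u (g i)"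
    and \<phi>: "\<And>n::nat. \<phi> n \<in> test_functions \<Omega>" "(\<lambda>n. sq_int \<Omega> (\<lambda>x. \<phi> n x - u x)) \<longlonglongrightarrow> 0"
      "\<And>i. i \<in> Basis \<Longrightarrow> (\<lambda>n. sq_int \<Omega> (\<lambda>x. partial_deriv i (\<phi> n) x - g i x)) \<longlonglongrightarrow> 0"
  shows "u \<in> H01 \<Omega>" "\<And>i. i \<in> Basis \<Longrightarrow> AE x in lebesgue_on \<Omega>. weak_deriv \<Omega> i u x = g i x"
proof -
  show ae: "AE x in lebesgue_on \<Omega>. weak_deriv \<Omega> i u x = g i x" if "i \<in> Basis" for i
    using weak_derivI(3)[OF \<Omega>] g[OF that] by blast
  have "sq_int \<Omega> (\<lambda>x. partial_deriv i (\<phi> n) x - g i x) = sq_int \<Omega> (\<lambda>x. partial_deriv i (\<phi> n) x - weak_deriv \<Omega> i u x)"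
    if "i \<in> Basis" for i n
    by (rule sq_int_cong_AE) (use ae[OF that] in \<open>auto elim!: eventually_mono\<close>)
  with u g \<phi> show "u \<in> H01 \<Omega>"
    unfolding H01_def H1_def Lp_norm_2_tendsto_0 by (auto intro!: exI[of _ \<phi>])
qed

lemma is_weak_deriv_lincomb:
  assumes "u \<in> L2 \<Omega>" "v \<in> L2 \<Omega>" "g \<in> L2 \<Omega>" "h \<in> L2 \<Omega>" "is_weak_deriv \<Omega> i u g" "is_weak_deriv \<Omega> i v h" "i \<in> Basis"
  shows "is_weak_deriv \<Omega> i (\<lambda>x. b * u x + c * v x) (\<lambda>x. b * g x + c * h x)"
  unfolding is_weak_deriv_def
proof
  fix \<phi> assume \<phi>: "\<phi> \<in> test_functions \<Omega>"
  note int = L2_integrable_mult[OF _ test_L2[OF sets_Omega \<phi>]]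
    L2_integrable_mult[OF _ test_L2[OF sets_Omega test_partial_deriv[OF \<phi> \<open>i \<in> Basis\<close>]]]
  have "(LINT x|lebesgue_on \<Omega>. (b * u x + c * v x) * partial_deriv i \<phi> x)
     = b * (LINT x|lebesgue_on \<Omega>. u x * partial_deriv i \<phi> x) + c * (LINT x|lebesgue_on \<Omega>. v x * partial_deriv i \<phi> x)"
    using int assms by (simp add: distrib_right mult.assoc)
  also have "\<dots> = - (b * (LINT x|lebesgue_on \<Omega>. g x * \<phi> x) + c * (LINT x|lebesgue_on \<Omega>. h x * \<phi> x))"
    using assms(5,6) \<phi> by (simp add: is_weak_deriv_def)
  also have "\<dots> = - (LINT x|lebesgue_on \<Omega>. (b * g x + c * h x) * \<phi> x)"
    using int assms by (simp add: distrib_right mult.assoc)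
  finally show "(LINT x|lebesgue_on \<Omega>. (b * u x + c * v x) * partial_deriv i \<phi> x)
     = - (LINT x|lebesgue_on \<Omega>. (b * g x + c * h x) * \<phi> x)" .
qed

lemma partial_deriv_lincomb:
  assumes "smooth f" "smooth g"
  shows "partial_deriv i (\<lambda>x. b * f x + c * g x) x = b * partial_deriv i f x + c * partial_deriv i g x"
  using assms smooth_differentiable[of f x] smooth_differentiable[of g x]
    smooth_differentiable[OF smooth_mult[OF smooth_const[of b] assms(1)], of x]
    smooth_differentiable[OF smooth_mult[OF smooth_const[of c] assms(2)], of x]
  by (simp add: partial_deriv_add partial_deriv_mult partial_deriv_const)

lemma H01_lincomb:
  assumes u: "u \<in> H01 \<Omega>" and v: "v \<in> H01 \<Omega>"
  shows "(\<lambda>x. b * u x + c * v x) \<in> H01 \<Omega>"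
    "\<And>i. i \<in> Basis \<Longrightarrow> AE x in lebesgue_on \<Omega>.
        weak_deriv \<Omega> i (\<lambda>x. b * u x + c * v x) x = b * weak_deriv \<Omega> i u x + c * weak_deriv \<Omega> i v x"
proof -
  obtain \<phi> where \<phi>: "\<And>n::nat. \<phi> n \<in> test_functions \<Omega>" "(\<lambda>n. sq_int \<Omega> (\<lambda>x. \<phi> n x - u x)) \<longlonglongrightarrow> 0"
      "\<And>i. i \<in> Basis \<Longrightarrow> (\<lambda>n. sq_int \<Omega> (\<lambda>x. partial_deriv i (\<phi> n) x - weak_deriv \<Omega> i u x)) \<longlonglongrightarrow> 0"
    using H01_approx[OF u] by blast
  obtain \<psi> where \<psi>: "\<And>n::nat. \<psi> n \<in> test_functions \<Omega>" "(\<lambda>n. sq_int \<Omega> (\<lambda>x. \<psi> n x - v x)) \<longlonglongrightarrow> 0"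
      "\<And>i. i \<in> Basis \<Longrightarrow> (\<lambda>n. sq_int \<Omega> (\<lambda>x. partial_deriv i (\<psi> n) x - weak_deriv \<Omega> i v x)) \<longlonglongrightarrow> 0"
    using H01_approx[OF v] by blast
  have t: "(\<lambda>x. b * \<phi> n x + c * \<psi> n x) \<in> test_functions \<Omega>" for n
    using \<phi>(1) \<psi>(1) by (intro test_add test_mult smooth_const)
  have L: "weak_deriv \<Omega> i u \<in> L2 \<Omega>" "weak_deriv \<Omega> i v \<in> L2 \<Omega>" if "i \<in> Basis" for i
    using H01_weak_deriv u v that by auto
  have m [measurable]: "f \<in> L2 \<Omega> \<Longrightarrow> f \<in> borel_measurable (lebesgue_on \<Omega>)"
    "f \<in> test_functions \<Omega> \<Longrightarrow> f \<in> borel_measurable (lebesgue_on \<Omega>)" for f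
    by (auto simp: L2_measurable smooth_measurable test_smooth)
  have bnd: "cmod (b * p + c * q - (b * p' + c * q')) \<le> (cmod b + cmod c) * (cmod (p - p') + cmod (q - q'))" for p q p' q'
  proof -
    have "b * p + c * q - (b * p' + c * q') = b * (p - p') + c * (q - q')" by (simp add: algebra_simps)
    then have "cmod (b * p + c * q - (b * p' + c * q')) \<le> cmod b * cmod (p - p') + cmod c * cmod (q - q')"
      using norm_triangle_ineq[of "b * (p - p')" "c * (q - q')"] by (simp add: norm_mult)
    also have "\<dots> \<le> (cmod b + cmod c) * (cmod (p - p') + cmod (q - q'))" by (simp add: algebra_simps)
    finally show ?thesis .
  qed
  have *: "(\<lambda>x. b * u x + c * v x) \<in> L2 \<Omega>"
      "i \<in> Basis \<Longrightarrow> (\<lambda>x. b * weak_deriv \<Omega> i u x + c * weak_deriv \<Omega> i v x) \<in> L2 \<Omega> \<and>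
        is_weak_deriv \<Omega> i (\<lambda>x. b * u x + c * v x) (\<lambda>x. b * weak_deriv \<Omega> i u x + c * weak_deriv \<Omega> i v x)"
      "(\<lambda>n. sq_int \<Omega> (\<lambda>x. b * \<phi> n x + c * \<psi> n x - (b * u x + c * v x))) \<longlonglongrightarrow> 0"
      "i \<in> Basis \<Longrightarrow> (\<lambda>n. sq_int \<Omega> (\<lambda>x. partial_deriv i (\<lambda>x. b * \<phi> n x + c * \<psi> n x) x
         - (b * weak_deriv \<Omega> i u x + c * weak_deriv \<Omega> i v x))) \<longlonglongrightarrow> 0" for i
  proof -
    show "(\<lambda>x. b * u x + c * v x) \<in> L2 \<Omega>" using H01_L2 u v by (intro L2_add L2_cmult)
    show "(\<lambda>x. b * weak_deriv \<Omega> i u x + c * weak_deriv \<Omega> i v x) \<in> L2 \<Omega> \<and>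
        is_weak_deriv \<Omega> i (\<lambda>x. b * u x + c * v x) (\<lambda>x. b * weak_deriv \<Omega> i u x + c * weak_deriv \<Omega> i v x)"
      if i: "i \<in> Basis"
      using H01_weak_deriv[OF u i] H01_weak_deriv[OF v i] H01_L2[OF u] H01_L2[OF v] i
      by (auto intro!: L2_add L2_cmult is_weak_deriv_lincomb)
    show "(\<lambda>n. sq_int \<Omega> (\<lambda>x. b * \<phi> n x + c * \<psi> n x - (b * u x + c * v x))) \<longlonglongrightarrow> 0"
      by (rule sq_int_tendsto_0[OF _ \<phi>(2) _ \<psi>(2), where B = "cmod b + cmod c"])
        (use m \<phi>(1) \<psi>(1) H01_L2[OF u] H01_L2[OF v] in \<open>auto intro!: bnd\<close>)
    show "(\<lambda>n. sq_int \<Omega> (\<lambda>x. partial_deriv i (\<lambda>x. b * \<phi> n x + c * \<psi> n x) x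
         - (b * weak_deriv \<Omega> i u x + c * weak_deriv \<Omega> i v x))) \<longlonglongrightarrow> 0" if i: "i \<in> Basis"
      unfolding partial_deriv_lincomb[OF test_smooth[OF \<phi>(1)] test_smooth[OF \<psi>(1)]]
      by (rule sq_int_tendsto_0[OF _ \<phi>(3)[OF i] _ \<psi>(3)[OF i], where B = "cmod b + cmod c"])
        (use m test_partial_deriv[OF \<phi>(1) i] test_partial_deriv[OF \<psi>(1) i] L[OF i] in \<open>auto intro!: bnd\<close>)
  qed
  show "(\<lambda>x. b * u x + c * v x) \<in> H01 \<Omega>" by (rule H01I(1)[OF *(1) *(2) t *(3) *(4)])
  show "AE x in lebesgue_on \<Omega>.
        weak_deriv \<Omega> i (\<lambda>x. b * u x + c * v x) x = b * weak_deriv \<Omega> i u x + c * weak_deriv \<Omega> i v x" if "i \<in> Basis" for i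
    by (rule H01I(2)[OF *(1) *(2) t *(3) *(4) that])
qed

text \<open>For the Leibniz rule, the weak derivative of \<open>u\<close> is tested against
  \<open>\<eta>\<close> times a test function. The bound \<open>B\<close> makes multiplication by
  \<open>\<eta>\<close> continuous in the H1 norm, so the approximating test functions may be
  multiplied as well.\<close>

lemma H01_mult:
  assumes u: "u \<in> H01 \<Omega>" and \<eta>: "smooth \<eta>" "\<And>x. cmod (\<eta> x) \<le> B" "\<And>i x. i \<in> Basis \<Longrightarrow> cmod (partial_deriv i \<eta> x) \<le> B"
  shows "(\<lambda>x. \<eta> x * u x) \<in> H01 \<Omega>"
    "\<And>i. i \<in> Basis \<Longrightarrow> AE x in lebesgue_on \<Omega>.
        weak_deriv \<Omega> i (\<lambda>x. \<eta> x * u x) x = \<eta> x * weak_deriv \<Omega> i u x + partial_deriv i \<eta> x * u x"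
proof -
  obtain \<phi> where \<phi>: "\<And>n::nat. \<phi> n \<in> test_functions \<Omega>" "(\<lambda>n. sq_int \<Omega> (\<lambda>x. \<phi> n x - u x)) \<longlonglongrightarrow> 0"
      "\<And>i. i \<in> Basis \<Longrightarrow> (\<lambda>n. sq_int \<Omega> (\<lambda>x. partial_deriv i (\<phi> n) x - weak_deriv \<Omega> i u x)) \<longlonglongrightarrow> 0"
    using H01_approx[OF u] by blast
  have uL: "u \<in> L2 \<Omega>" by (rule H01_L2[OF u])
  have B: "0 \<le> B" using \<eta>(2)[of undefined] norm_ge_zero order_trans by blast
  have t: "(\<lambda>x. \<eta> x * \<phi> n x) \<in> test_functions \<Omega>" for n
    using \<phi>(1) \<eta>(1) by (intro test_mult)
  have m [measurable]: "f \<in> L2 \<Omega> \<Longrightarrow> f \<in> borel_measurable (lebesgue_on \<Omega>)"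
    "f \<in> test_functions \<Omega> \<Longrightarrow> f \<in> borel_measurable (lebesgue_on \<Omega>)"
    "smooth f \<Longrightarrow> f \<in> borel_measurable (lebesgue_on \<Omega>)" for f
    by (auto simp: L2_measurable smooth_measurable test_smooth)
  have \<eta>L: "f \<in> L2 \<Omega> \<Longrightarrow> (\<lambda>x. \<eta> x * f x) \<in> L2 \<Omega>" for f
    using \<eta>(1,2) m(3) by (intro L2_bounded_mult)
  have d\<eta>L: "i \<in> Basis \<Longrightarrow> f \<in> L2 \<Omega> \<Longrightarrow> (\<lambda>x. partial_deriv i \<eta> x * f x) \<in> L2 \<Omega>" for f i
    using \<eta>(1,3) m(3)[OF smooth_partial_deriv] by (intro L2_bounded_mult)
  have gL: "(\<lambda>x. \<eta> x * weak_deriv \<Omega> i u x + partial_deriv i \<eta> x * u x) \<in> L2 \<Omega>" if i: "i \<in> Basis" for i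
    using H01_weak_deriv[OF u i] uL i by (intro L2_add \<eta>L d\<eta>L)
  have wd: "is_weak_deriv \<Omega> i (\<lambda>x. \<eta> x * u x) (\<lambda>x. \<eta> x * weak_deriv \<Omega> i u x + partial_deriv i \<eta> x * u x)"
    if i: "i \<in> Basis" for i
    unfolding is_weak_deriv_def
  proof
    fix \<psi> assume \<psi>: "\<psi> \<in> test_functions \<Omega>"
    define \<zeta> where "\<zeta> x = \<eta> x * \<psi> x" for x
    have \<zeta>: "\<zeta> \<in> test_functions \<Omega>" unfolding \<zeta>_def using \<psi> \<eta>(1) by (intro test_mult)
    have d\<zeta>: "partial_deriv i \<zeta> x = \<eta> x * partial_deriv i \<psi> x + partial_deriv i \<eta> x * \<psi> x" for x
      unfolding \<zeta>_def using \<eta>(1) test_smooth[OF \<psi>] by (intro partial_deriv_mult smooth_differentiable)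
    have tL: "\<zeta> \<in> L2 \<Omega>" "\<psi> \<in> L2 \<Omega>" "partial_deriv i \<zeta> \<in> L2 \<Omega>" "partial_deriv i \<psi> \<in> L2 \<Omega>"
      using \<zeta> \<psi> i by (auto intro: test_L2 sets_Omega test_partial_deriv)
    have i1: "integrable (lebesgue_on \<Omega>) (\<lambda>x. u x * partial_deriv i \<zeta> x)" using uL tL(3) by (rule L2_integrable_mult)
    have i2: "integrable (lebesgue_on \<Omega>) (\<lambda>x. (partial_deriv i \<eta> x * u x) * \<psi> x)"
      using d\<eta>L[OF i uL] tL(2) by (rule L2_integrable_mult)
    have i3: "integrable (lebesgue_on \<Omega>) (\<lambda>x. weak_deriv \<Omega> i u x * \<zeta> x)"
      using H01_weak_deriv(1)[OF u i] tL(1) by (rule L2_integrable_mult)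
    have "(LINT x|lebesgue_on \<Omega>. (\<eta> x * u x) * partial_deriv i \<psi> x)
        = (LINT x|lebesgue_on \<Omega>. u x * partial_deriv i \<zeta> x - (partial_deriv i \<eta> x * u x) * \<psi> x)"
      by (simp add: d\<zeta> algebra_simps)
    also have "\<dots> = (LINT x|lebesgue_on \<Omega>. u x * partial_deriv i \<zeta> x) - (LINT x|lebesgue_on \<Omega>. (partial_deriv i \<eta> x * u x) * \<psi> x)"
      using i1 i2 by (rule Bochner_Integration.integral_diff)
    also have "(LINT x|lebesgue_on \<Omega>. u x * partial_deriv i \<zeta> x) = - (LINT x|lebesgue_on \<Omega>. weak_deriv \<Omega> i u x * \<zeta> x)"
      using H01_weak_deriv(2)[OF u i] \<zeta> by (simp add: is_weak_deriv_def)
    also have "- (LINT x|lebesgue_on \<Omega>. weak_deriv \<Omega> i u x * \<zeta> x) - (LINT x|lebesgue_on \<Omega>. (partial_deriv i \<eta> x * u x) * \<psi> x)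
        = - (LINT x|lebesgue_on \<Omega>. weak_deriv \<Omega> i u x * \<zeta> x + (partial_deriv i \<eta> x * u x) * \<psi> x)"
      using i2 i3 by simp
    also have "(\<lambda>x. weak_deriv \<Omega> i u x * \<zeta> x + (partial_deriv i \<eta> x * u x) * \<psi> x)
        = (\<lambda>x. (\<eta> x * weak_deriv \<Omega> i u x + partial_deriv i \<eta> x * u x) * \<psi> x)"
      by (auto simp: \<zeta>_def algebra_simps)
    finally show "(LINT x|lebesgue_on \<Omega>. (\<eta> x * u x) * partial_deriv i \<psi> x)
      = - (LINT x|lebesgue_on \<Omega>. (\<eta> x * weak_deriv \<Omega> i u x + partial_deriv i \<eta> x * u x) * \<psi> x)" .
  qed
  have lim0: "(\<lambda>n. sq_int \<Omega> (\<lambda>x. \<eta> x * \<phi> n x - \<eta> x * u x)) \<longlonglongrightarrow> 0"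
  proof (rule sq_int_tendsto_0[OF _ \<phi>(2) _ \<phi>(2)])
    show "AE x in lebesgue_on \<Omega>. cmod (\<eta> x * \<phi> n x - \<eta> x * u x) \<le> B * (cmod (\<phi> n x - u x) + cmod (\<phi> n x - u x))" for n
    proof (intro always_eventually allI)
      fix x
      have "cmod (\<eta> x * \<phi> n x - \<eta> x * u x) = cmod (\<eta> x) * cmod (\<phi> n x - u x)"
        by (simp add: norm_mult flip: right_diff_distrib)
      also have "\<dots> \<le> B * (cmod (\<phi> n x - u x) + cmod (\<phi> n x - u x))" using \<eta>(2) B by (intro mult_mono) auto
      finally show "cmod (\<eta> x * \<phi> n x - \<eta> x * u x) \<le> B * (cmod (\<phi> n x - u x) + cmod (\<phi> n x - u x))" .
    qed
  qed (use m \<phi>(1) uL B in auto)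
  have lim1: "(\<lambda>n. sq_int \<Omega> (\<lambda>x. partial_deriv i (\<lambda>x. \<eta> x * \<phi> n x) x
         - (\<eta> x * weak_deriv \<Omega> i u x + partial_deriv i \<eta> x * u x))) \<longlonglongrightarrow> 0" if i: "i \<in> Basis" for i
  proof (rule sq_int_tendsto_0[OF _ \<phi>(2) _ \<phi>(3)[OF i]])
    show "AE x in lebesgue_on \<Omega>. cmod (partial_deriv i (\<lambda>x. \<eta> x * \<phi> n x) x
         - (\<eta> x * weak_deriv \<Omega> i u x + partial_deriv i \<eta> x * u x))
         \<le> B * (cmod (\<phi> n x - u x) + cmod (partial_deriv i (\<phi> n) x - weak_deriv \<Omega> i u x))" for n
    proof (intro always_eventually allI)
      fix x
      have "partial_deriv i (\<lambda>x. \<eta> x * \<phi> n x) x = \<eta> x * partial_deriv i (\<phi> n) x + partial_deriv i \<eta> x * \<phi> n x"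
        using \<eta>(1) test_smooth[OF \<phi>(1)] by (intro partial_deriv_mult smooth_differentiable)
      then have eq: "partial_deriv i (\<lambda>x. \<eta> x * \<phi> n x) x - (\<eta> x * weak_deriv \<Omega> i u x + partial_deriv i \<eta> x * u x)
          = partial_deriv i \<eta> x * (\<phi> n x - u x) + \<eta> x * (partial_deriv i (\<phi> n) x - weak_deriv \<Omega> i u x)"
        by (simp add: algebra_simps)
      have "cmod (partial_deriv i (\<lambda>x. \<eta> x * \<phi> n x) x - (\<eta> x * weak_deriv \<Omega> i u x + partial_deriv i \<eta> x * u x))
          \<le> cmod (partial_deriv i \<eta> x) * cmod (\<phi> n x - u x) + cmod (\<eta> x) * cmod (partial_deriv i (\<phi> n) x - weak_deriv \<Omega> i u x)"
        unfolding eq norm_mult[symmetric] by (rule norm_triangle_ineq)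
      also have "\<dots> \<le> B * cmod (\<phi> n x - u x) + B * cmod (partial_deriv i (\<phi> n) x - weak_deriv \<Omega> i u x)"
        using \<eta>(2,3) i by (intro add_mono mult_right_mono) auto
      finally show "cmod (partial_deriv i (\<lambda>x. \<eta> x * \<phi> n x) x
         - (\<eta> x * weak_deriv \<Omega> i u x + partial_deriv i \<eta> x * u x))
         \<le> B * (cmod (\<phi> n x - u x) + cmod (partial_deriv i (\<phi> n) x - weak_deriv \<Omega> i u x))"
        by (simp add: distrib_left)
    qed
  qed (use m \<phi>(1) uL B test_partial_deriv[OF \<phi>(1) i] H01_weak_deriv[OF u i] in auto)
  show "(\<lambda>x. \<eta> x * u x) \<in> H01 \<Omega>"
    by (rule H01I(1)[OF \<eta>L[OF uL] conjI[OF gL wd] t lim0 lim1])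
  show "AE x in lebesgue_on \<Omega>.
        weak_deriv \<Omega> i (\<lambda>x. \<eta> x * u x) x = \<eta> x * weak_deriv \<Omega> i u x + partial_deriv i \<eta> x * u x" if "i \<in> Basis" for i
    by (rule H01I(2)[OF \<eta>L[OF uL] conjI[OF gL wd] t lim0 lim1 that])
qed

lemma H01_zero: "(\<lambda>x. 0) \<in> H01 \<Omega>"
proof -
  have t: "(\<lambda>x. 0) \<in> test_functions \<Omega>" by (rule test_functionsI[of _ "{}"]) auto
  show ?thesis
    by (rule H01I(1)[where g = "\<lambda>_ _. 0" and \<phi> = "\<lambda>_ _. 0"])
      (use t L2_zero in \<open>auto simp: is_weak_deriv_def partial_deriv_const sq_int_def\<close>)
qed

lemma L2_inner_cong_AE:
  assumes "f \<in> L2 \<Omega>" "f' \<in> L2 \<Omega>" "g \<in> L2 \<Omega>" "g' \<in> L2 \<Omega>"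
    "AE x in lebesgue_on \<Omega>. f x = f' x" "AE x in lebesgue_on \<Omega>. g x = g' x"
  shows "L2_inner \<Omega> f g = L2_inner \<Omega> f' g'"
  unfolding L2_inner_def
proof (rule integral_cong_AE)
  show "AE x in lebesgue_on \<Omega>. f x * cnj (g x) = f' x * cnj (g' x)"
    using assms(5,6) by eventually_elim simp
qed (use assms L2_integrable_mult[OF _ L2_cnj] in \<open>blast intro: borel_measurable_integrable\<close>)+

text \<open>\<open>weak_deriv\<close> is a choice and so is linear only almost everywhere; linearity
  of the form therefore passes through \<open>L2_inner_cong_AE\<close>.\<close>

lemma dirichlet_semi_inner: "semi_inner cscale (H01 \<Omega>) (dirichlet_form \<Omega>)"
proof -
  interpret semi_inner cscale "L2 \<Omega>" "L2_inner \<Omega>" by (rule L2_semi_inner)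
  have lin: "dirichlet_form \<Omega> (\<lambda>x. b * u x + c * v x) w = b * dirichlet_form \<Omega> u w + c * dirichlet_form \<Omega> v w"
    if u: "u \<in> H01 \<Omega>" and v: "v \<in> H01 \<Omega>" and w: "w \<in> H01 \<Omega>" for u v w b c
  proof -
    have "L2_inner \<Omega> (weak_deriv \<Omega> i (\<lambda>x. b * u x + c * v x)) (weak_deriv \<Omega> i w)
        = b * L2_inner \<Omega> (weak_deriv \<Omega> i u) (weak_deriv \<Omega> i w) + c * L2_inner \<Omega> (weak_deriv \<Omega> i v) (weak_deriv \<Omega> i w)"
      if i: "i \<in> Basis" for i
    proof -
      note D = H01_weak_deriv(1)[OF _ i]
      have "L2_inner \<Omega> (weak_deriv \<Omega> i (\<lambda>x. b * u x + c * v x)) (weak_deriv \<Omega> i w)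
          = L2_inner \<Omega> (cscale b (weak_deriv \<Omega> i u) + cscale c (weak_deriv \<Omega> i v)) (weak_deriv \<Omega> i w)"
        using H01_lincomb[OF u v] D u v w i
        by (intro L2_inner_cong_AE) (auto simp: cscale_def plus_fun_def intro!: L2_add L2_cmult elim!: eventually_mono)
      then show ?thesis using D u v w by (simp add: ip_simps)
    qed
    then show ?thesis by (simp add: dirichlet_form_def sum.distrib sum_distrib_left)
  qed
  show ?thesis
  proof
    show "subspace (H01 \<Omega>)" unfolding subspace_def
    proof (intro conjI ballI allI)
      show "0 \<in> H01 \<Omega>" using H01_zero by (simp add: zero_fun_def)
      show "u + v \<in> H01 \<Omega>" if "u \<in> H01 \<Omega>" "v \<in> H01 \<Omega>" for u v
        using H01_lincomb(1)[OF that, of 1 1] by (simp add: plus_fun_def)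
      show "cscale c u \<in> H01 \<Omega>" if "u \<in> H01 \<Omega>" for c u
        using H01_lincomb(1)[OF that that, of c 0] by (simp add: cscale_def)
    qed
  next
    fix u v w assume "u \<in> H01 \<Omega>" "v \<in> H01 \<Omega>" "w \<in> H01 \<Omega>"
    then show "dirichlet_form \<Omega> (u + v) w = dirichlet_form \<Omega> u w + dirichlet_form \<Omega> v w"
      using lin[of u v w 1 1] by (simp add: plus_fun_def)
  next
    fix u w c assume "u \<in> H01 \<Omega>" "w \<in> H01 \<Omega>"
    then show "dirichlet_form \<Omega> (cscale c u) w = c * dirichlet_form \<Omega> u w"
      using lin[of u u w c 0] by (simp add: cscale_def)
  next
    fix u v assume "u \<in> H01 \<Omega>" "v \<in> H01 \<Omega>"
    then show "dirichlet_form \<Omega> v u = cnj (dirichlet_form \<Omega> u v)"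
      unfolding dirichlet_form_def cnj_sum by (intro sum.cong ip_herm H01_weak_deriv) auto
  next
    fix u assume "u \<in> H01 \<Omega>"
    then show "0 \<le> Re (dirichlet_form \<Omega> u u)"
      unfolding dirichlet_form_def Re_sum by (intro sum_nonneg ip_nonneg H01_weak_deriv) auto
  qed
qed

lemma dirichlet_form_space: "form_space cscale (L2 \<Omega>) (L2_inner \<Omega>) (H01 \<Omega>) (dirichlet_form \<Omega>)"
proof -
  interpret semi_inner cscale "L2 \<Omega>" "L2_inner \<Omega>" by (rule L2_semi_inner)
  interpret A: semi_inner cscale "H01 \<Omega>" "dirichlet_form \<Omega>" by (rule dirichlet_semi_inner)
  show ?thesis by unfold_locales (use H01_L2 L2_complete in blast)+
qed

lemma dirichlet_laplacian_op_graph: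
  "dirichlet_laplacian \<Omega> u f = form_space.op_graph (L2 \<Omega>) (L2_inner \<Omega>) (H01 \<Omega>) (dirichlet_form \<Omega>) u f"
  by (simp add: form_space.op_graph_def[OF dirichlet_form_space] dirichlet_laplacian_def)

end

section \<open>Positivity of the eigenvalues\<close>

text \<open>Difference quotients in the direction \<open>i\<close> integrate to 0 by translation
  invariance. The mean value inequality and the compact support dominate them, so their limit
  integrates to 0 too.\<close>

lemma integral_partial_deriv_zero:
  fixes f :: "'a::euclidean_space \<Rightarrow> complex"
  assumes der: "\<And>x. (f has_derivative f' x) (at x)" and K: "compact K" "\<And>x. x \<notin> K \<Longrightarrow> f x = 0"
    and bound: "\<And>x. cmod (f' x i) \<le> B" and i: "i \<in> Basis"
  shows "(LINT x|lborel. f' x i) = 0"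
proof -
  have cont: "continuous_on UNIV f"
    using der has_derivative_continuous by (intro continuous_at_imp_continuous_on) blast
  have [measurable]: "f \<in> borel_measurable borel" using cont by (rule borel_measurable_continuous_onI)
  have f_int: "integrable lborel f"
  proof -
    have "integrable lborel (\<lambda>x. indicator K x *\<^sub>R f x)"
      using K(1) cont continuous_on_subset by (intro borel_integrable_compact) blast+
    moreover have "(\<lambda>x. indicator K x *\<^sub>R f x) = f" using K(2) by (auto simp: indicator_def)
    ultimately show ?thesis by simp
  qed
  define v where "v n = inverse (real (Suc n)) *\<^sub>R i" for n
  have ni: "norm i = 1" using i by simp
  have nv: "norm (v n) = inverse (real (Suc n))" for n using ni by (simp add: v_def)
  have nv1: "norm (v n) \<le> 1" for n unfolding nv by (simp add: field_simps)
  define q where "q n x = real (Suc n) *\<^sub>R (f (v n + x) - f x)" for n x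
  have [measurable]: "q n \<in> borel_measurable borel" for n unfolding q_def by measurable
  have shift_int: "integrable lborel (\<lambda>x. f (v n + x))" for n
    using f_int lborel_distr_plus[of "v n"] integrable_distr_eq[of "(+) (v n)" lborel borel f] by auto
  have shift: "(LINT x|lborel. f (v n + x)) = (LINT x|lborel. f x)" for n
    using lborel_distr_plus[of "v n"] integral_distr[of "(+) (v n)" lborel borel f] by auto
  have q_int: "(LINT x|lborel. q n x) = 0" for n
    unfolding q_def using f_int shift_int by (simp add: shift)
  have lim: "(\<lambda>n. q n x) \<longlonglongrightarrow> f' x i" for x
  proof -
    have lin: "bounded_linear (f' x)" and
      D: "((\<lambda>h. norm (f (x + h) - f x - f' x h) / norm h) \<longlongrightarrow> 0) (at 0)"
      using der[of x] unfolding has_derivative_at by auto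
    have v0: "v \<longlonglongrightarrow> 0" unfolding v_def
      using tendsto_scaleR[OF LIMSEQ_inverse_real_of_nat tendsto_const[of i]] by simp
    have vne: "v n \<noteq> 0" for n using nv[of n] by auto
    have "filterlim v (at 0) sequentially" using v0 vne by (simp add: filterlim_at)
    from filterlim_compose[OF D this]
    have "(\<lambda>n. norm (f (x + v n) - f x - f' x (v n)) / norm (v n)) \<longlonglongrightarrow> 0" .
    moreover have "norm (f (x + v n) - f x - f' x (v n)) / norm (v n) = norm (q n x - f' x i)" for n
    proof -
      have "f' x (v n) = inverse (real (Suc n)) *\<^sub>R f' x i"
        unfolding v_def using linear_scale[OF bounded_linear.linear[OF lin]] by blast
      then have "q n x - f' x i = real (Suc n) *\<^sub>R (f (x + v n) - f x - f' x (v n))"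
        by (simp add: q_def scaleR_diff_right add.commute del: of_nat_Suc)
      then show ?thesis unfolding nv by (simp add: divide_inverse del: of_nat_Suc)
    qed
    ultimately show ?thesis using tendsto_norm_zero_iff LIM_zero_iff by (simp add: LIM_zero_iff tendsto_norm_zero_iff)
  qed
  have qB: "norm (q n x) \<le> B" for n x
  proof -
    define g where "g t = f (x + t *\<^sub>R i)" for t :: real
    have gd: "(g has_derivative (\<lambda>s. s *\<^sub>R f' (x + t *\<^sub>R i) i)) (at t)" for t
    proof -
      have "((\<lambda>t. x + t *\<^sub>R i) has_derivative (\<lambda>s. s *\<^sub>R i)) (at t)" by (auto intro!: derivative_eq_intros)
      from has_derivative_compose[OF this der[of "x + t *\<^sub>R i"]]
      have "(g has_derivative (\<lambda>s. f' (x + t *\<^sub>R i) (s *\<^sub>R i))) (at t)" unfolding g_def .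
      moreover have "f' (x + t *\<^sub>R i) (s *\<^sub>R i) = s *\<^sub>R f' (x + t *\<^sub>R i) i" for s
        using linear_scale[OF has_derivative_linear[OF der]] by blast
      ultimately show ?thesis by simp
    qed
    have "norm (g (inverse (real (Suc n))) - g 0) \<le> B * norm (inverse (real (Suc n)) - 0)"
    proof (rule differentiable_bound)
      show "convex (UNIV :: real set)" by simp
      show "(g has_derivative (\<lambda>s. s *\<^sub>R f' (x + t *\<^sub>R i) i)) (at t within UNIV)" for t using gd by simp
      show "onorm (\<lambda>s. s *\<^sub>R f' (x + t *\<^sub>R i) i) \<le> B" for t
        by (rule onorm_le) (use bound in \<open>simp add: mult.commute[of B] mult_left_mono\<close>)
    qed auto
    then have "norm (f (v n + x) - f x) \<le> B * inverse (real (Suc n))"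
      by (simp add: g_def v_def add.commute)
    then have "real (Suc n) * norm (f (v n + x) - f x) \<le> B" by (simp add: field_simps del: of_nat_Suc)
    then show ?thesis by (simp add: q_def del: of_nat_Suc)
  qed
  obtain R where R: "\<And>x. x \<in> K \<Longrightarrow> norm x \<le> R" using compact_imp_bounded[OF K(1)] by (auto simp: bounded_iff)
  \<comment> \<open>The shifts have length at most 1, so enlarging the radius by 1 accommodates all
    quotients at once.\<close>
  have q0: "q n x = 0" if "x \<notin> cball 0 (R + 1)" for n x
  proof -
    have x: "R + 1 < norm x" using that by (simp add: dist_norm)
    have "norm x \<le> norm (v n + x) + norm (v n)" using norm_triangle_ineq4[of "v n + x" "v n"] by simp
    then have "R < norm (v n + x)" "R < norm x" using x nv1[of n] by linarith+
    then have "v n + x \<notin> K" "x \<notin> K" using R by (meson not_le)+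
    then show ?thesis using K(2) by (simp add: q_def)
  qed
  have "(\<lambda>n. LINT x|lborel. q n x) \<longlonglongrightarrow> (LINT x|lborel. f' x i)"
  proof (rule integral_dominated_convergence)
    show "(\<lambda>x. f' x i) \<in> borel_measurable lborel"
      by (rule borel_measurable_LIMSEQ_metric[of q]) (use lim in auto)
    show "integrable lborel (\<lambda>x. B * indicator (cball 0 (R + 1)) x :: real)"
      by (intro integrable_mult_right integrable_real_indicator emeasure_bounded_finite) auto
    show "AE x in lborel. norm (q n x) \<le> B * indicator (cball 0 (R + 1)) x" for n
      using qB q0 by (intro always_eventually) (auto simp: indicator_def)
  qed (use lim in auto)
  then show ?thesis unfolding q_int using LIMSEQ_unique tendsto_const by blast
qed

lemma L2_nm_tendsto_0:
  assumes "\<And>n. f n \<in> L2 \<Omega>" "(\<lambda>n. sq_int \<Omega> (f n)) \<longlonglongrightarrow> 0" shows "(\<lambda>n. L2_nm \<Omega> (f n)) \<longlonglongrightarrow> 0"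
proof -
  have "(\<lambda>n. (L2_nm \<Omega> (f n))\<^sup>2) \<longlonglongrightarrow> 0"
    by (rule tendsto_ennrealD) (use assms(2) in \<open>auto simp: sq_int_L2_nm[OF assms(1)]\<close>)
  from tendsto_real_sqrt[OF this] show ?thesis by (simp add: L2_nm_nonneg)
qed

context
  fixes \<Omega> :: "'a::euclidean_space set"
  assumes \<Omega>: "open \<Omega>"
begin

interpretation L2: semi_inner cscale "L2 \<Omega>" "L2_inner \<Omega>" by (rule L2_semi_inner)

text \<open>Integrating the \<open>i\<close>-th partial derivative of \<open>arctan (x \<bullet> i) \<bar>\<phi>\<bar>\<^sup>2\<close> gives a weighted
  Poincare inequality that needs no assumption on the geometry of \<open>\<Omega>\<close>.\<close>

lemma test_weighted_poincare:
  assumes \<phi>: "\<phi> \<in> test_functions \<Omega>" and i: "i \<in> Basis"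
  shows "sq_int \<Omega> (\<lambda>x. complex_of_real (sqrt (1 / (1 + (x \<bullet> i)\<^sup>2))) * \<phi> x)
    \<le> ennreal (pi * (L2_nm \<Omega> \<phi> * L2_nm \<Omega> (partial_deriv i \<phi>)))"
proof -
  have \<Omega>s: "\<Omega> \<in> sets lebesgue" using \<Omega> by auto
  define d where "d = partial_deriv i \<phi>"
  have dt: "d \<in> test_functions \<Omega>" unfolding d_def using \<phi> i by (rule test_partial_deriv)
  have L: "\<phi> \<in> L2 \<Omega>" "d \<in> L2 \<Omega>" using \<Omega>s \<phi> dt by (auto intro: test_L2)
  obtain K where K: "compact K" "K \<subseteq> \<Omega>" "\<And>x. x \<notin> K \<Longrightarrow> \<phi> x = 0" "\<And>x. x \<notin> K \<Longrightarrow> d x = 0"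
    using test_support[OF \<phi>] unfolding d_def by blast
  obtain B1 where B1: "\<And>x. cmod (\<phi> x) \<le> B1" using test_bounded[OF \<phi>] by blast
  obtain B2 where B2: "\<And>x. cmod (d x) \<le> B2" using test_bounded[OF dt] by blast
  have B0: "0 \<le> B1" "0 \<le> B2" using B1[of 0] B2[of 0] norm_ge_zero order_trans by blast+
  \<comment> \<open>The derivative of \<open>arctan\<close>: a positive weight with a bounded
    primitive. The bound \<open>pi / 2\<close> of the primitive, doubled by the two terms of the
    product rule, gives the factor \<open>pi\<close>.\<close>
  define w where "w x = 1 / (1 + (x \<bullet> i)\<^sup>2)" for x
  have w: "0 < w x" "w x \<le> 1" for x
    by (auto simp: w_def add_pos_nonneg divide_le_eq)
  define h where "h x = complex_of_real (w x) * (\<phi> x * cnj (\<phi> x))" for x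
  define k where "k x = complex_of_real (arctan (x \<bullet> i)) * (\<phi> x * cnj (d x) + d x * cnj (\<phi> x))" for x
  have cont: "continuous_on UNIV \<phi>" "continuous_on UNIV d"
    using \<phi> dt by (auto intro: smooth_continuous test_smooth)
  have w_cont: "continuous_on UNIV w" unfolding w_def
    by (intro continuous_intros) (auto simp: add_nonneg_eq_0_iff)
  have m [measurable]: "h \<in> borel_measurable borel" "k \<in> borel_measurable borel"
    unfolding h_def k_def by (intro borel_measurable_continuous_onI continuous_intros cont w_cont)+
  have arct: "\<bar>arctan y\<bar> \<le> pi / 2" for y using arctan_bounded[of y] by linarith
  have kle: "cmod (k x) \<le> pi * (cmod (\<phi> x) * cmod (d x))" for x
  proof -
    have "cmod (k x) = \<bar>arctan (x \<bullet> i)\<bar> * cmod (\<phi> x * cnj (d x) + d x * cnj (\<phi> x))" by (simp add: k_def norm_mult)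
    also have "\<dots> \<le> pi / 2 * (2 * (cmod (\<phi> x) * cmod (d x)))"
      using norm_triangle_ineq[of "\<phi> x * cnj (d x)" "d x * cnj (\<phi> x)"] arct[of "x \<bullet> i"]
      by (intro mult_mono) (auto simp: norm_mult mult_ac)
    finally show ?thesis by simp
  qed
  have hle: "cmod (h x) = w x * (cmod (\<phi> x))\<^sup>2" for x
    using w[of x] by (simp add: h_def norm_mult power2_eq_square)
  have wle: "w x * (cmod (\<phi> x))\<^sup>2 \<le> (cmod (\<phi> x))\<^sup>2" for x
    using w[of x] by (intro mult_left_le_one_le) auto
  define f where "f x = complex_of_real (arctan (x \<bullet> i)) * (\<phi> x * cnj (\<phi> x))" for x
  define f' where "f' x v = complex_of_real (arctan (x \<bullet> i)) * (\<phi> x * cnj (frechet_derivative \<phi> (at x) v) +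
     frechet_derivative \<phi> (at x) v * cnj (\<phi> x)) + complex_of_real (w x * (v \<bullet> i)) * (\<phi> x * cnj (\<phi> x))" for x v
  have der: "(f has_derivative f' x) (at x)" for x
  proof -
    have p: "(\<phi> has_derivative frechet_derivative \<phi> (at x)) (at x)"
      using smooth_differentiable[OF test_smooth[OF \<phi>]] by (rule partial_deriv_has_derivative)
    have "((\<lambda>x. x \<bullet> i) has_derivative (\<lambda>v. v \<bullet> i)) (at x)" by (auto intro!: derivative_eq_intros)
    from has_derivative_compose[OF this DERIV_arctan[THEN has_field_derivative_imp_has_derivative]]
    have a: "((\<lambda>x. arctan (x \<bullet> i)) has_derivative (\<lambda>v. w x * (v \<bullet> i))) (at x)"
      by (simp add: w_def inverse_eq_divide)
    show ?thesis unfolding f_def f'_def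
      using has_derivative_mult[OF has_derivative_of_real[OF a, where 'a = complex] has_derivative_mult[OF p has_derivative_cnj[OF p]]] by simp
  qed
  have f'i: "f' x i = k x + h x" for x
    using i by (simp add: f'_def k_def h_def d_def partial_deriv_def)
  have "(LINT x|lborel. f' x i) = 0"
  proof (rule integral_partial_deriv_zero[OF der K(1)])
    show "f x = 0" if "x \<notin> K" for x using K(3)[OF that] by (simp add: f_def)
    show "cmod (f' x i) \<le> pi * (B1 * B2) + B1\<^sup>2" for x
    proof -
      have "cmod (f' x i) \<le> cmod (k x) + cmod (h x)" unfolding f'i by (rule norm_triangle_ineq)
      also have "\<dots> \<le> pi * (cmod (\<phi> x) * cmod (d x)) + w x * (cmod (\<phi> x))\<^sup>2" using kle by (simp add: hle)
      also have "\<dots> \<le> pi * (B1 * B2) + 1 * B1\<^sup>2"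
        using B1 B2 B0 w by (intro add_mono mult_mono power_mono mult_left_mono) (auto intro: less_imp_le)
      finally show ?thesis by simp
    qed
  qed (fact i)
  then have "(LINT x|lebesgue. k x + h x) = 0" unfolding f'i by (subst integral_completion) auto
  moreover have "indicator \<Omega> x *\<^sub>R (k x + h x) = k x + h x" for x
    using K by (cases "x \<in> K") (auto simp: k_def h_def)
  ultimately have "(LINT x|lebesgue_on \<Omega>. k x + h x) = 0"
    using \<Omega>s by (subst integral_restrict_space) auto
  have ab: "(\<lambda>x. complex_of_real (cmod (\<phi> x))) \<in> L2 \<Omega>" "(\<lambda>x. complex_of_real (cmod (d x))) \<in> L2 \<Omega>"
    using L by (auto simp: L2_iff)
  have pd_int: "integrable (lebesgue_on \<Omega>) (\<lambda>x. cmod (\<phi> x) * cmod (d x))"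
    using integrable_norm[OF L2_integrable_mult[OF L]] by (simp add: norm_mult)
  have mm: "h \<in> borel_measurable (lebesgue_on \<Omega>)" "k \<in> borel_measurable (lebesgue_on \<Omega>)"
    using m by (auto intro!: measurable_restrict_space1 measurable_completion)
  have k_int: "integrable (lebesgue_on \<Omega>) k"
    by (rule Bochner_Integration.integrable_bound[OF integrable_mult_right[OF pd_int, of pi]]) (use mm kle in auto)
  have h_int: "integrable (lebesgue_on \<Omega>) h"
    by (rule Bochner_Integration.integrable_bound[of _ "\<lambda>x. (cmod (\<phi> x))\<^sup>2"])
      (use mm L(1) wle in \<open>auto simp: L2_iff hle\<close>)
  have "(LINT x|lebesgue_on \<Omega>. h x) = - (LINT x|lebesgue_on \<Omega>. k x)"
    using \<open>(LINT x|lebesgue_on \<Omega>. k x + h x) = 0\<close> k_int h_int by (simp add: add_eq_0_iff2)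
  then have "cmod (LINT x|lebesgue_on \<Omega>. h x) \<le> (LINT x|lebesgue_on \<Omega>. cmod (k x))"
    by (simp add: integral_norm_bound)
  also have "\<dots> \<le> (LINT x|lebesgue_on \<Omega>. pi * (cmod (\<phi> x) * cmod (d x)))"
    using k_int pd_int kle by (intro integral_mono) auto
  also have "\<dots> = pi * (LINT x|lebesgue_on \<Omega>. cmod (\<phi> x) * cmod (d x))" by simp
  also have "(LINT x|lebesgue_on \<Omega>. cmod (\<phi> x) * cmod (d x)) = Re (L2_inner \<Omega> (\<lambda>x. complex_of_real (cmod (\<phi> x))) (\<lambda>x. complex_of_real (cmod (d x))))"
    unfolding L2_inner_def by (simp flip: of_real_mult)
  also have "\<dots> \<le> L2_nm \<Omega> (\<lambda>x. complex_of_real (cmod (\<phi> x))) * L2_nm \<Omega> (\<lambda>x. complex_of_real (cmod (d x)))"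
    using ab by (rule L2.Re_cauchy_schwarz)
  also have "\<dots> = L2_nm \<Omega> \<phi> * L2_nm \<Omega> d" unfolding L2.nm_def L2_inner_self by simp
  finally have main: "cmod (LINT x|lebesgue_on \<Omega>. h x) \<le> pi * (L2_nm \<Omega> \<phi> * L2_nm \<Omega> d)" by simp
  have hr: "h x = complex_of_real (w x * (cmod (\<phi> x))\<^sup>2)" for x
    by (simp add: h_def complex_norm_square[symmetric])
  have "(LINT x|lebesgue_on \<Omega>. h x) = of_real (LINT x|lebesgue_on \<Omega>. w x * (cmod (\<phi> x))\<^sup>2)"
    unfolding hr by (rule integral_complex_of_real)
  then have main': "(LINT x|lebesgue_on \<Omega>. w x * (cmod (\<phi> x))\<^sup>2) \<le> pi * (L2_nm \<Omega> \<phi> * L2_nm \<Omega> d)"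
    using main by simp
  have "sq_int \<Omega> (\<lambda>x. complex_of_real (sqrt (w x)) * \<phi> x) = (\<integral>\<^sup>+x. ennreal (w x * (cmod (\<phi> x))\<^sup>2) \<partial>lebesgue_on \<Omega>)"
    unfolding sq_int_def using w by (intro nn_integral_cong) (auto simp: norm_mult power_mult_distrib less_imp_le)
  also have "\<dots> = ennreal (LINT x|lebesgue_on \<Omega>. w x * (cmod (\<phi> x))\<^sup>2)"
    using integrable_norm[OF h_int] w by (intro nn_integral_eq_integral) (auto simp: hle less_imp_le)
  also have "\<dots> \<le> ennreal (pi * (L2_nm \<Omega> \<phi> * L2_nm \<Omega> d))" using main' by (rule ennreal_leI)
  finally show ?thesis by (simp add: w_def d_def)
qed

text \<open>The weighted inequality passes to the limit: the norms of \<open>\<phi> n\<close> stay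
  bounded while those of their derivatives tend to 0. Since the weight never vanishes,
  \<open>u\<close> is null. A single direction \<open>i\<close> suffices.\<close>

lemma H01_weak_deriv_zero:
  assumes u: "u \<in> H01 \<Omega>" and i: "i \<in> Basis" and z: "AE x in lebesgue_on \<Omega>. weak_deriv \<Omega> i u x = 0"
  shows "AE x in lebesgue_on \<Omega>. u x = 0"
proof -
  have \<Omega>s: "\<Omega> \<in> sets lebesgue" using \<Omega> by auto
  have uL: "u \<in> L2 \<Omega>" using \<Omega> u by (rule H01_L2)
  obtain \<phi> where \<phi>: "\<And>n::nat. \<phi> n \<in> test_functions \<Omega>" "(\<lambda>n. sq_int \<Omega> (\<lambda>x. \<phi> n x - u x)) \<longlonglongrightarrow> 0"
      "(\<lambda>n. sq_int \<Omega> (\<lambda>x. partial_deriv i (\<phi> n) x - weak_deriv \<Omega> i u x)) \<longlonglongrightarrow> 0"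
    using H01_approx[OF \<Omega> u] i by blast
  have \<phi>L: "\<phi> n \<in> L2 \<Omega>" "partial_deriv i (\<phi> n) \<in> L2 \<Omega>" for n
    using \<phi>(1) i \<Omega>s by (auto intro: test_L2 test_partial_deriv)
  have d0: "(\<lambda>n. L2_nm \<Omega> (partial_deriv i (\<phi> n))) \<longlonglongrightarrow> 0"
  proof (rule L2_nm_tendsto_0)
    have "sq_int \<Omega> (\<lambda>x. partial_deriv i (\<phi> n) x - weak_deriv \<Omega> i u x) = sq_int \<Omega> (partial_deriv i (\<phi> n))" for n
      by (rule sq_int_cong_AE) (use z in \<open>auto elim!: eventually_mono\<close>)
    then show "(\<lambda>n. sq_int \<Omega> (partial_deriv i (\<phi> n))) \<longlonglongrightarrow> 0" using \<phi>(3) by simp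
  qed (fact \<phi>L(2))
  have diffL: "\<phi> n - u \<in> L2 \<Omega>" for n using \<phi>L uL by auto
  have u0: "(\<lambda>n. L2_nm \<Omega> (\<phi> n - u)) \<longlonglongrightarrow> 0"
    by (rule L2_nm_tendsto_0[OF diffL]) (use \<phi>(2) in \<open>simp add: fun_diff_def\<close>)
  define s where "s x = complex_of_real (sqrt (1 / (1 + (x \<bullet> i)\<^sup>2)))" for x
  have s1: "cmod (s x) \<le> 1" for x by (simp add: s_def add_pos_nonneg divide_le_eq)
  have s0: "s x \<noteq> 0" for x by (simp add: s_def add_nonneg_eq_0_iff)
  have "continuous_on UNIV s" unfolding s_def by (intro continuous_intros) (auto simp: add_nonneg_eq_0_iff)
  then have sm [measurable]: "s \<in> borel_measurable (lebesgue_on \<Omega>)"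
    by (intro measurable_restrict_space1 measurable_completion) (simp add: borel_measurable_continuous_onI)
  have sL: "f \<in> L2 \<Omega> \<Longrightarrow> (\<lambda>x. s x * f x) \<in> L2 \<Omega>" for f using sm s1 by (intro L2_bounded_mult)
  have g0: "(\<lambda>n. sq_int \<Omega> (\<lambda>x. s x * \<phi> n x)) \<longlonglongrightarrow> 0"
  proof (rule tendsto_sandwich[where f = "\<lambda>_. 0"])
    have "sq_int \<Omega> (\<lambda>x. s x * \<phi> n x)
        \<le> ennreal (pi * ((L2_nm \<Omega> u + L2_nm \<Omega> (\<phi> n - u)) * L2_nm \<Omega> (partial_deriv i (\<phi> n))))" for n
    proof -
      have "L2_nm \<Omega> (\<phi> n) \<le> L2_nm \<Omega> u + L2_nm \<Omega> (\<phi> n - u)" using \<phi>L uL by (intro L2.nm_diff_triangle)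
      then show ?thesis unfolding s_def
        by (intro order_trans[OF test_weighted_poincare[OF \<phi>(1) i]] ennreal_leI mult_left_mono mult_right_mono) (auto simp: L2_nm_nonneg)
    qed
    then show "\<forall>\<^sub>F n in sequentially. sq_int \<Omega> (\<lambda>x. s x * \<phi> n x)
        \<le> ennreal (pi * ((L2_nm \<Omega> u + L2_nm \<Omega> (\<phi> n - u)) * L2_nm \<Omega> (partial_deriv i (\<phi> n))))" by simp
    have "(\<lambda>n. ennreal (pi * ((L2_nm \<Omega> u + L2_nm \<Omega> (\<phi> n - u)) * L2_nm \<Omega> (partial_deriv i (\<phi> n)))))
        \<longlonglongrightarrow> ennreal (pi * ((L2_nm \<Omega> u + 0) * 0))"
      by (intro tendsto_intros u0 d0)
    then show "(\<lambda>n. ennreal (pi * ((L2_nm \<Omega> u + L2_nm \<Omega> (\<phi> n - u)) * L2_nm \<Omega> (partial_deriv i (\<phi> n))))) \<longlonglongrightarrow> 0"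
      by simp
  qed auto
  have "(\<lambda>n::nat. sq_int \<Omega> (\<lambda>x. s x * u x)) \<longlonglongrightarrow> 0"
  proof (rule sq_int_tendsto_0[OF _ \<phi>(2) _ g0, where B = 1])
    show "AE x in lebesgue_on \<Omega>. cmod (s x * u x) \<le> 1 * (cmod (\<phi> n x - u x) + cmod (s x * \<phi> n x))" for n
    proof (intro always_eventually allI)
      fix x
      have "s x * u x = s x * \<phi> n x - s x * (\<phi> n x - u x)" by (simp add: algebra_simps)
      then have "cmod (s x * u x) \<le> cmod (s x * \<phi> n x) + cmod (s x * (\<phi> n x - u x))"
        by (metis norm_triangle_ineq4)
      also have "cmod (s x * (\<phi> n x - u x)) \<le> 1 * cmod (\<phi> n x - u x)"
        unfolding norm_mult using s1 by (intro mult_right_mono) auto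
      finally show "cmod (s x * u x) \<le> 1 * (cmod (\<phi> n x - u x) + cmod (s x * \<phi> n x))" by simp
    qed
  qed (use \<phi>L uL sL in \<open>auto dest!: L2_measurable\<close>)
  then have "sq_int \<Omega> (\<lambda>x. s x * u x) = 0" using LIMSEQ_unique tendsto_const by blast
  then have "L2_nm \<Omega> (\<lambda>x. s x * u x) = 0" using sq_int_L2_nm[OF sL[OF uL]] by simp
  then have "AE x in lebesgue_on \<Omega>. s x * u x = 0" using L2_nm_eq_0_iff[OF sL[OF uL]] by blast
  then show ?thesis by eventually_elim (simp add: s0)
qed

text \<open>For \<open>\<mu> \<le> 0\<close> the energy of an eigenfunction would be nonnegative and
  equal to \<open>\<mu>\<close> times its squared norm, hence 0, so its weak derivatives would be
  null. This makes -1 a regular point in the discrete case and gives sense to negative powers of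
  \<open>lam 1\<close>.\<close>

lemma eigenvalue_pos:
  assumes "eigenvalue \<Omega> (complex_of_real \<mu>)" shows "0 < \<mu>"
proof (rule ccontr)
  interpret A: semi_inner cscale "H01 \<Omega>" "dirichlet_form \<Omega>" using \<Omega> by (rule dirichlet_semi_inner)
  assume "\<not> 0 < \<mu>"
  obtain u where u: "dirichlet_laplacian \<Omega> u (\<lambda>x. complex_of_real \<mu> * u x)" "\<not> (AE x in lebesgue_on \<Omega>. u x = 0)"
    using assms by (auto simp: eigenvalue_def eigenfunction_def eigenspace_def)
  have uH: "u \<in> H01 \<Omega>" using u(1) by (simp add: dirichlet_laplacian_def)
  have uL: "u \<in> L2 \<Omega>" using \<Omega> uH by (rule H01_L2)
  have "dirichlet_form \<Omega> u u = L2_inner \<Omega> (cscale (of_real \<mu>) u) u"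
    using u(1) uH by (simp add: dirichlet_laplacian_def cscale_def)
  then have "Re (dirichlet_form \<Omega> u u) = \<mu> * (L2_nm \<Omega> u)\<^sup>2" using uL by (simp add: L2.ip_simps L2.nm_sq)
  moreover have "\<mu> * (L2_nm \<Omega> u)\<^sup>2 \<le> 0" using \<open>\<not> 0 < \<mu>\<close> by (simp add: mult_nonpos_nonneg)
  ultimately have "Re (dirichlet_form \<Omega> u u) = 0" using A.ip_nonneg[OF uH] by linarith
  then have sum0: "(\<Sum>i\<in>Basis. Re (L2_inner \<Omega> (weak_deriv \<Omega> i u) (weak_deriv \<Omega> i u))) = 0"
    by (simp add: dirichlet_form_def)
  obtain i :: 'a where i: "i \<in> Basis" using nonempty_Basis by blast
  have "Re (L2_inner \<Omega> (weak_deriv \<Omega> i u) (weak_deriv \<Omega> i u)) = 0"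
    using sum0 i by (subst (asm) sum_nonneg_eq_0_iff) (auto intro: L2.ip_nonneg H01_weak_deriv[OF \<Omega> uH])
  then have "L2_nm \<Omega> (weak_deriv \<Omega> i u) = 0" by (simp add: L2.nm_def)
  then have "AE x in lebesgue_on \<Omega>. weak_deriv \<Omega> i u x = 0"
    using L2_nm_eq_0_iff H01_weak_deriv[OF \<Omega> uH i] by blast
  from H01_weak_deriv_zero[OF uH i this] show False using u(2) by simp
qed

end

section \<open>Eigenvalue counting\<close>

lemma Lp_norm_2_L2_nm: "f \<in> L2 \<Omega> \<Longrightarrow> Lp_norm 2 \<Omega> f = ennreal (L2_nm \<Omega> f)"
  by (simp add: Lp_norm_2 sq_int_L2_nm L2_nm_nonneg)

text \<open>Makes the definite description in \<open>eigen_multiplicity\<close> meaningful: more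
  than \<open>m\<close> vectors in the span of \<open>m\<close> satisfy a nontrivial linear
  relation.\<close>

lemma has_multiplicity_le:
  assumes "has_multiplicity \<Omega> z m" "has_multiplicity \<Omega> z n" shows "n \<le> m"
proof (rule ccontr)
  assume "\<not> n \<le> m"
  obtain e where e: "\<And>i. i < n \<Longrightarrow> e i \<in> eigenspace \<Omega> z"
    "\<And>c::nat \<Rightarrow> complex. (AE x in lebesgue_on \<Omega>. (\<Sum>i<n. c i * e i x) = 0) \<Longrightarrow> \<forall>i<n. c i = 0"
    using assms(2) unfolding has_multiplicity_def by blast
  obtain e' where e': "\<And>u. u \<in> eigenspace \<Omega> z \<Longrightarrow> \<exists>c::nat \<Rightarrow> complex. AE x in lebesgue_on \<Omega>. u x = (\<Sum>i<m. c i * e' i x)"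
    using assms(1) unfolding has_multiplicity_def by blast
  have "\<forall>j<n. \<exists>c::nat \<Rightarrow> complex. AE x in lebesgue_on \<Omega>. e j x = (\<Sum>i<m. c i * e' i x)" using e(1) e' by blast
  then obtain A :: "nat \<Rightarrow> nat \<Rightarrow> complex" where
    A: "\<And>j. j < n \<Longrightarrow> AE x in lebesgue_on \<Omega>. e j x = (\<Sum>i<m. A j i * e' i x)" by metis
  obtain c j0 where c: "j0 < n" "c j0 \<noteq> 0" "\<And>i. i < m \<Longrightarrow> (\<Sum>j<n. c j * A j i) = 0"
    using homogeneous_system[of "{..<m}" "{..<n}" A] \<open>\<not> n \<le> m\<close> by auto
  have "AE x in lebesgue_on \<Omega>. \<forall>j\<in>{..<n}. e j x = (\<Sum>i<m. A j i * e' i x)"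
    using A by (intro AE_finite_allI) auto
  then have "AE x in lebesgue_on \<Omega>. (\<Sum>j<n. c j * e j x) = 0"
  proof eventually_elim
    case (elim x)
    then have "(\<Sum>j<n. c j * e j x) = (\<Sum>j<n. \<Sum>i<m. c j * A j i * e' i x)"
      by (intro sum.cong) (auto simp: sum_distrib_left mult.assoc)
    also have "\<dots> = (\<Sum>i<m. (\<Sum>j<n. c j * A j i) * e' i x)" by (subst sum.swap) (simp add: sum_distrib_right)
    also have "\<dots> = 0" using c(3) by simp
    finally show ?case .
  qed
  from e(2)[OF this] c show False by blast
qed

lemma eigen_multiplicity_eq: "has_multiplicity \<Omega> z n \<Longrightarrow> eigen_multiplicity \<Omega> z = n"
  unfolding eigen_multiplicity_def by (rule the_equality) (auto intro: antisym has_multiplicity_le)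

lemma multiplicity_pos_eigenvalue:
  assumes "has_multiplicity \<Omega> z n" "0 < n" shows "eigenvalue \<Omega> z"
proof -
  obtain e where e: "\<And>i. i < n \<Longrightarrow> e i \<in> eigenspace \<Omega> z"
    "\<And>c::nat \<Rightarrow> complex. (AE x in lebesgue_on \<Omega>. (\<Sum>i<n. c i * e i x) = 0) \<Longrightarrow> \<forall>i<n. c i = 0"
    using assms(1) unfolding has_multiplicity_def by blast
  have "\<not> (AE x in lebesgue_on \<Omega>. e 0 x = 0)"
  proof
    assume *: "AE x in lebesgue_on \<Omega>. e 0 x = 0"
    have "(\<Sum>i<n. (if i = 0 then 1 else 0) * e i x) = e 0 x" for x
      using assms(2) by (simp add: if_distrib[where f = "\<lambda>c. c * _"] cong: if_cong)
    with * have "\<forall>i<n. (if i = 0 then 1 else 0 :: complex) = 0" by (intro e(2)) simp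
    from this[rule_format, OF assms(2)] show False by simp
  qed
  then show ?thesis using e(1)[OF assms(2)] by (auto simp: eigenvalue_def eigenfunction_def)
qed

section \<open>Domains with empty essential spectrum\<close>

locale discrete_domain =
  fixes \<Omega> :: "'a::euclidean_space set"
  assumes \<Omega>: "open \<Omega>" and ess: "essential_spectrum \<Omega> = {}"
begin

interpretation form_space cscale "L2 \<Omega>" "L2_inner \<Omega>" "H01 \<Omega>" "dirichlet_form \<Omega>"
  using \<Omega> by (rule dirichlet_form_space)

lemma op_graph_iff: "op_graph u f \<longleftrightarrow> dirichlet_laplacian \<Omega> u f"
  by (simp add: dirichlet_laplacian_op_graph[OF \<Omega>])

lemma resolvent_inv_bounded:
  assumes "complex_of_real z \<in> resolvent_set \<Omega>" shows "inv_bounded z"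
proof -
  obtain M where M: "\<And>f u. f \<in> L2 \<Omega> \<Longrightarrow> dirichlet_laplacian \<Omega> u (\<lambda>x. f x + complex_of_real z * u x) \<Longrightarrow>
       Lp_norm 2 \<Omega> u \<le> ennreal M * Lp_norm 2 \<Omega> f" using assms unfolding resolvent_set_def by blast
  \<comment> \<open>\<open>ennreal\<close> sends a negative \<open>M\<close> to 0, hence the
    maximum.\<close>
  have "nm u \<le> max M 0 * nm f" if f: "f \<in> L2 \<Omega>" and u: "op_graph u (f + cscale (of_real z) u)" for f u
  proof -
    have u': "dirichlet_laplacian \<Omega> u (\<lambda>x. f x + complex_of_real z * u x)"
      using u by (simp add: op_graph_iff cscale_def plus_fun_def)
    have uL: "u \<in> L2 \<Omega>" using u by (simp add: op_graph_def)
    have "ennreal (nm u) \<le> ennreal M * ennreal (nm f)" using M[OF f u'] f uL by (simp add: Lp_norm_2_L2_nm)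
    also have "\<dots> \<le> ennreal (max M 0) * ennreal (nm f)" by (intro mult_right_mono ennreal_leI) auto
    also have "\<dots> = ennreal (max M 0 * nm f)" using f by (intro ennreal_mult[symmetric]) auto
    finally show ?thesis using f by (simp add: ennreal_le_iff)
  qed
  then show ?thesis unfolding inv_bounded_def by blast
qed

lemma eigenvalue_obtain_eigenvector:
  assumes "eigenvalue \<Omega> (complex_of_real \<mu>)"
  obtains u where "op_graph u (cscale (of_real \<mu>) u)" "0 < nm u"
proof -
  obtain u where u: "dirichlet_laplacian \<Omega> u (\<lambda>x. complex_of_real \<mu> * u x)" "\<not> (AE x in lebesgue_on \<Omega>. u x = 0)"
    using assms by (auto simp: eigenvalue_def eigenfunction_def eigenspace_def)
  have uL: "u \<in> L2 \<Omega>" using u(1) H01_L2[OF \<Omega>] by (auto simp: dirichlet_laplacian_def)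
  have "nm u \<noteq> 0" using u(2) L2_nm_eq_0_iff[OF uL] by simp
  then have "0 < nm u" using nm_nonneg[OF uL] by linarith
  then show ?thesis using u(1) by (intro that) (auto simp: op_graph_iff cscale_def)
qed

text \<open>An eigenvector contradicts the resolvent bound with right-hand side 0, so an eigenvalue
  is a point of the spectrum; as nothing is essential, it is discrete.\<close>

lemma eigenvalue_spectrum:
  assumes "eigenvalue \<Omega> (complex_of_real \<mu>)"
  shows "complex_of_real \<mu> isolated_in spectrum \<Omega>" "\<exists>n. has_multiplicity \<Omega> (complex_of_real \<mu>) n"
proof -
  have "complex_of_real \<mu> \<notin> resolvent_set \<Omega>"
  proof
    assume "complex_of_real \<mu> \<in> resolvent_set \<Omega>"
    then obtain M where M: "\<And>f u. f \<in> L2 \<Omega> \<Longrightarrow> op_graph u (f + cscale (of_real \<mu>) u) \<Longrightarrow> nm u \<le> M * nm f"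
      using resolvent_inv_bounded unfolding inv_bounded_def by blast
    obtain u where "op_graph u (cscale (of_real \<mu>) u)" "0 < nm u" using eigenvalue_obtain_eigenvector[OF assms] by blast
    then show False using M[of 0 u] by (simp add: nm_def ip_zero)
  qed
  then have "complex_of_real \<mu> \<in> discrete_spectrum \<Omega>"
    using ess by (auto simp: essential_spectrum_def spectrum_def)
  then show "complex_of_real \<mu> isolated_in spectrum \<Omega>" "\<exists>n. has_multiplicity \<Omega> (complex_of_real \<mu>) n"
    by (auto simp: discrete_spectrum_def)
qed

lemma not_eigenvalue_resolvent: "\<not> eigenvalue \<Omega> z \<Longrightarrow> z \<in> resolvent_set \<Omega>"
  using ess by (auto simp: essential_spectrum_def spectrum_def discrete_spectrum_def)

text \<open>Every spectral point is an isolated eigenvalue here, which is the alternative that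
  \<open>rayleigh_bound\<close> assumes as \<open>spec\<close>.\<close>

lemma inv_bounded_near:
  "inv_bounded \<mu> \<or> (\<exists>\<epsilon>>0. \<forall>z. 0 < \<bar>z - \<mu>\<bar> \<and> \<bar>z - \<mu>\<bar> < \<epsilon> \<longrightarrow> inv_bounded z)"
proof (cases "eigenvalue \<Omega> (complex_of_real \<mu>)")
  case True
  from eigenvalue_spectrum(1)[OF this] obtain \<epsilon> where \<epsilon>: "\<epsilon> > 0"
    "\<And>y. y \<in> spectrum \<Omega> \<Longrightarrow> dist (complex_of_real \<mu>) y < \<epsilon> \<Longrightarrow> y = complex_of_real \<mu>"
    unfolding isolated_in_dist_Ex_iff by blast
  have "inv_bounded z" if z: "0 < \<bar>z - \<mu>\<bar>" "\<bar>z - \<mu>\<bar> < \<epsilon>" for z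
  proof (rule resolvent_inv_bounded, rule ccontr)
    assume "complex_of_real z \<notin> resolvent_set \<Omega>"
    moreover have "dist (complex_of_real \<mu>) (complex_of_real z) < \<epsilon>"
      using z by (simp add: dist_norm norm_minus_commute flip: of_real_diff)
    ultimately show False using \<epsilon>(2)[of "complex_of_real z"] z by (simp add: spectrum_def)
  qed
  then show ?thesis using \<epsilon>(1) by blast
qed (use not_eigenvalue_resolvent resolvent_inv_bounded in blast)

text \<open>The number -1 is not an eigenvalue, since eigenvalues are positive, and in the absence
  of essential spectrum it is therefore regular.\<close>

lemma resolvent_surj: assumes f: "f \<in> L2 \<Omega>" shows "\<exists>u. op_graph u (f - u)"
proof -
  have "\<not> eigenvalue \<Omega> (complex_of_real (-1))" using eigenvalue_pos[OF \<Omega>, of "-1"] by linarith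
  then have "complex_of_real (-1) \<in> resolvent_set \<Omega>" by (rule not_eigenvalue_resolvent)
  then obtain u where "dirichlet_laplacian \<Omega> u (\<lambda>x. f x + complex_of_real (-1) * u x)"
    using f unfolding resolvent_set_def by blast
  moreover have "(\<lambda>x. f x + complex_of_real (-1) * u x) = f - u" by auto
  ultimately show ?thesis unfolding op_graph_iff by metis
qed

text \<open>Infinitely many would accumulate at some \<open>s\<close>. A lower bound for
  \<open>H - s\<close> fails on eigenvectors whose eigenvalue is close enough to \<open>s\<close>;
  lower bounds on a punctured neighbourhood of \<open>s\<close> fail at the eigenvalues inside it.
  Without finiteness the sum in \<open>eigenvalue_count\<close> would be 0 by default.\<close>

lemma finite_eigenvalues: "finite {\<mu>. \<mu> \<le> t \<and> eigenvalue \<Omega> (complex_of_real \<mu>)}" (is "finite ?E")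
proof (rule ccontr)
  assume inf: "infinite ?E"
  have "?E \<subseteq> {0..t}" by (auto dest!: eigenvalue_pos[OF \<Omega>])
  then obtain s where s: "s islimpt ?E"
    using inf compact_imp_bounded[OF compact_Icc] bounded_subset by (metis bounded_infinite_imp_islimpt inf subset_refl)
  show False using inv_bounded_near[of s]
  proof
    assume "inv_bounded s"
    then obtain M where M: "\<And>f u. f \<in> L2 \<Omega> \<Longrightarrow> op_graph u (f + cscale (of_real s) u) \<Longrightarrow> nm u \<le> M * nm f"
      unfolding inv_bounded_def by blast
    have "0 < 1 / (\<bar>M\<bar> + 1)" by simp
    then obtain \<mu> where \<mu>: "eigenvalue \<Omega> (complex_of_real \<mu>)" "\<bar>\<mu> - s\<bar> < 1 / (\<bar>M\<bar> + 1)"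
      using s unfolding islimpt_approachable dist_real_def by blast
    obtain u where u: "op_graph u (cscale (of_real \<mu>) u)" "0 < nm u" using eigenvalue_obtain_eigenvector[OF \<mu>(1)] by blast
    have uL: "u \<in> L2 \<Omega>" using u(1) by (simp add: op_graph_def)
    have "cscale (of_real (\<mu> - s)) u + cscale (of_real s) u = cscale (of_real \<mu>) u"
      by (simp flip: scale_left_distrib of_real_add)
    then have "nm u \<le> M * nm (cscale (of_real (\<mu> - s)) u)" using M[of "cscale (of_real (\<mu> - s)) u" u] u uL by auto
    also have "\<dots> = (M * \<bar>\<mu> - s\<bar>) * nm u" using uL by (simp add: nm_scale del: of_real_diff)
    finally have "1 \<le> M * \<bar>\<mu> - s\<bar>" using u(2) by simp
    also have "\<dots> \<le> \<bar>M\<bar> * \<bar>\<mu> - s\<bar>" by (intro mult_right_mono) auto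
    also have "\<dots> \<le> \<bar>M\<bar> * (1 / (\<bar>M\<bar> + 1))" using \<mu>(2) by (intro mult_left_mono) auto
    also have "\<dots> < 1" by (simp add: divide_less_eq)
    finally show False by simp
  next
    assume "\<exists>\<epsilon>>0. \<forall>z. 0 < \<bar>z - s\<bar> \<and> \<bar>z - s\<bar> < \<epsilon> \<longrightarrow> inv_bounded z"
    then obtain \<epsilon> where \<epsilon>: "\<epsilon> > 0" "\<And>z. 0 < \<bar>z - s\<bar> \<Longrightarrow> \<bar>z - s\<bar> < \<epsilon> \<Longrightarrow> inv_bounded z" by blast
    obtain \<mu> where \<mu>: "eigenvalue \<Omega> (complex_of_real \<mu>)" "\<mu> \<noteq> s" "\<bar>\<mu> - s\<bar> < \<epsilon>"
      using s \<epsilon>(1) unfolding islimpt_approachable dist_real_def by blast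
    then have "inv_bounded \<mu>" using \<epsilon>(2)[of \<mu>] by simp
    then obtain M where M: "\<And>f u. f \<in> L2 \<Omega> \<Longrightarrow> op_graph u (f + cscale (of_real \<mu>) u) \<Longrightarrow> nm u \<le> M * nm f"
      unfolding inv_bounded_def by blast
    obtain u where "op_graph u (cscale (of_real \<mu>) u)" "0 < nm u" using eigenvalue_obtain_eigenvector[OF \<mu>(1)] by blast
    then show False using M[of 0 u] by (simp add: nm_def ip_zero)
  qed
qed

text \<open>The vectors \<open>e'\<close> are indexed by pairs of an eigenvalue up to
  \<open>t\<close> and a basis index of its eigenspace, so that their number is the count. They need
  not be orthogonal to each other: the abstract bound uses only their span.\<close>

theorem trial_functions_le_count:
  fixes f :: "'j \<Rightarrow> 'a \<Rightarrow> complex"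
  assumes J: "finite J" and f: "\<And>j. j \<in> J \<Longrightarrow> f j \<in> H01 \<Omega>"
      "\<And>j. j \<in> J \<Longrightarrow> Re (dirichlet_form \<Omega> (f j) (f j)) < t * (L2_nm \<Omega> (f j))\<^sup>2"
    and orth: "\<And>j k. \<lbrakk>j \<in> J; k \<in> J; j \<noteq> k\<rbrakk> \<Longrightarrow> L2_inner \<Omega> (f j) (f k) = 0"
      "\<And>j k. \<lbrakk>j \<in> J; k \<in> J; j \<noteq> k\<rbrakk> \<Longrightarrow> dirichlet_form \<Omega> (f j) (f k) = 0"
  shows "card J \<le> eigenvalue_count \<Omega> t"
proof -
  define E where "E = {\<mu>. \<mu> \<le> t \<and> eigenvalue \<Omega> (complex_of_real \<mu>)}"
  have E: "finite E" unfolding E_def by (rule finite_eigenvalues)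
  define n where "n \<mu> = eigen_multiplicity \<Omega> (complex_of_real \<mu>)" for \<mu>
  have n: "has_multiplicity \<Omega> (complex_of_real \<mu>) (n \<mu>)" if "\<mu> \<in> E" for \<mu>
    using eigenvalue_spectrum(2)[of \<mu>] eigen_multiplicity_eq that by (auto simp: E_def n_def)
  have "\<forall>\<mu>\<in>E. \<exists>e. (\<forall>i<n \<mu>. e i \<in> eigenspace \<Omega> (complex_of_real \<mu>)) \<and>
      (\<forall>u\<in>eigenspace \<Omega> (complex_of_real \<mu>). \<exists>c::nat \<Rightarrow> complex. AE x in lebesgue_on \<Omega>. u x = (\<Sum>i<n \<mu>. c i * e i x))"
    using n unfolding has_multiplicity_def by blast
  from bchoice[OF this] obtain e where "\<forall>\<mu>\<in>E. (\<forall>i<n \<mu>. e \<mu> i \<in> eigenspace \<Omega> (complex_of_real \<mu>)) \<and>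
      (\<forall>u\<in>eigenspace \<Omega> (complex_of_real \<mu>). \<exists>c::nat \<Rightarrow> complex. AE x in lebesgue_on \<Omega>. u x = (\<Sum>i<n \<mu>. c i * e \<mu> i x))" ..
  then have e: "\<And>\<mu> i. \<mu> \<in> E \<Longrightarrow> i < n \<mu> \<Longrightarrow> e \<mu> i \<in> eigenspace \<Omega> (complex_of_real \<mu>)"
      "\<And>\<mu> u. \<mu> \<in> E \<Longrightarrow> u \<in> eigenspace \<Omega> (complex_of_real \<mu>) \<Longrightarrow>
        \<exists>c::nat \<Rightarrow> complex. AE x in lebesgue_on \<Omega>. u x = (\<Sum>i<n \<mu>. c i * e \<mu> i x)"
    by blast+
  define I where "I = (SIGMA \<mu>:E. {..<n \<mu>})"
  have I: "finite I" unfolding I_def using E by (intro finite_SigmaI) auto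
  have cardI: "card I = eigenvalue_count \<Omega> t"
    unfolding I_def eigenvalue_count_def using E by (simp add: E_def n_def)
  define e' where "e' p = e (fst p) (snd p)" for p
  have eop: "op_graph (e' p) (cscale (of_real (fst p)) (e' p))" if "p \<in> I" for p
    using e(1) that by (auto simp: I_def e'_def op_graph_iff cscale_def eigenspace_def)
  have eL: "e' p \<in> L2 \<Omega>" if "p \<in> I" for p using eop[OF that] by (simp add: op_graph_def)
  have bound: "t * (nm u)\<^sup>2 \<le> Re (dirichlet_form \<Omega> u u)"
    if u: "u \<in> H01 \<Omega>" "\<And>p. p \<in> I \<Longrightarrow> L2_inner \<Omega> u (e' p) = 0" for u
  proof (rule rayleigh_bound[where e = e' and l = fst, OF resolvent_surj inv_bounded_near I eop _ _ u])
    show "0 \<le> fst p" if "p \<in> I" for p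
      using that by (auto simp: I_def E_def dest!: eigenvalue_pos[OF \<Omega>])
  next
    fix v \<mu> assume \<mu>: "\<mu> \<le> t" and v: "op_graph v (cscale (of_real \<mu>) v)"
    have vL: "v \<in> L2 \<Omega>" using v by (simp add: op_graph_def)
    have v': "v \<in> eigenspace \<Omega> (complex_of_real \<mu>)" using v by (simp add: eigenspace_def op_graph_iff cscale_def)
    have "\<exists>c. AE x in lebesgue_on \<Omega>. v x = (\<Sum>p\<in>I. cscale (c p) (e' p)) x"
    proof (cases "\<mu> \<in> E")
      case True
      obtain c :: "nat \<Rightarrow> complex" where c: "AE x in lebesgue_on \<Omega>. v x = (\<Sum>i<n \<mu>. c i * e \<mu> i x)"
        using e(2)[OF True v'] by blast
      define c' where "c' p = (if fst p = \<mu> then c (snd p) else 0)" for p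
      have "(\<Sum>p\<in>I. cscale (c' p) (e' p)) x = (\<Sum>i<n \<mu>. c i * e \<mu> i x)" for x
      proof -
        have "(\<Sum>p\<in>I. cscale (c' p) (e' p)) x = (\<Sum>p\<in>I. c' p * e' p x)"
          using I by (induction I rule: finite_induct) (auto simp: cscale_def)
        also have "\<dots> = (\<Sum>\<nu>\<in>E. \<Sum>i<n \<nu>. c' (\<nu>, i) * e' (\<nu>, i) x)"
          unfolding I_def using E by (subst sum.Sigma) (auto simp: case_prod_beta)
        also have "\<dots> = (\<Sum>\<nu>\<in>E. if \<nu> = \<mu> then (\<Sum>i<n \<mu>. c i * e \<mu> i x) else 0)"
          by (intro sum.cong) (auto simp: c'_def e'_def)
        also have "\<dots> = (\<Sum>i<n \<mu>. c i * e \<mu> i x)" using E True by simp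
        finally show ?thesis .
      qed
      then show ?thesis using c by (intro exI[of _ c']) simp
    next
      case False
      then have "AE x in lebesgue_on \<Omega>. v x = 0"
        using v' \<mu> by (auto simp: E_def eigenvalue_def eigenfunction_def)
      then show ?thesis by (intro exI[of _ "\<lambda>_. 0"]) simp
    qed
    then obtain c where c: "AE x in lebesgue_on \<Omega>. v x = (\<Sum>p\<in>I. cscale (c p) (e' p)) x" by blast
    have sL: "(\<Sum>p\<in>I. cscale (c p) (e' p)) \<in> L2 \<Omega>" using eL by auto
    have "v - (\<Sum>p\<in>I. cscale (c p) (e' p)) \<in> L2 \<Omega>" using vL sL by auto
    then have "nm (v - (\<Sum>p\<in>I. cscale (c p) (e' p))) = 0"
      using c by (subst L2_nm_eq_0_iff) (auto elim!: eventually_mono)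
    then show "\<exists>c. nm (v - (\<Sum>p\<in>I. cscale (c p) (e' p))) = 0" by blast
  qed
  show ?thesis unfolding cardI[symmetric]
    by (rule trial_count[OF I J eL bound f orth])
qed

end

section \<open>Localised eigenfunctions\<close>

definition localise :: "real \<Rightarrow> 'a::euclidean_space \<Rightarrow> ('a \<Rightarrow> complex) \<Rightarrow> 'a \<Rightarrow> complex" where
  "localise r y u = (\<lambda>x. complex_of_real (bump r y x) * u x)"

definition bump_grad :: "real \<Rightarrow> 'a::euclidean_space \<Rightarrow> 'a \<Rightarrow> real" where
  "bump_grad r y x = (\<Sum>i\<in>Basis. (cmod (partial_deriv i (\<lambda>x. complex_of_real (bump r y x)) x))\<^sup>2)"

lemma bump_grad_nonneg: "0 \<le> bump_grad r y x"
  by (simp add: bump_grad_def sum_nonneg)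

lemma bump_grad_le: "0 < r \<Longrightarrow> bump_grad r y x \<le> 16 / r\<^sup>2 * indicator (ball y (2 * r)) x"
  unfolding bump_grad_def by (rule bump_gradient)

lemma partial_deriv_bump_real: "cnj (partial_deriv i (\<lambda>x. complex_of_real (bump r y x)) x) = partial_deriv i (\<lambda>x. complex_of_real (bump r y x)) x"
  by (simp add: bump_gen_partial_deriv)

lemma bump_partial_bound:
  assumes r: "0 < r" and i: "i \<in> Basis"
  shows "cmod (partial_deriv i (\<lambda>x. complex_of_real (bump r y x)) x) \<le> 4 / r"
proof (rule power2_le_imp_le)
  have "(cmod (partial_deriv i (\<lambda>x. complex_of_real (bump r y x)) x))\<^sup>2 \<le> bump_grad r y x"
    unfolding bump_grad_def using i by (intro member_le_sum) auto
  also have "\<dots> \<le> 16 / r\<^sup>2 * indicator (ball y (2 * r)) x" unfolding bump_grad_def by (rule bump_gradient[OF r])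
  also have "\<dots> \<le> (4 / r)\<^sup>2" by (auto simp: indicator_def power_divide)
  finally show "(cmod (partial_deriv i (\<lambda>x. complex_of_real (bump r y x)) x))\<^sup>2 \<le> (4 / r)\<^sup>2" .
qed (use r in simp)

context
  fixes \<Omega> :: "'a::euclidean_space set" and r :: real
  assumes \<Omega>: "open \<Omega>" and r: "0 < r"
begin

interpretation L2: semi_inner cscale "L2 \<Omega>" "L2_inner \<Omega>" by (rule L2_semi_inner)

lemma localise_H01:
  assumes u: "u \<in> H01 \<Omega>"
  shows "localise r y u \<in> H01 \<Omega>"
    "\<And>i. i \<in> Basis \<Longrightarrow> AE x in lebesgue_on \<Omega>. weak_deriv \<Omega> i (localise r y u) x =
       complex_of_real (bump r y x) * weak_deriv \<Omega> i u x + partial_deriv i (\<lambda>x. complex_of_real (bump r y x)) x * u x"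
proof -
  have b1: "cmod (complex_of_real (bump r y x)) \<le> 1 + 4 / r" for x
    using bump_nonneg[of r y x] bump_le_1[of r y x] r by (simp add: add_increasing2)
  have b2: "i \<in> Basis \<Longrightarrow> cmod (partial_deriv i (\<lambda>x. complex_of_real (bump r y x)) x) \<le> 1 + 4 / r" for i x
    using bump_partial_bound[OF r, of i y x] by linarith
  show "localise r y u \<in> H01 \<Omega>" unfolding localise_def
    by (rule H01_mult(1)[OF \<Omega> u smooth_bump_gen, where B = "1 + 4 / r"]) (use b1 b2 in auto)
  show "AE x in lebesgue_on \<Omega>. weak_deriv \<Omega> i (localise r y u) x =
       complex_of_real (bump r y x) * weak_deriv \<Omega> i u x + partial_deriv i (\<lambda>x. complex_of_real (bump r y x)) x * u x"
    if "i \<in> Basis" for i unfolding localise_def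
    by (rule H01_mult(2)[OF \<Omega> u smooth_bump_gen, where B = "1 + 4 / r"]) (use b1 b2 that in auto)
qed

text \<open>The bumps live on balls of radius \<open>2 * r\<close>, which are disjoint for centres
  at distance at least \<open>4 * r\<close>; the same holds for their gradients.\<close>

lemma localise_form_orthogonal:
  assumes u: "u \<in> H01 \<Omega>" and y: "4 * r \<le> dist y y'"
  shows "L2_inner \<Omega> (localise r y u) (localise r y' u) = 0" "dirichlet_form \<Omega> (localise r y u) (localise r y' u) = 0"
proof -
  have disj: "x \<notin> ball y (2 * r) \<or> x \<notin> ball y' (2 * r)" for x
    using y dist_triangle[of y y' x] by (auto simp: dist_commute)
  have bz: "x \<notin> ball z (2 * r) \<Longrightarrow> bump_gen j r z x = 0" for x j and z :: 'a by (rule bump_gen_zero[OF r])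
  have bdz: "x \<notin> ball z (2 * r) \<Longrightarrow> partial_deriv i (\<lambda>x. complex_of_real (bump r z x)) x = 0" for x i and z :: 'a
    by (simp add: bump_gen_partial_deriv bz)
  have "(\<lambda>x. localise r y u x * cnj (localise r y' u x)) = (\<lambda>x. 0)"
  proof
    show "localise r y u x * cnj (localise r y' u x) = 0" for x
      using disj[of x] bz by (auto simp: localise_def)
  qed
  then show "L2_inner \<Omega> (localise r y u) (localise r y' u) = 0" by (simp add: L2_inner_def)
  have "L2_inner \<Omega> (weak_deriv \<Omega> i (localise r y u)) (weak_deriv \<Omega> i (localise r y' u)) = 0" if i: "i \<in> Basis" for i
  proof -
    have "AE x in lebesgue_on \<Omega>. weak_deriv \<Omega> i (localise r y u) x * cnj (weak_deriv \<Omega> i (localise r y' u) x) = 0"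
      using localise_H01(2)[OF u i, of y] localise_H01(2)[OF u i, of y']
    proof eventually_elim
      case (elim x)
      then show ?case using disj[of x] bz[of x y] bz[of x y'] bdz[of x y] bdz[of x y'] by auto
    qed
    then show ?thesis unfolding L2_inner_def by (rule integral_eq_zero_AE)
  qed
  then show "dirichlet_form \<Omega> (localise r y u) (localise r y' u) = 0" by (simp add: dirichlet_form_def)
qed

text \<open>The IMS localisation formula. For the real bump \<open>b\<close> and each partial
  derivative \<open>D\<close>, almost everywhere
  \<open>|D (b u)|^2 = Re (D u * cnj (D (b^2 u))) + |D b|^2 |u|^2\<close>. The function
  \<open>b^2 u\<close>, written as \<open>localise\<close> applied twice, is an admissible test
  function in the eigenvalue equation.\<close>

lemma localise_form_eigenfunction:
  assumes u: "dirichlet_laplacian \<Omega> u (\<lambda>x. complex_of_real \<mu> * u x)"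
  shows "Re (dirichlet_form \<Omega> (localise r y u) (localise r y u)) =
    \<mu> * (L2_nm \<Omega> (localise r y u))\<^sup>2 + (LINT x|lebesgue_on \<Omega>. bump_grad r y x * (cmod (u x))\<^sup>2)"
proof -
  have uH: "u \<in> H01 \<Omega>" using u by (simp add: dirichlet_laplacian_def)
  have uL: "u \<in> L2 \<Omega>" using \<Omega> uH by (rule H01_L2)
  define c where "c x = complex_of_real (bump r y x)" for x
  define d where "d i x = partial_deriv i c x" for i x
  have dc: "d i x = partial_deriv i (\<lambda>x. complex_of_real (bump r y x)) x" for i x by (simp add: d_def c_def[abs_def])
  have cc: "cnj (c x) = c x" "cnj (d i x) = d i x" for x i
    using partial_deriv_bump_real by (auto simp: c_def dc)
  have locH: "localise r y u \<in> H01 \<Omega>" "localise r y (localise r y u) \<in> H01 \<Omega>" using localise_H01(1) uH by auto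
  have DL: "weak_deriv \<Omega> i v \<in> L2 \<Omega>" if "v \<in> H01 \<Omega>" "i \<in> Basis" for v i
    using H01_weak_deriv[OF \<Omega> that] by simp
  have dm: "(\<lambda>x. d i x * u x) \<in> L2 \<Omega>" if i: "i \<in> Basis" for i
  proof (rule L2_bounded_mult[OF uL])
    show "d i \<in> borel_measurable (lebesgue_on \<Omega>)"
      unfolding d_def[abs_def] c_def[abs_def] by (intro smooth_measurable smooth_partial_deriv smooth_bump_gen i)
    show "cmod (d i x) \<le> 4 / r" for x unfolding dc by (rule bump_partial_bound[OF r i])
  qed
  have dint: "integrable (lebesgue_on \<Omega>) (\<lambda>x. (cmod (d i x))\<^sup>2 * (cmod (u x))\<^sup>2)" if i: "i \<in> Basis" for i
    using dm[OF i] by (simp add: L2_iff norm_mult power_mult_distrib)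
  have per: "Re (L2_inner \<Omega> (weak_deriv \<Omega> i (localise r y u)) (weak_deriv \<Omega> i (localise r y u))) =
      Re (L2_inner \<Omega> (weak_deriv \<Omega> i u) (weak_deriv \<Omega> i (localise r y (localise r y u)))) +
      (LINT x|lebesgue_on \<Omega>. (cmod (d i x))\<^sup>2 * (cmod (u x))\<^sup>2)" if i: "i \<in> Basis" for i
  proof -
    let ?D1 = "weak_deriv \<Omega> i (localise r y u)" and ?D2 = "weak_deriv \<Omega> i (localise r y (localise r y u))" and ?D = "weak_deriv \<Omega> i u"
    have int1: "integrable (lebesgue_on \<Omega>) (\<lambda>x. ?D1 x * cnj (?D1 x))"
      using locH i by (intro L2_integrable_mult L2_cnj DL)
    have int2: "integrable (lebesgue_on \<Omega>) (\<lambda>x. ?D x * cnj (?D2 x))"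
      using locH uH i by (intro L2_integrable_mult L2_cnj DL)
    have "Re (L2_inner \<Omega> ?D1 ?D1) = (LINT x|lebesgue_on \<Omega>. Re (?D1 x * cnj (?D1 x)))"
      unfolding L2_inner_def using int1 by (rule integral_Re[symmetric])
    also have "\<dots> = (LINT x|lebesgue_on \<Omega>. Re (?D x * cnj (?D2 x)) + (cmod (d i x))\<^sup>2 * (cmod (u x))\<^sup>2)"
    proof (rule integral_cong_AE)
      show "(\<lambda>x. Re (?D1 x * cnj (?D1 x))) \<in> borel_measurable (lebesgue_on \<Omega>)"
        using borel_measurable_integrable[OF integrable_Re[OF int1]] .
      show "(\<lambda>x. Re (?D x * cnj (?D2 x)) + (cmod (d i x))\<^sup>2 * (cmod (u x))\<^sup>2) \<in> borel_measurable (lebesgue_on \<Omega>)"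
        using borel_measurable_integrable[OF integrable_Re[OF int2]] borel_measurable_integrable[OF dint[OF i]] by measurable
      show "AE x in lebesgue_on \<Omega>. Re (?D1 x * cnj (?D1 x)) = Re (?D x * cnj (?D2 x)) + (cmod (d i x))\<^sup>2 * (cmod (u x))\<^sup>2"
        using localise_H01(2)[OF uH i, of y] localise_H01(2)[OF locH(1) i, of y]
      proof eventually_elim
        case (elim x)
        define a where "a = ?D x"
        define b where "b = bump r y x"
        define g where "g = Re (d i x)"
        have gd: "d i x = complex_of_real g" using cc(2)[of i x] by (simp add: g_def complex_eq_iff)
        have e1: "?D1 x = of_real b * a + of_real g * u x"
          using elim(1) by (simp add: a_def b_def gd[symmetric] dc)
        have e2: "?D2 x = of_real b * (of_real b * a + of_real g * u x) + of_real g * (of_real b * u x)"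
          using elim(2) e1 by (simp add: a_def b_def gd[symmetric] dc localise_def)
        have "cmod (u x) * cmod (u x) = Re (u x) * Re (u x) + Im (u x) * Im (u x)"
          using cmod_power2[of "u x"] by (simp add: power2_eq_square)
        then show ?case unfolding e1 e2 a_def[symmetric] gd
          by (simp add: algebra_simps power2_eq_square)
      qed
    qed
    also have "\<dots> = (LINT x|lebesgue_on \<Omega>. Re (?D x * cnj (?D2 x))) + (LINT x|lebesgue_on \<Omega>. (cmod (d i x))\<^sup>2 * (cmod (u x))\<^sup>2)"
      using integrable_Re[OF int2] dint[OF i] by (rule Bochner_Integration.integral_add)
    also have "(LINT x|lebesgue_on \<Omega>. Re (?D x * cnj (?D2 x))) = Re (L2_inner \<Omega> ?D ?D2)"
      unfolding L2_inner_def using int2 by (rule integral_Re)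
    finally show ?thesis .
  qed
  have "Re (dirichlet_form \<Omega> (localise r y u) (localise r y u)) = Re (dirichlet_form \<Omega> u (localise r y (localise r y u))) +
      (\<Sum>i\<in>Basis. LINT x|lebesgue_on \<Omega>. (cmod (d i x))\<^sup>2 * (cmod (u x))\<^sup>2)"
    unfolding dirichlet_form_def Re_sum by (simp add: per sum.distrib)
  also have "(\<Sum>i\<in>Basis. LINT x|lebesgue_on \<Omega>. (cmod (d i x))\<^sup>2 * (cmod (u x))\<^sup>2)
      = (LINT x|lebesgue_on \<Omega>. bump_grad r y x * (cmod (u x))\<^sup>2)"
    using dint by (simp add: bump_grad_def dc[symmetric] sum_distrib_right)
  also have "dirichlet_form \<Omega> u (localise r y (localise r y u)) = L2_inner \<Omega> (\<lambda>x. complex_of_real \<mu> * u x) (localise r y (localise r y u))"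
    using u locH(2) by (simp add: dirichlet_laplacian_def)
  also have "\<dots> = of_real \<mu> * L2_inner \<Omega> (localise r y u) (localise r y u)"
    unfolding L2_inner_def by (simp add: localise_def mult_ac)
  also have "Re \<dots> = \<mu> * (L2_nm \<Omega> (localise r y u))\<^sup>2" using locH(1) H01_L2[OF \<Omega>] by (simp add: L2.nm_sq)
  finally show ?thesis .
qed

end

lemma (in discrete_domain) separated_low_energy_count:
  assumes r: "0 < r" and u: "dirichlet_laplacian \<Omega> u (\<lambda>x. complex_of_real \<mu> * u x)"
    and Z: "finite Z" "\<And>y z. \<lbrakk>y \<in> Z; z \<in> Z; y \<noteq> z\<rbrakk> \<Longrightarrow> 4 * r \<le> dist y z"
    and low: "\<And>y. y \<in> Z \<Longrightarrow> (LINT x|lebesgue_on \<Omega>. bump_grad r y x * (cmod (u x))\<^sup>2)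
        < \<theta> * \<mu> * (LINT x|lebesgue_on \<Omega>. (bump r y x)\<^sup>2 * (cmod (u x))\<^sup>2)"
  shows "card Z \<le> eigenvalue_count \<Omega> ((1 + \<theta>) * \<mu>)"
proof (rule trial_functions_le_count[where f = "\<lambda>y. localise r y u"])
  have uH: "u \<in> H01 \<Omega>" using u by (simp add: dirichlet_laplacian_def)
  fix y assume y: "y \<in> Z"
  show "localise r y u \<in> H01 \<Omega>" by (rule localise_H01(1)[OF \<Omega> r uH])
  have "(L2_nm \<Omega> (localise r y u))\<^sup>2 = (LINT x|lebesgue_on \<Omega>. (bump r y x)\<^sup>2 * (cmod (u x))\<^sup>2)"
    by (simp add: L2_nm_sq localise_def norm_mult power_mult_distrib)
  then show "Re (dirichlet_form \<Omega> (localise r y u) (localise r y u)) < (1 + \<theta>) * \<mu> * (L2_nm \<Omega> (localise r y u))\<^sup>2"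
    using low[OF y] by (simp add: localise_form_eigenfunction[OF \<Omega> r u] algebra_simps)
next
  have uH: "u \<in> H01 \<Omega>" using u by (simp add: dirichlet_laplacian_def)
  fix y z assume "y \<in> Z" "z \<in> Z" "y \<noteq> z"
  then show "L2_inner \<Omega> (localise r y u) (localise r z u) = 0" "dirichlet_form \<Omega> (localise r y u) (localise r z u) = 0"
    using localise_form_orthogonal[OF \<Omega> r uH Z(2)] by auto
qed (fact Z(1))

section \<open>From a local decay inequality to a bound on the \<open>L\<^sub>1\<close> norm\<close>

lemma sqrt_sum_le: "finite I \<Longrightarrow> (\<And>i. i \<in> I \<Longrightarrow> 0 \<le> f i) \<Longrightarrow> sqrt (\<Sum>i\<in>I. f i) \<le> (\<Sum>i\<in>I. sqrt (f i))"
proof (induction I rule: finite_induct)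
  case (insert i I)
  then have "sqrt (f i + sum f I) \<le> sqrt (f i) + sqrt (sum f I)"
    by (intro sqrt_add_le_add_sqrt sum_nonneg) auto
  with insert show ?case by fastforce
qed simp

text \<open>With \<open>s\<close> the \<open>d\<close>-th root of 1/2, the sequence is the
  \<open>d\<close>-th power of \<open>(n + 1) * s^n\<close>.\<close>

lemma half_power_times_poly_tendsto_0:
  assumes d: "0 < d" shows "(\<lambda>n. (1/2) ^ n * (real n + 1) ^ d) \<longlonglongrightarrow> 0"
proof -
  define s where "s = root d (1/2)"
  have s: "0 \<le> s" "s < 1" "s ^ d = 1/2" using d by (auto simp: s_def)
  have "(\<lambda>n. of_nat n * s ^ n + s ^ n) \<longlonglongrightarrow> 0 + 0"
    using s by (intro tendsto_add powser_times_n_limit_0 LIMSEQ_realpow_zero) auto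
  from tendsto_power[OF this, of d] have "(\<lambda>n. (real n * s ^ n + s ^ n) ^ d) \<longlonglongrightarrow> 0" using d by (simp add: zero_power)
  moreover have "(real n * s ^ n + s ^ n) ^ d = (1/2) ^ n * (real n + 1) ^ d" for n
  proof -
    have "real n * s ^ n + s ^ n = s ^ n * (real n + 1)" by (simp add: algebra_simps)
    moreover have "(s ^ n) ^ d = (1/2) ^ n" by (metis power_mult mult.commute s(3))
    ultimately show ?thesis by (simp add: power_mult_distrib)
  qed
  ultimately show ?thesis by simp
qed

lemma nn_integral_lborel_shift:
  fixes f :: "'a::euclidean_space \<Rightarrow> ennreal"
  assumes "f \<in> borel_measurable borel"
  shows "(\<integral>\<^sup>+x. f (x + a) \<partial>lborel) = (\<integral>\<^sup>+x. f x \<partial>lborel)"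
proof -
  have "(\<integral>\<^sup>+x. f x \<partial>lborel) = (\<integral>\<^sup>+x. f x \<partial>distr lborel borel ((+) a))" by (simp add: lborel_distr_plus)
  also have "\<dots> = (\<integral>\<^sup>+x. f (a + x) \<partial>lborel)" using assms by (subst nn_integral_distr) auto
  finally show ?thesis by (simp add: add.commute)
qed

lemma ennreal_power2_le_imp_le: "a\<^sup>2 \<le> b\<^sup>2 \<Longrightarrow> a \<le> (b::ennreal)"
  by (cases a; cases b) (auto simp: ennreal_power top_unique intro: power2_le_imp_le)

text \<open>Let \<open>q\<close> be the root of \<open>Q\<close> and \<open>m\<close> the volume of
  a ball of radius \<open>r\<close>. Fubini and Cauchy-Schwarz on such balls give
  \<open>m * I \<le> sqrt m\<close> times the integral of \<open>q\<close>. By the decay that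
  integral is at most twice the part \<open>T\<close> over \<open>Y\<close>, and Cauchy-Schwarz
  bounds \<open>T^2\<close> by \<open>m * A\<close> times the volume of \<open>Y\<close>. All powers
  of \<open>m\<close> cancel.\<close>

theorem L1_bound_of_local_decay:
  fixes F :: "'a::euclidean_space \<Rightarrow> real" and V Z :: "'a set"
  assumes F [measurable]: "F \<in> borel_measurable borel" and F0: "\<And>x. 0 \<le> F x"
    and A: "(\<integral>\<^sup>+x. ennreal ((F x)\<^sup>2) \<partial>lborel) = ennreal A" "0 \<le> A" and r: "0 < r"
    and V: "finite V" "V \<noteq> {}" "\<And>v. v \<in> V \<Longrightarrow> norm v \<le> 2" and Z: "finite Z"
    and Q_def: "\<And>y. Q y = (\<integral>\<^sup>+x. ennreal ((F x)\<^sup>2) * indicator (ball y r) x \<partial>lborel)"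
    and decay: "\<And>y. y \<notin> (\<Union>z\<in>Z. ball z (4 * r)) \<Longrightarrow> Q y \<le> ennreal ((1 / (2 * real (card V)))\<^sup>2) * (\<Sum>v\<in>V. Q (y + r *\<^sub>R v))"
  shows "(\<integral>\<^sup>+x. ennreal (F x) \<partial>lborel)\<^sup>2
    \<le> ennreal (4 * (real (card Z) * (unit_ball_vol (real DIM('a)) * (4 * r) ^ DIM('a))) * A)"
proof -
  define \<omega> where "\<omega> = unit_ball_vol (real DIM('a))"
  have \<omega>: "0 < \<omega>" by (simp add: \<omega>_def)
  have vol: "emeasure lborel (ball z \<rho>) = ennreal (\<omega> * \<rho> ^ DIM('a))" if "0 \<le> \<rho>" for z :: 'a and \<rho>
    using that by (simp add: emeasure_ball \<omega>_def)
  have [measurable]: "ball x e \<in> sets borel" for x :: 'a and e by simp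
  \<comment> \<open>The indicator of a ball as a function of centre and point together; its joint
    measurability is what Fubini requires.\<close>
  define k where "k y x = (if dist y x < r then 1 else 0 :: ennreal)" for y x :: 'a
  have k_ind: "indicator (ball y r) x = k y x" for x y by (simp add: k_def indicator_def)
  have [measurable (raw)]: "(\<lambda>w. k (f w) (g w)) \<in> borel_measurable M"
    if [measurable]: "f \<in> borel_measurable M" "g \<in> borel_measurable M" for f g and M :: "'c measure"
    unfolding k_def by measurable
  have Qk: "Q y = (\<integral>\<^sup>+x. ennreal ((F x)\<^sup>2) * k y x \<partial>lborel)" for y unfolding Q_def k_ind ..
  have [measurable]: "Q \<in> borel_measurable borel" unfolding Qk[abs_def] by measurable
  have k_vol: "(\<integral>\<^sup>+y. k y x \<partial>lborel) = ennreal (\<omega> * r ^ DIM('a))" "(\<integral>\<^sup>+x. k y x \<partial>lborel) = ennreal (\<omega> * r ^ DIM('a))" for x y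
  proof -
    have "k y x = indicator (ball x r) y" for y by (simp add: k_def indicator_def dist_commute)
    then have "(\<integral>\<^sup>+y. k y x \<partial>lborel) = (\<integral>\<^sup>+y. indicator (ball x r) y \<partial>lborel)" by simp
    then show "(\<integral>\<^sup>+y. k y x \<partial>lborel) = ennreal (\<omega> * r ^ DIM('a))" using r by (simp add: vol)
    show "(\<integral>\<^sup>+x. k y x \<partial>lborel) = ennreal (\<omega> * r ^ DIM('a))"
      unfolding k_ind[symmetric] using r by (simp add: vol)
  qed
  define m where "m = \<omega> * r ^ DIM('a)"
  have m: "0 < m" using \<omega> r by (simp add: m_def)
  have QA: "Q y \<le> ennreal A" for y
    unfolding Qk A(1)[symmetric] by (intro nn_integral_mono) (auto simp: k_def)
  define qr where "qr y = sqrt (enn2real (Q y))" for y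
  define q where "q y = ennreal (qr y)" for y
  have qr0: "0 \<le> qr y" for y by (simp add: qr_def)
  have Qr: "Q y = ennreal ((qr y)\<^sup>2)" for y
    using QA[of y] by (simp add: qr_def ennreal_enn2real_if) (metis ennreal_neq_top top_unique)
  have qQ: "(q y)\<^sup>2 = Q y" for y using qr0 by (simp add: q_def Qr ennreal_power)
  have q_le: "q y \<le> ennreal (sqrt A)" for y
  proof -
    have "(qr y)\<^sup>2 \<le> A" using QA[of y] A(2) by (simp add: Qr ennreal_le_iff)
    then have "qr y \<le> sqrt A" by (rule real_le_rsqrt)
    then show ?thesis unfolding q_def by (rule ennreal_leI)
  qed
  have [measurable]: "q \<in> borel_measurable borel" unfolding q_def qr_def by measurable
  define Y where "Y = (\<Union>z\<in>Z. ball z (4 * r))"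
  have [measurable]: "Y \<in> sets borel" unfolding Y_def using Z by (intro sets.finite_UN) auto
  \<comment> \<open>All neighbours together carry the weight
    \<open>card V * \<epsilon> = 1/2\<close>, the contraction factor of the iteration.\<close>
  define \<epsilon> where "\<epsilon> = 1 / (2 * real (card V))"
  have cV: "0 < card V" using V by (simp add: card_gt_0_iff)
  have \<epsilon>: "0 < \<epsilon>" "real (card V) * \<epsilon> = 1/2" using cV by (auto simp: \<epsilon>_def)
  have q_decay: "q y \<le> ennreal \<epsilon> * (\<Sum>v\<in>V. q (y + r *\<^sub>R v))" if y: "y \<notin> Y" for y
  proof -
    have "ennreal ((qr y)\<^sup>2) \<le> ennreal (\<epsilon>\<^sup>2) * (\<Sum>v\<in>V. ennreal ((qr (y + r *\<^sub>R v))\<^sup>2))"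
      using decay[of y] y unfolding Qr Y_def \<epsilon>_def by blast
    also have "\<dots> = ennreal (\<epsilon>\<^sup>2 * (\<Sum>v\<in>V. (qr (y + r *\<^sub>R v))\<^sup>2))"
      by (simp add: sum_ennreal ennreal_mult sum_nonneg)
    finally have "(qr y)\<^sup>2 \<le> \<epsilon>\<^sup>2 * (\<Sum>v\<in>V. (qr (y + r *\<^sub>R v))\<^sup>2)"
      by (subst (asm) ennreal_le_iff) (auto intro!: mult_nonneg_nonneg sum_nonneg)
    then have "qr y \<le> sqrt (\<epsilon>\<^sup>2 * (\<Sum>v\<in>V. (qr (y + r *\<^sub>R v))\<^sup>2))" by (rule real_le_rsqrt)
    also have "\<dots> = \<epsilon> * sqrt (\<Sum>v\<in>V. (qr (y + r *\<^sub>R v))\<^sup>2)" using \<epsilon> by (simp add: real_sqrt_mult)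
    also have "\<dots> \<le> \<epsilon> * (\<Sum>v\<in>V. sqrt ((qr (y + r *\<^sub>R v))\<^sup>2))"
      using \<epsilon> V(1) by (intro mult_left_mono sqrt_sum_le) auto
    also have "\<dots> = \<epsilon> * (\<Sum>v\<in>V. qr (y + r *\<^sub>R v))" using qr0 by simp
    finally have "ennreal (qr y) \<le> ennreal (\<epsilon> * (\<Sum>v\<in>V. qr (y + r *\<^sub>R v)))" by (rule ennreal_leI)
    also have "\<dots> = ennreal \<epsilon> * (\<Sum>v\<in>V. q (y + r *\<^sub>R v))"
      using \<epsilon> qr0 by (simp add: q_def sum_ennreal ennreal_mult sum_nonneg)
    finally show ?thesis by (simp add: q_def)
  qed
  define T where "T = (\<integral>\<^sup>+y. q y * indicator Y y \<partial>lborel)"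
  \<comment> \<open>Truncated to a ball, because the integral of \<open>q\<close> over the whole
    space is not yet known to be finite.\<close>
  define S where "S \<rho> = (\<integral>\<^sup>+y. q y * indicator (ball 0 \<rho>) y \<partial>lborel)" for \<rho>
  \<comment> \<open>The neighbours of a point of the ball lie in the ball enlarged by
    \<open>2 * r\<close>, as \<open>norm v \<le> 2\<close>; translation invariance turns each
    neighbour term into the same integral.\<close>
  have S_step: "S \<rho> \<le> T + ennreal (1/2) * S (\<rho> + 2 * r)" for \<rho>
  proof -
    define g where "g y = q y * indicator (ball 0 (\<rho> + 2 * r)) y" for y
    have [measurable]: "g \<in> borel_measurable borel" unfolding g_def by measurable
    have "S \<rho> \<le> (\<integral>\<^sup>+y. q y * indicator Y y + ennreal \<epsilon> * (\<Sum>v\<in>V. g (y + r *\<^sub>R v)) \<partial>lborel)"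
      unfolding S_def
    proof (rule nn_integral_mono)
      fix y :: 'a
      show "q y * indicator (ball 0 \<rho>) y \<le> q y * indicator Y y + ennreal \<epsilon> * (\<Sum>v\<in>V. g (y + r *\<^sub>R v))"
      proof (cases "y \<in> Y \<or> y \<notin> ball 0 \<rho>")
        case True
        then show ?thesis by (auto simp: indicator_def)
      next
        case False
        have "g (y + r *\<^sub>R v) = q (y + r *\<^sub>R v)" if "v \<in> V" for v
        proof -
          have "norm (y + r *\<^sub>R v) \<le> norm y + r * norm v" using norm_triangle_ineq[of y "r *\<^sub>R v"] r by simp
          also have "\<dots> \<le> norm y + r * 2" using V(3)[OF that] r by simp
          also have "\<dots> < \<rho> + 2 * r" using False by (simp add: dist_norm)
          finally show ?thesis by (simp add: g_def)
        qed
        then show ?thesis using False q_decay[of y] by simp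
      qed
    qed
    also have "\<dots> = T + ennreal \<epsilon> * (\<Sum>v\<in>V. \<integral>\<^sup>+y. g (y + r *\<^sub>R v) \<partial>lborel)"
      unfolding T_def by (subst nn_integral_add) (auto simp: nn_integral_cmult nn_integral_sum)
    also have "(\<Sum>v\<in>V. \<integral>\<^sup>+y. g (y + r *\<^sub>R v) \<partial>lborel) = (\<Sum>v\<in>V. S (\<rho> + 2 * r))"
    proof (rule sum.cong)
      show "(\<integral>\<^sup>+y. g (y + r *\<^sub>R v) \<partial>lborel) = S (\<rho> + 2 * r)" for v
        unfolding S_def g_def[symmetric] by (rule nn_integral_lborel_shift) measurable
    qed simp
    also have "ennreal \<epsilon> * (\<Sum>v\<in>V. S (\<rho> + 2 * r)) = ennreal (1/2) * S (\<rho> + 2 * r)"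
    proof -
      have "ennreal \<epsilon> * of_nat (card V) = ennreal (real (card V) * \<epsilon>)"
        using \<epsilon>(1) by (simp add: ennreal_of_nat_eq_real_of_nat ennreal_mult mult.commute)
      then have "ennreal \<epsilon> * of_nat (card V) = ennreal (1/2)" unfolding \<epsilon>(2) .
      then show ?thesis unfolding sum_constant by (metis mult.assoc)
    qed
    finally show ?thesis .
  qed
  have S_iter: "S \<rho> \<le> 2 * T + ennreal ((1/2) ^ n) * S (\<rho> + 2 * r * real n)" for \<rho> n
  proof (induction n arbitrary: \<rho>)
    case 0
    show ?case by simp
  next
    case (Suc n)
    have half: "ennreal (1/2) * (2 * T) = T"
    proof -
      have "ennreal (1/2) * 2 = 1" using ennreal_mult[of "1/2" 2] by simp
      then show ?thesis by (simp add: mult.assoc[symmetric])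
    qed
    have "S \<rho> \<le> T + ennreal (1/2) * S (\<rho> + 2 * r)" by (rule S_step)
    also have "\<dots> \<le> T + ennreal (1/2) * (2 * T + ennreal ((1/2) ^ n) * S (\<rho> + 2 * r + 2 * r * real n))"
      by (intro add_left_mono mult_left_mono Suc.IH) auto
    also have "\<dots> = T + (T + ennreal (1/2) * ennreal ((1/2) ^ n) * S (\<rho> + 2 * r + 2 * r * real n))"
      by (simp only: distrib_left half mult.assoc)
    also have "ennreal (1/2) * ennreal ((1/2) ^ n) = ennreal ((1/2) ^ Suc n)"
      by (subst ennreal_mult[symmetric]) auto
    also have "\<rho> + 2 * r + 2 * r * real n = \<rho> + 2 * r * real (Suc n)" by (simp add: algebra_simps)
    finally show ?case by (simp only: mult_2[of T] add.assoc)
  qed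
  have S_le: "S \<rho> \<le> ennreal (sqrt A * (\<omega> * \<rho> ^ DIM('a)))" if \<rho>: "0 \<le> \<rho>" for \<rho>
  proof -
    have "S \<rho> \<le> (\<integral>\<^sup>+y. ennreal (sqrt A) * indicator (ball (0::'a) \<rho>) y \<partial>lborel)"
      unfolding S_def by (intro nn_integral_mono mult_right_mono q_le) auto
    also have "\<dots> = ennreal (sqrt A) * ennreal (\<omega> * \<rho> ^ DIM('a))"
      using \<rho> by (subst nn_integral_cmult_indicator) (auto simp: vol)
    finally show ?thesis using A(2) \<omega> \<rho> by (simp add: ennreal_mult)
  qed
  \<comment> \<open>The remainder after \<open>n\<close> steps carries the factor
    \<open>(1/2)^n\<close>, whereas \<open>q \<le> sqrt A\<close> lets \<open>S\<close> grow only
    like the volume of a ball of radius linear in \<open>n\<close>.\<close>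
  have S_2T: "S \<rho> \<le> 2 * T" if \<rho>: "0 \<le> \<rho>" for \<rho>
  proof (rule LIMSEQ_le_const)
    define c where "c = \<rho> + 2 * r"
    have c: "0 < c" using \<rho> r by (simp add: c_def)
    define b where "b n = sqrt A * \<omega> * c ^ DIM('a) * ((1/2) ^ n * (real n + 1) ^ DIM('a))" for n
    have "b \<longlonglongrightarrow> 0" unfolding b_def
      using tendsto_mult_right_zero[OF half_power_times_poly_tendsto_0[of "DIM('a)"]] by simp
    then have "(\<lambda>n. 2 * T + ennreal (b n)) \<longlonglongrightarrow> 2 * T + ennreal 0" by (intro tendsto_add tendsto_const tendsto_ennrealI)
    then show "(\<lambda>n. 2 * T + ennreal (b n)) \<longlonglongrightarrow> 2 * T" by simp
    have "S \<rho> \<le> 2 * T + ennreal (b n)" for n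
    proof -
      have "ennreal ((1/2) ^ n) * S (\<rho> + 2 * r * real n) \<le> ennreal ((1/2) ^ n) * ennreal (sqrt A * (\<omega> * (\<rho> + 2 * r * real n) ^ DIM('a)))"
        using \<rho> r by (intro mult_left_mono S_le) auto
      also have "\<dots> = ennreal ((1/2) ^ n * (sqrt A * (\<omega> * (\<rho> + 2 * r * real n) ^ DIM('a))))"
        using A(2) \<omega> \<rho> r by (intro ennreal_mult[symmetric]) auto
      also have "\<dots> \<le> ennreal (b n)"
      proof (rule ennreal_leI)
        have "\<rho> + 2 * r * real n \<le> c * (real n + 1)" using \<rho> r by (simp add: c_def algebra_simps)
        then have "(\<rho> + 2 * r * real n) ^ DIM('a) \<le> (c * (real n + 1)) ^ DIM('a)" using \<rho> r by (intro power_mono) auto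
        then have "(1/2) ^ n * (sqrt A * (\<omega> * (\<rho> + 2 * r * real n) ^ DIM('a))) \<le> (1/2) ^ n * (sqrt A * (\<omega> * (c * (real n + 1)) ^ DIM('a)))"
          using A(2) \<omega> by (intro mult_left_mono) auto
        then show "(1/2) ^ n * (sqrt A * (\<omega> * (\<rho> + 2 * r * real n) ^ DIM('a))) \<le> b n"
          by (simp add: b_def power_mult_distrib mult_ac)
      qed
      finally show ?thesis using S_iter[of \<rho> n] by (meson add_left_mono order_trans)
    qed
    then show "\<exists>N. \<forall>n\<ge>N. S \<rho> \<le> 2 * T + ennreal (b n)" by blast
  qed
  \<comment> \<open>Exhaustion of the space by balls, through Fatou's lemma.\<close>
  have q_int: "(\<integral>\<^sup>+y. q y \<partial>lborel) \<le> 2 * T"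
  proof -
    have "(\<lambda>n. q y * indicator (ball 0 (real n)) y) \<longlonglongrightarrow> q y" for y :: 'a
    proof (rule tendsto_eventually)
      obtain N :: nat where N: "norm y < real N" using reals_Archimedean2 by blast
      show "\<forall>\<^sub>F n in sequentially. q y * indicator (ball 0 (real n)) y = q y"
        by (rule eventually_sequentiallyI[of N]) (use N in \<open>auto simp: dist_norm indicator_def\<close>)
    qed
    then have "(\<integral>\<^sup>+y. q y \<partial>lborel) = (\<integral>\<^sup>+y. liminf (\<lambda>n. q y * indicator (ball 0 (real n)) y) \<partial>lborel)"
      by (intro nn_integral_cong) (metis lim_imp_Liminf trivial_limit_sequentially)
    also have "\<dots> \<le> liminf (\<lambda>n. S (real n))" unfolding S_def by (rule nn_integral_liminf) measurable
    also have "\<dots> \<le> limsup (\<lambda>n. S (real n))" by (rule Liminf_le_Limsup) simp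
    also have "\<dots> \<le> 2 * T" by (intro Limsup_bounded always_eventually) (use S_2T in auto)
    finally show ?thesis .
  qed
  have Y_vol: "emeasure lborel Y \<le> ennreal (real (card Z) * (\<omega> * (4 * r) ^ DIM('a)))"
  proof -
    have "emeasure lborel Y \<le> (\<Sum>z\<in>Z. emeasure lborel (ball z (4 * r)))"
      unfolding Y_def using Z by (intro emeasure_subadditive_finite) auto
    also have "\<dots> = ennreal (real (card Z) * (\<omega> * (4 * r) ^ DIM('a)))"
      using r \<omega> by (simp add: vol ennreal_mult ennreal_of_nat_eq_real_of_nat)
    finally show ?thesis .
  qed
  have Q_int: "(\<integral>\<^sup>+y. Q y \<partial>lborel) = ennreal (m * A)"
  proof -
    have "(\<integral>\<^sup>+y. Q y \<partial>lborel) = (\<integral>\<^sup>+y. \<integral>\<^sup>+x. ennreal ((F x)\<^sup>2) * k y x \<partial>lborel \<partial>lborel)" unfolding Qk ..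
    also have "\<dots> = (\<integral>\<^sup>+x. \<integral>\<^sup>+y. ennreal ((F x)\<^sup>2) * k y x \<partial>lborel \<partial>lborel)"
      by (rule lborel_pair.Fubini') measurable
    also have "\<dots> = (\<integral>\<^sup>+x. ennreal ((F x)\<^sup>2) * ennreal m \<partial>lborel)"
    proof (rule nn_integral_cong)
      fix x
      have [measurable]: "(\<lambda>y. k y x) \<in> borel_measurable borel" unfolding k_def by measurable
      show "(\<integral>\<^sup>+y. ennreal ((F x)\<^sup>2) * k y x \<partial>lborel) = ennreal ((F x)\<^sup>2) * ennreal m"
        by (subst nn_integral_cmult) (auto simp: k_vol m_def)
    qed
    also have "\<dots> = ennreal (m * A)"
      using m A(2) by (subst nn_integral_multc) (auto simp: A(1) mult.commute simp flip: ennreal_mult)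
    finally show ?thesis .
  qed
  have T_sq: "T\<^sup>2 \<le> ennreal (m * A * (real (card Z) * (\<omega> * (4 * r) ^ DIM('a))))"
  proof -
    have "T\<^sup>2 \<le> (\<integral>\<^sup>+y. (q y)\<^sup>2 \<partial>lborel) * (\<integral>\<^sup>+y. (indicator Y y)\<^sup>2 \<partial>lborel)"
      unfolding T_def by (rule Cauchy_Schwarz_nn_integral) measurable
    also have "(\<integral>\<^sup>+y. (indicator Y y :: ennreal)\<^sup>2 \<partial>lborel) = emeasure lborel Y"
    proof -
      have "(indicator Y y :: ennreal)\<^sup>2 = indicator Y y" for y by (simp add: indicator_def)
      then show ?thesis by simp
    qed
    also have "(\<integral>\<^sup>+y. (q y)\<^sup>2 \<partial>lborel) = ennreal (m * A)" by (simp add: qQ Q_int)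
    also have "ennreal (m * A) * emeasure lborel Y \<le> ennreal (m * A) * ennreal (real (card Z) * (\<omega> * (4 * r) ^ DIM('a)))"
      by (intro mult_left_mono Y_vol) auto
    also have "\<dots> = ennreal (m * A * (real (card Z) * (\<omega> * (4 * r) ^ DIM('a))))"
      using m A(2) \<omega> r by (intro ennreal_mult[symmetric]) auto
    finally show ?thesis .
  qed
  define I where "I = (\<integral>\<^sup>+x. ennreal (F x) \<partial>lborel)"
  have "ennreal m * I \<le> ennreal (sqrt m) * (2 * T)"
  proof -
    have "ennreal m * I = (\<integral>\<^sup>+x. ennreal (F x) * ennreal m \<partial>lborel)"
      unfolding I_def by (subst nn_integral_multc) (auto simp: mult.commute)
    also have "\<dots> = (\<integral>\<^sup>+x. \<integral>\<^sup>+y. ennreal (F x) * k y x \<partial>lborel \<partial>lborel)"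
    proof (rule nn_integral_cong)
      fix x
      have [measurable]: "(\<lambda>y. k y x) \<in> borel_measurable borel" unfolding k_def by measurable
      show "ennreal (F x) * ennreal m = (\<integral>\<^sup>+y. ennreal (F x) * k y x \<partial>lborel)"
        by (subst nn_integral_cmult) (auto simp: k_vol m_def)
    qed
    also have "\<dots> = (\<integral>\<^sup>+y. \<integral>\<^sup>+x. ennreal (F x) * k y x \<partial>lborel \<partial>lborel)"
      by (rule lborel_pair.Fubini'[symmetric]) measurable
    also have "\<dots> \<le> (\<integral>\<^sup>+y. ennreal (sqrt m) * q y \<partial>lborel)"
    proof (rule nn_integral_mono)
      fix y
      have k2: "k y x * k y x = k y x" "(k y x)\<^sup>2 = k y x" for x by (auto simp: k_def)
      have "(\<integral>\<^sup>+x. ennreal (F x) * k y x \<partial>lborel)\<^sup>2 = (\<integral>\<^sup>+x. (ennreal (F x) * k y x) * k y x \<partial>lborel)\<^sup>2"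
        by (simp add: mult.assoc k2)
      also have "\<dots> \<le> (\<integral>\<^sup>+x. (ennreal (F x) * k y x)\<^sup>2 \<partial>lborel) * (\<integral>\<^sup>+x. (k y x)\<^sup>2 \<partial>lborel)"
        by (rule Cauchy_Schwarz_nn_integral) measurable
      also have "\<dots> = Q y * ennreal m"
        using F0 by (simp add: power_mult_distrib k2 k_vol Qk m_def ennreal_power)
      also have "\<dots> = (ennreal (sqrt m) * q y)\<^sup>2"
        using m by (simp add: power_mult_distrib qQ ennreal_power mult.commute)
      finally show "(\<integral>\<^sup>+x. ennreal (F x) * k y x \<partial>lborel) \<le> ennreal (sqrt m) * q y"
        by (rule ennreal_power2_le_imp_le)
    qed
    also have "\<dots> = ennreal (sqrt m) * (\<integral>\<^sup>+y. q y \<partial>lborel)" by (subst nn_integral_cmult) auto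
    also have "\<dots> \<le> ennreal (sqrt m) * (2 * T)" by (intro mult_left_mono q_int) auto
    finally show ?thesis .
  qed
  then have "(ennreal m * I)\<^sup>2 \<le> (ennreal (sqrt m) * (2 * T))\<^sup>2" by (intro power_mono) auto
  also have "\<dots> = ennreal m * (4 * T\<^sup>2)" using m by (simp add: power_mult_distrib ennreal_power)
  also have "\<dots> \<le> ennreal m * (4 * ennreal (m * A * (real (card Z) * (\<omega> * (4 * r) ^ DIM('a)))))"
    by (intro mult_left_mono T_sq) auto
  also have "\<dots> = ennreal (m\<^sup>2) * ennreal (4 * (real (card Z) * (\<omega> * (4 * r) ^ DIM('a))) * A)"
  proof -
    define W where "W = m * A * (real (card Z) * (\<omega> * (4 * r) ^ DIM('a)))"
    have W: "0 \<le> W" using m A(2) \<omega> r by (simp add: W_def)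
    have "4 * ennreal W = ennreal (4 * W)" using W by (subst ennreal_mult) auto
    moreover have "ennreal m * ennreal (4 * W) = ennreal (m * (4 * W))"
      using m W by (intro ennreal_mult[symmetric]) auto
    ultimately have "ennreal m * (4 * ennreal (m * A * (real (card Z) * (\<omega> * (4 * r) ^ DIM('a)))))
        = ennreal (m * (4 * (m * A * (real (card Z) * (\<omega> * (4 * r) ^ DIM('a))))))"
      by (simp only: W_def)
    also have "\<dots> = ennreal (m\<^sup>2 * (4 * (real (card Z) * (\<omega> * (4 * r) ^ DIM('a))) * A))"
      by (simp add: power2_eq_square mult_ac)
    also have "\<dots> = ennreal (m\<^sup>2) * ennreal (4 * (real (card Z) * (\<omega> * (4 * r) ^ DIM('a))) * A)"
      using A(2) \<omega> r by (intro ennreal_mult) auto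
    finally show ?thesis .
  qed
  finally have "ennreal (m\<^sup>2) * I\<^sup>2 \<le> ennreal (m\<^sup>2) * ennreal (4 * (real (card Z) * (\<omega> * (4 * r) ^ DIM('a))) * A)"
    using m by (simp add: power_mult_distrib ennreal_power)
  then have "I\<^sup>2 \<le> ennreal (4 * (real (card Z) * (\<omega> * (4 * r) ^ DIM('a))) * A)"
    using m by (subst (asm) ennreal_mult_le_mult_iff) auto
  then show ?thesis by (simp add: I_def \<omega>_def)
qed

section \<open>The \<open>L\<^sub>1\<close> bound for eigenfunctions\<close>

text \<open>Fubini and translations are applied to Borel functions on the whole space.
  \<open>F\<close> represents the modulus of \<open>u\<close> extended by 0, and
  \<open>f 0 = 0\<close> keeps the extension invisible to the integrals.\<close>

lemma borel_representative:
  fixes \<Omega> :: "'a::euclidean_space set"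
  assumes \<Omega>: "\<Omega> \<in> sets lebesgue" and u: "u \<in> borel_measurable (lebesgue_on \<Omega>)"
  obtains F :: "'a \<Rightarrow> real" where "F \<in> borel_measurable borel" "\<And>x. 0 \<le> F x"
    "\<And>(f :: real \<Rightarrow> real) w. f 0 = 0 \<Longrightarrow>
      (\<integral>\<^sup>+x. ennreal (f (F x)) * w x \<partial>lborel) = (\<integral>\<^sup>+x. ennreal (f (cmod (u x))) * w x \<partial>lebesgue_on \<Omega>)"
proof -
  define g where "g x = indicator \<Omega> x *\<^sub>R cmod (u x)" for x
  have "g \<in> borel_measurable lebesgue"
    unfolding g_def using u \<Omega> by (subst borel_measurable_restrict_space_iff[symmetric]) auto
  then obtain G where G: "G \<in> borel_measurable lborel" "AE x in lborel. g x = G x"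
    using completion_ex_borel_measurable_real by blast
  show ?thesis
  proof (rule that[of "\<lambda>x. \<bar>G x\<bar>"])
    show "(\<lambda>x. \<bar>G x\<bar>) \<in> borel_measurable borel" using G(1) by simp
    fix f :: "real \<Rightarrow> real" and w assume f: "f 0 = 0"
    have "(\<integral>\<^sup>+x. ennreal (f \<bar>G x\<bar>) * w x \<partial>lborel) = (\<integral>\<^sup>+x. ennreal (f (g x)) * w x \<partial>lborel)"
    proof (rule nn_integral_cong_AE, use G(2) in eventually_elim)
      fix x assume *: "g x = G x"
      have "0 \<le> g x" by (simp add: g_def)
      then show "ennreal (f \<bar>G x\<bar>) * w x = ennreal (f (g x)) * w x" unfolding * by simp
    qed
    also have "\<dots> = (\<integral>\<^sup>+x. ennreal (f (g x)) * w x \<partial>lebesgue)" by (rule nn_integral_completion[symmetric])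
    also have "\<dots> = (\<integral>\<^sup>+x. ennreal (f (cmod (u x))) * w x * indicator \<Omega> x \<partial>lebesgue)"
      by (intro nn_integral_cong) (auto simp: g_def indicator_def f)
    also have "\<dots> = (\<integral>\<^sup>+x. ennreal (f (cmod (u x))) * w x \<partial>lebesgue_on \<Omega>)"
      using \<Omega> by (intro nn_integral_restrict_space[symmetric]) simp
    finally show "(\<integral>\<^sup>+x. ennreal (f \<bar>G x\<bar>) * w x \<partial>lborel) = (\<integral>\<^sup>+x. ennreal (f (cmod (u x))) * w x \<partial>lebesgue_on \<Omega>)" .
  qed simp
qed

text \<open>Cardinalities are bounded by \<open>N\<close>, so a separated set with the most elements
  exists; a point of \<open>B\<close> outside its balls could be added to it.\<close>

lemma maximal_separated_set:
  fixes B :: "'a::metric_space set"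
  assumes \<delta>: "0 < \<delta>" and card: "\<And>Z. \<lbrakk>finite Z; Z \<subseteq> B; \<And>y z. \<lbrakk>y \<in> Z; z \<in> Z; y \<noteq> z\<rbrakk> \<Longrightarrow> \<delta> \<le> dist y z\<rbrakk> \<Longrightarrow> card Z \<le> N"
  obtains Z where "finite Z" "card Z \<le> N" "B \<subseteq> (\<Union>z\<in>Z. ball z \<delta>)"
proof -
  define P where "P Z \<longleftrightarrow> finite Z \<and> Z \<subseteq> B \<and> (\<forall>y\<in>Z. \<forall>z\<in>Z. y \<noteq> z \<longrightarrow> \<delta> \<le> dist y z)" for Z
  have "P {}" by (simp add: P_def)
  moreover have "\<forall>Z. P Z \<longrightarrow> card Z < Suc N" using card by (auto simp: P_def less_Suc_eq_le)
  ultimately obtain Z where Z: "P Z" "\<And>Z'. P Z' \<Longrightarrow> card Z' \<le> card Z"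
    using ex_has_greatest_nat[of P "{}" card "Suc N"] by blast
  have "B \<subseteq> (\<Union>z\<in>Z. ball z \<delta>)"
  proof
    fix y assume y: "y \<in> B"
    show "y \<in> (\<Union>z\<in>Z. ball z \<delta>)"
    proof (rule ccontr)
      assume *: "y \<notin> (\<Union>z\<in>Z. ball z \<delta>)"
      then have far: "\<delta> \<le> dist z y" if "z \<in> Z" for z using that by auto
      then have False: "y \<notin> Z" using \<delta> by force
      then have "P (insert y Z)" using Z(1) y far by (auto simp: P_def dist_commute)
      then have "card (insert y Z) \<le> card Z" by (rule Z(2))
      then show False using False Z(1) by (simp add: P_def)
    qed
  qed
  then show ?thesis using that Z(1) card[of Z] by (auto simp: P_def)
qed

lemma (in discrete_domain) eigenfunction_L1_bound:
  fixes V :: "'a set"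
  assumes u: "dirichlet_laplacian \<Omega> u (\<lambda>x. complex_of_real \<mu> * u x)" and \<mu>: "0 < \<mu>" and \<theta>: "0 < \<theta>"
    and V: "finite V" "V \<noteq> {}" "\<And>v. v \<in> V \<Longrightarrow> norm v \<le> 2" "ball 0 2 \<subseteq> (\<Union>v\<in>V. ball v 1)"
    and r_def: "r = sqrt (192 / (\<theta> * \<mu>)) * real (card V)"
  shows "(Lp_norm 1 \<Omega> u)\<^sup>2
    \<le> ennreal (4 * (real (eigenvalue_count \<Omega> ((1 + \<theta>) * \<mu>)) * (unit_ball_vol (real DIM('a)) * (4 * r) ^ DIM('a)))) * (Lp_norm 2 \<Omega> u)\<^sup>2"
proof -
  define N where "N = eigenvalue_count \<Omega> ((1 + \<theta>) * \<mu>)"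
  have \<Omega>s: "\<Omega> \<in> sets lebesgue" using \<Omega> by auto
  have uL: "u \<in> L2 \<Omega>" using u H01_L2[OF \<Omega>] by (simp add: dirichlet_laplacian_def)
  then have um [measurable]: "u \<in> borel_measurable (lebesgue_on \<Omega>)" by (rule L2_measurable)
  have cV: "0 < card V" using V by (simp add: card_gt_0_iff)
  have r: "0 < r" using cV \<theta> \<mu> by (simp add: r_def)
  \<comment> \<open>The 48 is 3 from \<open>bump_sq_ge\<close> times 16 from
    \<open>bump_gradient\<close>. The 192 in \<open>r\<close> is 4 times 48, which gives exactly the
    weight demanded by \<open>L1_bound_of_local_decay\<close>.\<close>
  have r_sq: "48 / (\<theta> * \<mu> * r\<^sup>2) = (1 / (2 * real (card V)))\<^sup>2"
    using cV \<theta> \<mu> by (simp add: r_def power_mult_distrib power_divide field_simps)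
  \<comment> \<open>Centres where the localised function has energy below
    \<open>1 + \<theta>\<close> times \<open>\<mu>\<close>. Separated subsets have at most
    \<open>N\<close> elements, so at most \<open>N\<close> balls of radius \<open>4 * r\<close>
    cover \<open>B\<close>.\<close>
  define B where "B = {y. (LINT x|lebesgue_on \<Omega>. bump_grad r y x * (cmod (u x))\<^sup>2)
        < \<theta> * \<mu> * (LINT x|lebesgue_on \<Omega>. (bump r y x)\<^sup>2 * (cmod (u x))\<^sup>2)}"
  obtain Z where Z: "finite Z" "card Z \<le> N" "B \<subseteq> (\<Union>z\<in>Z. ball z (4 * r))"
  proof (rule maximal_separated_set[where B = B and \<delta> = "4 * r" and N = N])
    fix Z assume "finite Z" "Z \<subseteq> B" "\<And>y z. \<lbrakk>y \<in> Z; z \<in> Z; y \<noteq> z\<rbrakk> \<Longrightarrow> 4 * r \<le> dist y z"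
    then show "card Z \<le> N" unfolding N_def
      by (intro separated_low_energy_count[OF r u]) (auto simp: B_def)
  qed (use r in auto)
  obtain F :: "'a \<Rightarrow> real" where F: "F \<in> borel_measurable borel" "\<And>x. 0 \<le> F x"
    "\<And>(f :: real \<Rightarrow> real) w. f 0 = 0 \<Longrightarrow>
      (\<integral>\<^sup>+x. ennreal (f (F x)) * w x \<partial>lborel) = (\<integral>\<^sup>+x. ennreal (f (cmod (u x))) * w x \<partial>lebesgue_on \<Omega>)"
    using borel_representative[OF \<Omega>s um] by blast
  define Q where "Q y = (\<integral>\<^sup>+x. ennreal ((F x)\<^sup>2) * indicator (ball y r) x \<partial>lborel)" for y
  have Q\<Omega>: "Q y = (\<integral>\<^sup>+x. ennreal ((cmod (u x))\<^sup>2) * indicator (ball y r) x \<partial>lebesgue_on \<Omega>)" for y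
    unfolding Q_def using F(3)[of "\<lambda>t. t\<^sup>2"] by simp
  define A where "A = (LINT x|lebesgue_on \<Omega>. (cmod (u x))\<^sup>2)"
  have A0: "0 \<le> A" by (simp add: A_def Bochner_Integration.integral_nonneg)
  have uA: "sq_int \<Omega> u = ennreal A" unfolding A_def by (rule L2_sq_int[OF uL])
  have FA: "(\<integral>\<^sup>+x. ennreal ((F x)\<^sup>2) \<partial>lborel) = ennreal A"
    using F(3)[of "\<lambda>t. t\<^sup>2" "\<lambda>_. 1"] uA by (simp add: sq_int_def)
  have bm [measurable]: "(\<lambda>x. bump r y x) \<in> borel_measurable (lebesgue_on \<Omega>)" for y
  proof -
    have "(\<lambda>x. Re (complex_of_real (bump r y x))) \<in> borel_measurable (lebesgue_on \<Omega>)"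
      using smooth_measurable[OF smooth_bump_gen] by measurable
    then show ?thesis by simp
  qed
  have gm [measurable]: "(\<lambda>x. bump_grad r y x) \<in> borel_measurable (lebesgue_on \<Omega>)" for y
  proof -
    have "(\<lambda>x. cmod (partial_deriv i (\<lambda>x. complex_of_real (bump r y x)) x)) \<in> borel_measurable (lebesgue_on \<Omega>)"
      if "i \<in> Basis" for i
      using smooth_measurable[OF smooth_partial_deriv[OF smooth_bump_gen that]] by measurable
    then show ?thesis unfolding bump_grad_def by (intro borel_measurable_sum borel_measurable_power)
  qed
  have im [measurable]: "(\<lambda>x. indicator (ball y s) x :: ennreal) \<in> borel_measurable (lebesgue_on \<Omega>)" for y :: 'a and s
    by (intro measurable_restrict_space1 measurable_completion borel_measurable_indicator) simp
  have u2: "integrable (lebesgue_on \<Omega>) (\<lambda>x. (cmod (u x))\<^sup>2)" using uL by (simp add: L2_iff)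
  have b_le: "(bump r y x)\<^sup>2 * (cmod (u x))\<^sup>2 \<le> (cmod (u x))\<^sup>2" for y x
    using bump_nonneg[of r y x] bump_le_1[of r y x] by (intro mult_left_le_one_le power_le_one) auto
  have b_int: "integrable (lebesgue_on \<Omega>) (\<lambda>x. (bump r y x)\<^sup>2 * (cmod (u x))\<^sup>2)" for y
    by (rule Bochner_Integration.integrable_bound[OF u2]) (use b_le in auto)
  have g_le: "bump_grad r y x * (cmod (u x))\<^sup>2 \<le> 16 / r\<^sup>2 * (cmod (u x))\<^sup>2" for y x
  proof (intro mult_right_mono)
    have "16 / r\<^sup>2 * indicator (ball y (2 * r)) x \<le> 16 / r\<^sup>2 * 1" by (intro mult_left_mono) (auto simp: indicator_def)
    then show "bump_grad r y x \<le> 16 / r\<^sup>2" using bump_grad_le[OF r, of y x] by linarith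
  qed simp
  have g_int: "integrable (lebesgue_on \<Omega>) (\<lambda>x. bump_grad r y x * (cmod (u x))\<^sup>2)" for y
    by (rule Bochner_Integration.integrable_bound[OF integrable_mult_right[OF u2, of "16 / r\<^sup>2"]])
      (use g_le in \<open>auto simp: abs_mult abs_of_nonneg[OF bump_grad_nonneg]\<close>)
  \<comment> \<open>Such a \<open>y\<close> lies outside \<open>B\<close>, so
    \<open>Q y / 3 \<le> I1 \<le> I2 / (\<theta> * \<mu>)\<close>. The gradient bound estimates
    \<open>I2\<close> by \<open>16 / r^2\<close> times the mass in the ball of radius
    \<open>2 * r\<close>, which is covered by the balls of radius \<open>r\<close> around the points
    \<open>y + r v\<close>.\<close>
  have decay: "Q y \<le> ennreal ((1 / (2 * real (card V)))\<^sup>2) * (\<Sum>v\<in>V. Q (y + r *\<^sub>R v))"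
    if y: "y \<notin> (\<Union>z\<in>Z. ball z (4 * r))" for y
  proof -
    define I1 where "I1 = (LINT x|lebesgue_on \<Omega>. (bump r y x)\<^sup>2 * (cmod (u x))\<^sup>2)"
    define I2 where "I2 = (LINT x|lebesgue_on \<Omega>. bump_grad r y x * (cmod (u x))\<^sup>2)"
    have le: "\<theta> * \<mu> * I1 \<le> I2"
    proof -
      have "y \<notin> B" using y Z(3) by blast
      then show ?thesis by (simp add: B_def I1_def I2_def)
    qed
    have I1: "ennreal I1 = (\<integral>\<^sup>+x. ennreal ((bump r y x)\<^sup>2 * (cmod (u x))\<^sup>2) \<partial>lebesgue_on \<Omega>)"
      unfolding I1_def using b_int by (intro nn_integral_eq_integral[symmetric]) auto
    have I2: "ennreal I2 = (\<integral>\<^sup>+x. ennreal (bump_grad r y x * (cmod (u x))\<^sup>2) \<partial>lebesgue_on \<Omega>)"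
      unfolding I2_def using g_int
      by (intro nn_integral_eq_integral[symmetric]) (auto simp: bump_grad_nonneg)
    have "ennreal (1/3) * Q y = (\<integral>\<^sup>+x. ennreal (1/3) * (ennreal ((cmod (u x))\<^sup>2) * indicator (ball y r) x) \<partial>lebesgue_on \<Omega>)"
      unfolding Q\<Omega> by (rule nn_integral_cmult[symmetric]) measurable
    also have "\<dots> \<le> ennreal I1" unfolding I1
    proof (rule nn_integral_mono)
      fix x
      show "ennreal (1/3) * (ennreal ((cmod (u x))\<^sup>2) * indicator (ball y r) x) \<le> ennreal ((bump r y x)\<^sup>2 * (cmod (u x))\<^sup>2)"
      proof (cases "x \<in> ball y r")
        case True
        have "ennreal (1/3) * ennreal ((cmod (u x))\<^sup>2) = ennreal (1/3 * (cmod (u x))\<^sup>2)"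
          by (intro ennreal_mult[symmetric]) auto
        also have "\<dots> \<le> ennreal ((bump r y x)\<^sup>2 * (cmod (u x))\<^sup>2)"
          using bump_sq_ge[OF r True] by (intro ennreal_leI mult_right_mono) auto
        finally show ?thesis using True by (simp only: indicator_simps mult_1_right)
      qed simp
    qed
    finally have Q1: "ennreal (1/3) * Q y \<le> ennreal I1" .
    have cover: "indicator (ball y (2 * r)) x \<le> (\<Sum>v\<in>V. indicator (ball (y + r *\<^sub>R v) r) x :: ennreal)" for x
    proof (cases "x \<in> ball y (2 * r)")
      case True
      have "norm ((1 / r) *\<^sub>R (x - y)) = norm (x - y) / r" using r by simp
      also have "\<dots> < 2" using True r by (simp add: dist_norm norm_minus_commute field_simps)
      finally have "(1 / r) *\<^sub>R (x - y) \<in> ball 0 2" by (simp only: mem_ball_0)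
      then have "(1 / r) *\<^sub>R (x - y) \<in> (\<Union>v\<in>V. ball v 1)" using V(4) by blast
      then obtain v where v: "v \<in> V" "norm ((1 / r) *\<^sub>R (x - y) - v) < 1" by (auto simp: dist_norm norm_minus_commute)
      have "x - (y + r *\<^sub>R v) = r *\<^sub>R ((1 / r) *\<^sub>R (x - y) - v)" using r by (simp add: algebra_simps)
      then have "norm (x - (y + r *\<^sub>R v)) < r" using v(2) r by simp
      then have "x \<in> ball (y + r *\<^sub>R v) r" by (simp add: dist_norm norm_minus_commute)
      then have "(1::ennreal) = indicator (ball (y + r *\<^sub>R v) r) x" by simp
      also have "\<dots> \<le> (\<Sum>v\<in>V. indicator (ball (y + r *\<^sub>R v) r) x)"
        using v(1) V(1) by (intro member_le_sum[of v V "\<lambda>v. indicator (ball (y + r *\<^sub>R v) r) x"]) auto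
      finally show ?thesis using True by simp
    qed simp
    have "ennreal I2 \<le> (\<integral>\<^sup>+x. ennreal (16 / r\<^sup>2) * (\<Sum>v\<in>V. ennreal ((cmod (u x))\<^sup>2) * indicator (ball (y + r *\<^sub>R v) r) x) \<partial>lebesgue_on \<Omega>)"
      unfolding I2
    proof (rule nn_integral_mono)
      fix x
      have "ennreal (bump_grad r y x * (cmod (u x))\<^sup>2) \<le> ennreal (16 / r\<^sup>2 * indicator (ball y (2 * r)) x * (cmod (u x))\<^sup>2)"
        using bump_grad_le[OF r, of y x] by (intro ennreal_leI mult_right_mono) auto
      also have "\<dots> = ennreal (16 / r\<^sup>2) * (ennreal ((cmod (u x))\<^sup>2) * indicator (ball y (2 * r)) x)"
        by (cases "x \<in> ball y (2 * r)") (auto simp flip: ennreal_mult)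
      also have "\<dots> \<le> ennreal (16 / r\<^sup>2) * (ennreal ((cmod (u x))\<^sup>2) * (\<Sum>v\<in>V. indicator (ball (y + r *\<^sub>R v) r) x))"
        by (intro mult_left_mono cover) auto
      finally show "ennreal (bump_grad r y x * (cmod (u x))\<^sup>2)
          \<le> ennreal (16 / r\<^sup>2) * (\<Sum>v\<in>V. ennreal ((cmod (u x))\<^sup>2) * indicator (ball (y + r *\<^sub>R v) r) x)"
        by (simp add: sum_distrib_left)
    qed
    also have "\<dots> = ennreal (16 / r\<^sup>2) * (\<Sum>v\<in>V. Q (y + r *\<^sub>R v))"
      unfolding Q\<Omega> by (subst nn_integral_cmult) (auto simp: nn_integral_sum)
    finally have Q2: "ennreal I2 \<le> ennreal (16 / r\<^sup>2) * (\<Sum>v\<in>V. Q (y + r *\<^sub>R v))" .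
    define c where "c = 3 / (\<theta> * \<mu>)"
    have c: "0 < c" using \<theta> \<mu> by (simp add: c_def)
    have "Q y = ennreal 3 * (ennreal (1/3) * Q y)"
    proof -
      have "ennreal 3 * ennreal (1/3) = 1" by (subst ennreal_mult[symmetric]) auto
      then show ?thesis by (metis mult.assoc mult_1)
    qed
    also have "\<dots> \<le> ennreal 3 * ennreal I1" using Q1 by (intro mult_left_mono) auto
    also have "\<dots> = ennreal (3 * I1)" by (intro ennreal_mult'[symmetric]) simp
    also have "\<dots> \<le> ennreal (c * I2)"
      using le \<theta> \<mu> by (intro ennreal_leI) (simp add: c_def field_simps)
    also have "\<dots> = ennreal c * ennreal I2" using c by (intro ennreal_mult') auto
    also have "\<dots> \<le> ennreal c * (ennreal (16 / r\<^sup>2) * (\<Sum>v\<in>V. Q (y + r *\<^sub>R v)))" by (intro mult_left_mono Q2) auto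
    also have "\<dots> = ennreal (c * (16 / r\<^sup>2)) * (\<Sum>v\<in>V. Q (y + r *\<^sub>R v))"
      using c by (subst ennreal_mult) (auto simp: mult.assoc)
    also have "c * (16 / r\<^sup>2) = (1 / (2 * real (card V)))\<^sup>2" unfolding r_sq[symmetric] by (simp add: c_def)
    finally show ?thesis .
  qed
  have "(\<integral>\<^sup>+x. ennreal (F x) \<partial>lborel)\<^sup>2
      \<le> ennreal (4 * (real (card Z) * (unit_ball_vol (real DIM('a)) * (4 * r) ^ DIM('a))) * A)"
    by (rule L1_bound_of_local_decay[OF F(1,2) FA A0 r V(1-3) Z(1) Q_def decay])
  also have "\<dots> \<le> ennreal (4 * (real N * (unit_ball_vol (real DIM('a)) * (4 * r) ^ DIM('a))) * A)"
    using Z(2) A0 r by (intro ennreal_leI mult_right_mono mult_left_mono) auto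
  also have "\<dots> = ennreal (4 * (real N * (unit_ball_vol (real DIM('a)) * (4 * r) ^ DIM('a)))) * ennreal A"
    using A0 by (intro ennreal_mult'') auto
  also have "ennreal A = (Lp_norm 2 \<Omega> u)\<^sup>2" by (simp add: Lp_norm_2_sq uA)
  also have "(\<integral>\<^sup>+x. ennreal (F x) \<partial>lborel) = Lp_norm 1 \<Omega> u"
    using F(3)[of "\<lambda>t. t" "\<lambda>_. 1"] by (simp add: Lp_norm_1)
  finally show ?thesis by (simp add: N_def)
qed

text \<open>The extra powers of \<open>1 / \<theta>\<close> and \<open>l / l1\<close> only enlarge
  the right-hand side. For \<open>N \<ge> 2\<close> the logarithm is at least \<open>ln 2\<close>,
  and the first summand suffices at the price of \<open>1 / ln 2 ^ d\<close>. For
  \<open>N \<le> 1\<close> the logarithm gives nothing, and the second summand takes over; any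
  exponent \<open>m\<close> will do.\<close>

lemma count_factor_le:
  fixes \<theta> l l1 :: real and N d m :: nat
  assumes \<theta>: "0 < \<theta>" "\<theta> \<le> 1" and l: "0 < l1" "l1 \<le> l"
  shows "real N * (1 / sqrt (\<theta> * l)) ^ d \<le> (1 + 1 / ln 2 ^ d) * (l1 powr (- (real d / 2)) *
     (\<theta> powr (- real d) * (l / l1) ^ d * ln (real N) ^ d * real N + \<theta> powr (- (4 * real d)) * (l / l1) ^ m))"
proof -
  have pw: "(1 / sqrt t) ^ d = t powr (- (real d / 2))" if "0 < t" for t :: real
  proof -
    have "(1 / sqrt t) ^ d = (t powr (- (1/2))) powr (real d)"
      using that by (simp add: powr_realpow powr_minus_divide powr_half_sqrt)
    then show ?thesis by (simp add: powr_powr)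
  qed
  have "(1 / sqrt (\<theta> * l)) ^ d = \<theta> powr (- (real d / 2)) * l powr (- (real d / 2))"
    using \<theta> l by (simp add: pw powr_mult)
  also have "\<dots> \<le> \<theta> powr (- real d) * l1 powr (- (real d / 2))"
    using \<theta> l by (intro mult_mono powr_mono' powr_mono2') auto
  finally have base: "(1 / sqrt (\<theta> * l)) ^ d \<le> \<theta> powr (- real d) * l1 powr (- (real d / 2))" .
  have \<rho>: "1 \<le> (l / l1) ^ j" for j using l by (intro one_le_power) (simp add: field_simps)
  have ln2: "0 < ln (2::real) ^ d" by simp
  define X where "X = \<theta> powr (- real d) * (l / l1) ^ d * ln (real N) ^ d * real N"
  define Y where "Y = \<theta> powr (- (4 * real d)) * (l / l1) ^ m"
  have lnN: "0 \<le> ln (real N) ^ d" by (cases "N = 0") auto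
  have X0: "0 \<le> X" using \<theta> l lnN by (simp add: X_def)
  have Y0: "0 \<le> Y" using \<theta> l by (simp add: Y_def)
  have "\<theta> powr (- real d) * real N \<le> (1 + 1 / ln 2 ^ d) * (X + Y)"
  proof (cases "2 \<le> N")
    case True
    have "ln 2 ^ d \<le> ln (real N) ^ d" using True by (intro power_mono) auto
    then have "1 \<le> 1 / ln 2 ^ d * ln (real N) ^ d" using ln2 by (simp add: field_simps)
    then have "\<theta> powr (- real d) * real N * (1 * 1) \<le> \<theta> powr (- real d) * real N * ((l / l1) ^ d * (1 / ln 2 ^ d * ln (real N) ^ d))"
      using \<rho>[of d] by (intro mult_left_mono mult_mono) auto
    also have "\<dots> = 1 / ln 2 ^ d * X" by (simp add: X_def)
    also have "\<dots> \<le> (1 + 1 / ln 2 ^ d) * (X + Y)" using ln2 X0 Y0 by (intro mult_mono) auto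
    finally show ?thesis by simp
  next
    case False
    then have "real N \<le> 1" by simp
    then have "\<theta> powr (- real d) * real N \<le> \<theta> powr (- (4 * real d)) * (l / l1) ^ m"
      using \<theta> \<rho>[of m] by (intro mult_mono powr_mono') auto
    also have "\<dots> = 1 * Y" by (simp add: Y_def)
    also have "\<dots> \<le> (1 + 1 / ln 2 ^ d) * (X + Y)" using ln2 X0 Y0 by (intro mult_mono) auto
    finally show ?thesis .
  qed
  then have "l1 powr (- (real d / 2)) * (\<theta> powr (- real d) * real N) \<le> l1 powr (- (real d / 2)) * ((1 + 1 / ln 2 ^ d) * (X + Y))"
    by (intro mult_left_mono) auto
  moreover have "real N * (1 / sqrt (\<theta> * l)) ^ d \<le> real N * (\<theta> powr (- real d) * l1 powr (- (real d / 2)))"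
    using base by (intro mult_left_mono) auto
  ultimately show ?thesis unfolding X_def[symmetric] Y_def[symmetric] by (simp add: mult_ac)
qed

theorem corollary1p4:
  shows "\<exists>C::real. C \<ge> 0 \<and>
    (\<forall>(\<Omega> :: 'a::euclidean_space set) lam.
       \<Omega> \<noteq> {} \<longrightarrow> open \<Omega> \<longrightarrow> essential_spectrum \<Omega> = {} \<longrightarrow> eigenvalue_enumeration \<Omega> lam \<longrightarrow>
       (\<forall>(\<theta>::real) (k::nat) \<Phi>.
          0 < \<theta> \<longrightarrow> \<theta> \<le> 1 \<longrightarrow> 1 \<le> k \<longrightarrow> eigenfunction \<Omega> (complex_of_real (lam k)) \<Phi> \<longrightarrow>
          (Lp_norm 1 \<Omega> \<Phi>)^2 \<le>
            ennreal (C * lam 1 powr (- (real DIM('a) / 2)) *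
              (\<theta> powr (- real DIM('a)) * (lam k / lam 1) ^ DIM('a)
                 * ln (real (eigenvalue_count \<Omega> ((1 + \<theta>) * lam k))) ^ DIM('a)
                 * real (eigenvalue_count \<Omega> ((1 + \<theta>) * lam k))
               + \<theta> powr (- (4 * real DIM('a))) * (lam k / lam 1) ^ (4 * DIM('a) - 3)))
            * (Lp_norm 2 \<Omega> \<Phi>)^2))"
proof -
  \<comment> \<open>A finite net of the ball of radius 2; it depends on the dimension alone, and so
    will \<open>C\<close>.\<close>
  obtain V :: "'a set" where V: "V \<subseteq> cball 0 2" "finite V" "cball 0 2 \<subseteq> (\<Union>v\<in>V. ball v 1)"
    by (rule compactE_image[of "cball 0 2 :: 'a set" "cball 0 2" "\<lambda>v. ball v 1"]) (auto intro: UN_I)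
  have Vne: "V \<noteq> {}"
  proof
    assume "V = {}"
    moreover have "(0::'a) \<in> cball 0 2" by simp
    ultimately show False using V(3) by blast
  qed
  define d where "d = DIM('a)"
  \<comment> \<open>Everything in the bound except \<open>N\<close> and the power of
    \<open>1 / sqrt (\<theta> * lam k)\<close> contained in that of \<open>r\<close>.\<close>
  define C0 where "C0 = 4 * unit_ball_vol (real d) * (4 * (sqrt 192 * real (card V))) ^ d"
  define C where "C = C0 * (1 + 1 / ln 2 ^ d)"
  have C0: "0 \<le> C0" by (simp add: C0_def)
  have C: "0 \<le> C" using C0 by (simp add: C_def)
  show ?thesis
  proof (intro exI[of _ C] conjI C allI impI)
    fix \<Omega> :: "'a set" and lam :: "nat \<Rightarrow> real" and \<theta> :: real and k :: nat and \<Phi>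
    assume \<Omega>: "open \<Omega>" "essential_spectrum \<Omega> = {}" and lam: "eigenvalue_enumeration \<Omega> lam"
      and \<theta>: "0 < \<theta>" "\<theta> \<le> 1" and k: "1 \<le> k" and \<Phi>: "eigenfunction \<Omega> (complex_of_real (lam k)) \<Phi>"
    interpret discrete_domain \<Omega> using \<Omega> by unfold_locales
    \<comment> \<open>The value \<open>lam 1\<close> occurs at index 1, so its multiplicity is
      positive and it is an eigenvalue, which gives \<open>0 < lam 1\<close>.\<close>
    have "finite {j. 1 \<le> j \<and> lam j = lam 1}"
      and mult: "has_multiplicity \<Omega> (complex_of_real (lam 1)) (card {j. 1 \<le> j \<and> lam j = lam 1})"
      using lam by (auto simp: eigenvalue_enumeration_def)
    then have "0 < card {j. 1 \<le> j \<and> lam j = lam 1}" by (auto simp: card_gt_0_iff)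
    then have l1: "0 < lam 1" using multiplicity_pos_eigenvalue[OF mult] eigenvalue_pos[OF \<Omega>(1)] by blast
    have l1k: "lam 1 \<le> lam k"
      using lam k unfolding eigenvalue_enumeration_def by (auto dest: mono_onD)
    define N where "N = eigenvalue_count \<Omega> ((1 + \<theta>) * lam k)"
    define r where "r = sqrt (192 / (\<theta> * lam k)) * real (card V)"
    have lap: "dirichlet_laplacian \<Omega> \<Phi> (\<lambda>x. complex_of_real (lam k) * \<Phi> x)"
      using \<Phi> by (simp add: eigenfunction_def eigenspace_def)
    have bound: "(Lp_norm 1 \<Omega> \<Phi>)\<^sup>2 \<le> ennreal (4 * (real N * (unit_ball_vol (real d) * (4 * r) ^ d))) * (Lp_norm 2 \<Omega> \<Phi>)\<^sup>2"
      unfolding N_def d_def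
      by (rule eigenfunction_L1_bound[OF lap _ \<theta>(1) V(2) Vne _ _ r_def]) (use l1 l1k V in auto)
    have "4 * (real N * (unit_ball_vol (real d) * (4 * r) ^ d)) = C0 * (real N * (1 / sqrt (\<theta> * lam k)) ^ d)"
      by (simp add: C0_def r_def real_sqrt_divide power_mult_distrib power_divide)
    also have "\<dots> \<le> C0 * ((1 + 1 / ln 2 ^ d) * (lam 1 powr (- (real d / 2)) *
       (\<theta> powr (- real d) * (lam k / lam 1) ^ d * ln (real N) ^ d * real N + \<theta> powr (- (4 * real d)) * (lam k / lam 1) ^ (4 * d - 3))))"
      using C0 \<theta> l1 l1k by (intro mult_left_mono count_factor_le) auto
    finally have "4 * (real N * (unit_ball_vol (real d) * (4 * r) ^ d)) \<le> C * lam 1 powr (- (real d / 2)) *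
       (\<theta> powr (- real d) * (lam k / lam 1) ^ d * ln (real N) ^ d * real N + \<theta> powr (- (4 * real d)) * (lam k / lam 1) ^ (4 * d - 3))"
      by (simp add: C_def mult.assoc)
    then have "ennreal (4 * (real N * (unit_ball_vol (real d) * (4 * r) ^ d))) * (Lp_norm 2 \<Omega> \<Phi>)\<^sup>2
        \<le> ennreal (C * lam 1 powr (- (real d / 2)) *
       (\<theta> powr (- real d) * (lam k / lam 1) ^ d * ln (real N) ^ d * real N + \<theta> powr (- (4 * real d)) * (lam k / lam 1) ^ (4 * d - 3))) * (Lp_norm 2 \<Omega> \<Phi>)\<^sup>2"
      by (intro mult_right_mono ennreal_leI) auto
    with bound show "(Lp_norm 1 \<Omega> \<Phi>)^2 \<le>
            ennreal (C * lam 1 powr (- (real DIM('a) / 2)) *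
              (\<theta> powr (- real DIM('a)) * (lam k / lam 1) ^ DIM('a)
                 * ln (real (eigenvalue_count \<Omega> ((1 + \<theta>) * lam k))) ^ DIM('a)
                 * real (eigenvalue_count \<Omega> ((1 + \<theta>) * lam k))
               + \<theta> powr (- (4 * real DIM('a))) * (lam k / lam 1) ^ (4 * DIM('a) - 3)))
            * (Lp_norm 2 \<Omega> \<Phi>)^2"
      unfolding N_def d_def by (rule order_trans)
  qed
qed

end
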